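(* The metric space $(\mathcal{D},\Box)$ of isomorphism classes of geometric data sets with the box distance is complete but not separable.
   Context: A geometric data set is a triple $X=(X,F_X,\mu_X)$ where $X$ is a non-empty set, $F_X$ is a non-empty set of functions $X\to\mathbb{R}$ such that $d_X(x,y):=\sup_{f\in F_X}|f(x)-f(y)|$ is finite for all $x,y\in X$ and is a complete separable metric on $X$, and $\mu_X$ is a Borel probability measure on $(X,d_X)$ with $\operatorname{supp}\mu_X=X$. $\mathrm{Lip}_1(X)$ denotes the set of 1-Lipschitz functions $(X,d_X)\to\mathbb{R}$; one has $F_X\subset \mathrm{Lip}_1(X)$, and $\overline{F_X}$ is the closure of $F_X$ in $\mathrm{Lip}_1(X)$ for pointwise convergence. For a family $F$ of functions and a map $\varphi$, $F\circ\varphi:=\{f\circ\varphi\mid f\in F\}$. Two geometric data sets $X,Y$ are isomorphic if there is a Borel measurable map $\varphi\colon X\to Y$ with $\varphi_*\mu_X=\mu_Y$ and $\overline{F_Y}\circ\varphi=\overline{F_X}$. $\mathcal{D}$ is the set of isomorphism classes of geometric data sets. $\Pi(\mu_X,\mu_Y)$ is the set of couplings: Borel probability measures $\pi$ on $X\times Y$ with marginals $\mu_X$ and $\mu_Y$. $\mathrm{pr}_1,\mathrm{pr}_2$ are the projections of $X\times Y$. For $S\subset X\times Y$, $d^S_\infty(f,g):=\sup_{s\in S}|f(s)-g(s)|$ (with $d^\emptyset_\infty\equiv0$), and $(d^S_\infty)_{\mathrm{H}}$ is the associated ($[0,+\infty]$-valued) Hausdorff distance between sets of functions on $X\times Y$.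 The box distance between geometric data sets is $$\Box(X,Y):=\inf_{\pi,S}\max\{1-\pi(S),\ 2(d^S_\infty)_{\mathrm{H}}(F_X\circ\mathrm{pr}_1,F_Y\circ\mathrm{pr}_2)\},$$ where $\pi$ runs over $\Pi(\mu_X,\mu_Y)$ and $S$ over all closed subsets of $X\times Y$. It is regarded as a distance on $\mathcal{D}$. *)

theory Defs
  imports "HOL-Probability.Probability"
begin

definition borel_of :: "'a topology \<Rightarrow> 'a measure" where
  "borel_of T = sigma (topspace T) {U. openin T U}"

definition supp_of :: "'a topology \<Rightarrow> 'a measure \<Rightarrow> 'a set" where
  "supp_of T \<mu> = {x \<in> topspace T. \<forall>U. openin T U \<and> x \<in> U \<longrightarrow> 0 < emeasure \<mu> U}"

section \<open>Geometric data sets\<close>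

record 'a gds =
  pts :: "'a set"
  feats :: "('a \<Rightarrow> real) set"
  law :: "'a measure"

text \<open>
  Since \<^const>\<open>Sup\<close> is unspecified on unbounded sets of reals, finiteness of the supremum is
  required separately in the definition of geometric data sets below. The value \<open>0\<close> off the
  carrier is needed because \<^locale>\<open>Metric_space\<close> demands nonnegativity and symmetry everywhere.
\<close>
definition gds_dist :: "'a gds \<Rightarrow> 'a \<Rightarrow> 'a \<Rightarrow> real" where
  "gds_dist X x y =
     (if x \<in> pts X \<and> y \<in> pts X then SUP f\<in>feats X. \<bar>f x - f y\<bar> else 0)"

definition gds_top :: "'a gds \<Rightarrow> 'a topology" where
  "gds_top X = Metric_space.mtopology (pts X) (gds_dist X)"

text \<open>Functions on the carrier \<open>X\<close> are the elements of \<open>X \<rightarrow>\<^sub>E UNIV\<close>, so that equality of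
  functions is equality on \<open>X\<close>.\<close>
definition geometric_data_set :: "'a gds \<Rightarrow> bool" where
  "geometric_data_set X \<longleftrightarrow>
     pts X \<noteq> {} \<and>
     feats X \<noteq> {} \<and>
     feats X \<subseteq> (pts X \<rightarrow>\<^sub>E UNIV) \<and>
     (\<forall>x\<in>pts X. \<forall>y\<in>pts X. bdd_above ((\<lambda>f. \<bar>f x - f y\<bar>) ` feats X)) \<and>
     Metric_space (pts X) (gds_dist X) \<and>
     Metric_space.mcomplete (pts X) (gds_dist X) \<and>
     separable_space (gds_top X) \<and>
     space (law X) = pts X \<and>
     sets (law X) = sets (borel_of (gds_top X)) \<and>
     prob_space (law X) \<and>
     supp_of (gds_top X) (law X) = pts X"

definition Lip1 :: "'a gds \<Rightarrow> ('a \<Rightarrow> real) set" where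
  "Lip1 X = {f \<in> pts X \<rightarrow>\<^sub>E UNIV. \<forall>x\<in>pts X. \<forall>y\<in>pts X. \<bar>f x - f y\<bar> \<le> gds_dist X x y}"

text \<open>The product topology on functions is the topology of pointwise convergence.\<close>
definition feats_closure :: "'a gds \<Rightarrow> ('a \<Rightarrow> real) set" where
  "feats_closure X =
     subtopology (product_topology (\<lambda>_. euclideanreal) (pts X)) (Lip1 X) closure_of feats X"

text \<open>\<open>F \<circ> \<phi>\<close> for a map \<open>\<phi>\<close> with domain \<open>A\<close>\<close>
definition precomp :: "'a set \<Rightarrow> ('b \<Rightarrow> 'c) set \<Rightarrow> ('a \<Rightarrow> 'b) \<Rightarrow> ('a \<Rightarrow> 'c) set" where
  "precomp A F \<phi> = (\<lambda>f. compose A f \<phi>) ` F"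

definition gds_iso :: "'a gds \<Rightarrow> 'b gds \<Rightarrow> bool" where
  "gds_iso X Y \<longleftrightarrow>
     (\<exists>\<phi> \<in> borel_of (gds_top X) \<rightarrow>\<^sub>M borel_of (gds_top Y).
        distr (law X) (borel_of (gds_top Y)) \<phi> = law Y \<and>
        precomp (pts X) (feats_closure Y) \<phi> = feats_closure X)"

text \<open>
  The set of isomorphism classes of geometric data sets with points in \<^typ>\<open>'a\<close>. Complete
  separable metric spaces have at most continuum many points, so as soon as \<^typ>\<open>real\<close> injects
  into \<^typ>\<open>'a\<close>, every geometric data set, over any type, is isomorphic to one counted here.
\<close>
definition gds_classes :: "'a gds set set" where
  "gds_classes =
     {X. geometric_data_set X} //
     {(X, Y). geometric_data_set X \<and> geometric_data_set Y \<and> gds_iso X Y}"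

section \<open>Box distance\<close>

definition couplings :: "'a gds \<Rightarrow> 'b gds \<Rightarrow> ('a \<times> 'b) measure set" where
  "couplings X Y =
     {\<pi>. space \<pi> = pts X \<times> pts Y \<and>
         sets \<pi> = sets (borel_of (prod_topology (gds_top X) (gds_top Y))) \<and>
         prob_space \<pi> \<and>
         distr \<pi> (borel_of (gds_top X)) fst = law X \<and>
         distr \<pi> (borel_of (gds_top Y)) snd = law Y}"

text \<open>In \<^typ>\<open>ennreal\<close> the supremum over the empty set is \<open>0\<close>.\<close>
definition sup_dist :: "'s set \<Rightarrow> ('s \<Rightarrow> real) \<Rightarrow> ('s \<Rightarrow> real) \<Rightarrow> ennreal" where
  "sup_dist S f g = (SUP s\<in>S. ennreal \<bar>f s - g s\<bar>)"

definition hausdorff_dist :: "('x \<Rightarrow> 'x \<Rightarrow> ennreal) \<Rightarrow> 'x set \<Rightarrow> 'x set \<Rightarrow> ennreal" where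
  "hausdorff_dist d A B =
     max (SUP a\<in>A. INF b\<in>B. d a b) (SUP b\<in>B. INF a\<in>A. d a b)"

definition box_dist :: "'a gds \<Rightarrow> 'b gds \<Rightarrow> ennreal" where
  "box_dist X Y =
     (INF (\<pi>, S) \<in> couplings X Y \<times> {S. closedin (prod_topology (gds_top X) (gds_top Y)) S}.
        max (ennreal (1 - measure \<pi> S))
            (2 * hausdorff_dist (sup_dist S)
                   (precomp (pts X \<times> pts Y) (feats X) fst)
                   (precomp (pts X \<times> pts Y) (feats Y) snd)))"

text \<open>
  The box distance as a function on isomorphism classes: \<^const>\<open>the_elem\<close> picks the common value
  of \<^const>\<open>box_dist\<close> on all pairs of representatives. It is at most \<open>1\<close> (take \<open>S = {}\<close>), so
  \<^const>\<open>enn2real\<close> loses nothing. The value \<open>0\<close> off \<^const>\<open>gds_classes\<close> plays the same role as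
  in \<^const>\<open>gds_dist\<close>.
\<close>
definition box_dist_classes :: "'a gds set \<Rightarrow> 'a gds set \<Rightarrow> real" where
  "box_dist_classes A B =
     (if A \<in> gds_classes \<and> B \<in> gds_classes
      then enn2real (the_elem ((\<lambda>(X, Y). box_dist X Y) ` (A \<times> B))) else 0)"

end

(* The box distance only involves couplings and relations between the feature sets: box_dist X Y < c
   iff some coupling gives mass at least 1 - c to the set where related features differ by at most
   c / 2, for a relation that is full on both sides. The gluing of couplings, needed for the triangle
   inequality and for the limit of a Cauchy sequence, is done by kernels obtained from conditioning
   on the cells of a fine countable partition; since features are 1-Lipschitz, this loses only an
   arbitrarily small amount. At distance zero an isometry is extracted by a diagonal argument. The
   limit of a fast Cauchy sequence lives on the trajectories of a Markov chain with these kernels.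
   Non-separability is already visible on one-point spaces. *)

theory Submission
  imports Defs "HOL-Library.Diagonal_Subsequence"
begin

section \<open>Geometric data sets as metric measure spaces\<close>

text \<open>The relation \<open>near\<close> keeps apart the two quantities whose maximum enters the
  box distance: \<open>a\<close> bounds the mass lost and \<open>b\<close> the error of the
  features. Under composition they add up separately, and conditioning on cells costs only in
  \<open>b\<close>, by the diameter of the cells. Correspondences between features replace the
  Hausdorff distance because they compose, and because consecutive ones link up to chains along
  which limits can be taken. They also control the metrics: \<open>gds_dist\<close> is a supremum
  over features, so on pairs where related features agree up to \<open>b\<close> the distances agree
  up to \<open>2 * b\<close>. Isometries and distance estimates come out of the box distance in this
  way. The points of a limit first arise as real functions on a set of features, while all spaces
  have to share the point type \<open>'a\<close>; the injection of the reals into \<open>'a\<close>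
  is there to code them, a separable metric space having at most continuum many points.\<close>

lemma sets_borel_of: "sets (borel_of T) = sigma_sets (topspace T) {U. openin T U}"
  unfolding borel_of_def by (rule sets_measure_of) (auto dest: openin_subset)

lemma space_borel_of [simp]: "space (borel_of T) = topspace T"
  unfolding borel_of_def by (rule space_measure_of) (auto dest: openin_subset)

lemma openin_borel_of: "openin T U \<Longrightarrow> U \<in> sets (borel_of T)"
  by (simp add: sets_borel_of sigma_sets.Basic)

lemma measurable_borel_ofI:
  assumes "f \<in> space M \<rightarrow> topspace T"
    and "\<And>U. openin T U \<Longrightarrow> f -` U \<inter> space M \<in> sets M"
  shows "f \<in> M \<rightarrow>\<^sub>M borel_of T"
proof (rule measurable_sigma_sets[OF sets_borel_of])
  show "{U. openin T U} \<subseteq> Pow (topspace T)" by (auto dest: openin_subset)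
qed (use assms in auto)

lemma measurable_borel_of_continuous:
  assumes "continuous_map T T' f"
  shows "f \<in> borel_of T \<rightarrow>\<^sub>M borel_of T'"
proof (rule measurable_borel_ofI)
  show "f \<in> space (borel_of T) \<rightarrow> topspace T'"
    using assms by (simp add: continuous_map_def)
next
  fix U assume "openin T' U"
  with assms have "openin T {x \<in> topspace T. f x \<in> U}"
    by (simp add: continuous_map_def)
  moreover have "f -` U \<inter> space (borel_of T) = {x \<in> topspace T. f x \<in> U}" by auto
  ultimately show "f -` U \<inter> space (borel_of T) \<in> sets (borel_of T)"
    by (simp add: openin_borel_of)
qed

locale gds_space =
  fixes X :: "'a gds"
  assumes gds: "geometric_data_set X"
begin

sublocale Metric_space "pts X" "gds_dist X"
  using gds by (simp add: geometric_data_set_def)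

lemma gds_top_eq: "gds_top X = mtopology"
  by (simp add: gds_top_def)

lemma topspace_gds [simp]: "topspace (gds_top X) = pts X"
  by (simp add: gds_top_eq)

lemma pts_nonempty: "pts X \<noteq> {}" and feats_nonempty: "feats X \<noteq> {}"
  and mcomplete: "mcomplete" and separable: "separable_space mtopology"
  and space_law [simp]: "space (law X) = pts X"
  and sets_law: "sets (law X) = sets (borel_of mtopology)"
  and supp_law: "supp_of mtopology (law X) = pts X"
  using gds by (auto simp: geometric_data_set_def gds_top_eq)

sublocale law: prob_space "law X"
  using gds by (simp add: geometric_data_set_def)

lemma feats_ext: "f \<in> feats X \<Longrightarrow> f \<in> pts X \<rightarrow>\<^sub>E UNIV"
  using gds by (auto simp: geometric_data_set_def)

lemma bdd_feats: "x \<in> pts X \<Longrightarrow> y \<in> pts X \<Longrightarrow> bdd_above ((\<lambda>f. \<bar>f x - f y\<bar>) ` feats X)"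
  using gds by (auto simp: geometric_data_set_def)

lemma gds_dist_eq: "x \<in> pts X \<Longrightarrow> y \<in> pts X \<Longrightarrow> gds_dist X x y = (SUP f\<in>feats X. \<bar>f x - f y\<bar>)"
  by (simp add: gds_dist_def)

lemma feat_lipschitz:
  assumes "f \<in> feats X" "x \<in> pts X" "y \<in> pts X"
  shows "\<bar>f x - f y\<bar> \<le> gds_dist X x y"
  using assms by (auto simp: gds_dist_eq intro!: cSUP_upper bdd_feats)

lemma dist_le:
  assumes "x \<in> pts X" "y \<in> pts X" "\<And>f. f \<in> feats X \<Longrightarrow> \<bar>f x - f y\<bar> \<le> b"
  shows "gds_dist X x y \<le> b"
  using assms feats_nonempty by (auto simp: gds_dist_eq intro!: cSUP_least)

lemma openin_sets: "openin mtopology U \<Longrightarrow> U \<in> sets (law X)"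
  by (simp add: sets_law openin_borel_of)

lemma mball_sets [measurable]: "mball x r \<in> sets (law X)"
  by (simp add: openin_sets)

lemma closedin_sets: "closedin mtopology C \<Longrightarrow> C \<in> sets (law X)"
proof -
  assume C: "closedin mtopology C"
  then have "pts X - C \<in> sets (law X)"
    using openin_sets by (auto simp: closedin_def)
  then have "space (law X) - (pts X - C) \<in> sets (law X)"
    by (rule sets.compl_sets)
  moreover have "space (law X) - (pts X - C) = C"
    using closedin_subset[OF C] by auto
  ultimately show ?thesis by simp
qed

lemma mball_pos: "x \<in> pts X \<Longrightarrow> 0 < r \<Longrightarrow> 0 < measure (law X) (mball x r)"
proof -
  assume "x \<in> pts X" "0 < r"
  then have "x \<in> supp_of mtopology (law X)" "openin mtopology (mball x r)" "x \<in> mball x r"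
    using supp_law by auto
  then have "0 < emeasure (law X) (mball x r)"
    unfolding supp_of_def by blast
  then show ?thesis
    by (simp add: law.emeasure_eq_measure)
qed

text \<open>A sequence rather than a countable set, so that the balls around its first
  \<open>J\<close> terms can exhaust the mass.\<close>

definition dense_seq :: "(nat \<Rightarrow> 'a) \<Rightarrow> bool" where
  "dense_seq c \<longleftrightarrow> range c \<subseteq> pts X \<and> (\<forall>x\<in>pts X. \<forall>e>0. \<exists>i. gds_dist X (c i) x < e)"

lemma ex_dense_seq: "\<exists>c. dense_seq c"
proof -
  obtain D where D: "countable D" "D \<subseteq> pts X" "mtopology closure_of D = pts X"
    using separable unfolding separable_space_def by auto
  have "D \<noteq> {}" using D pts_nonempty by auto
  define c where "c = from_nat_into D"
  have r: "range c = D"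
    unfolding c_def using range_from_nat_into[OF \<open>D \<noteq> {}\<close> D(1)] .
  have "\<exists>i. gds_dist X (c i) x < e" if "x \<in> pts X" and e: "e > 0" for x e
  proof -
    have "x \<in> mtopology closure_of D" using that D by auto
    then obtain y where "y \<in> D" "y \<in> mball x e"
      unfolding metric_closure_of using e by auto
    moreover then obtain i where "c i = y" using r by auto
    ultimately show ?thesis by (auto simp: commute)
  qed
  with r D show ?thesis unfolding dense_seq_def by blast
qed

lemma dense_seqD: "dense_seq c \<Longrightarrow> c i \<in> pts X"
  "dense_seq c \<Longrightarrow> x \<in> pts X \<Longrightarrow> e > 0 \<Longrightarrow> \<exists>i. gds_dist X (c i) x < e"
  unfolding dense_seq_def by auto

text \<open>The balls around all terms cover the space, so continuity of the measure from below
  leaves finitely many with almost full mass. Such finite unions take the place of compact sets of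
  large measure.\<close>

lemma finite_balls_large:
  assumes "dense_seq c" "r > 0" "e > 0"
  obtains J :: nat where "measure (law X) (\<Union>i<J. mball (c i) r) > 1 - e"
proof -
  define A where "A J = (\<Union>i<J. mball (c i) r)" for J :: nat
  have U: "(\<Union>J. A J) = pts X"
  proof (intro equalityI subsetI)
    fix x assume "x \<in> pts X"
    then obtain i where "gds_dist X (c i) x < r" using dense_seqD(2)[OF assms(1)] assms(2) by blast
    then have "x \<in> A (Suc i)"
      using \<open>x \<in> pts X\<close> dense_seqD(1)[OF assms(1)] by (auto simp: A_def)
    then show "x \<in> (\<Union>J. A J)" by blast
  qed (auto simp: A_def)
  have inc: "incseq A" unfolding incseq_def A_def by fastforce
  have "(\<lambda>J. measure (law X) (A J)) \<longlonglongrightarrow> measure (law X) (\<Union>J. A J)"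
    by (rule law.finite_Lim_measure_incseq) (use inc in \<open>auto simp: A_def[abs_def]\<close>)
  then have lim: "(\<lambda>J. measure (law X) (A J)) \<longlonglongrightarrow> 1"
    using law.prob_space U by simp
  have "\<forall>\<^sub>F J in sequentially. measure (law X) (A J) > 1 - e"
    by (rule order_tendstoD(1)[OF lim]) (use assms in auto)
  then obtain J where "measure (law X) (A J) > 1 - e"
    by (auto simp: eventually_sequentially)
  then show ?thesis using that by (auto simp: A_def)
qed

lemma feat_continuous: "f \<in> feats X \<Longrightarrow> continuous_map mtopology euclideanreal f"
proof -
  assume f: "f \<in> feats X"
  have "\<exists>d>0. \<forall>x. x \<in> pts X \<and> gds_dist X a x < d \<longrightarrow> dist (f a) (f x) < e"
    if "a \<in> pts X" "e > 0" for a e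
  proof (intro exI[of _ e] conjI allI impI)
    fix x assume "x \<in> pts X \<and> gds_dist X a x < e"
    then show "dist (f a) (f x) < e"
      using feat_lipschitz[OF f, of a x] that by (simp add: dist_real_def)
  qed fact
  then have "continuous_map mtopology (Met_TC.mtopology) f"
    unfolding metric_continuous_map[OF Met_TC.Metric_space_axioms] by blast
  then show ?thesis by simp
qed

lemma dist_measurable: "x \<in> pts X \<Longrightarrow> gds_dist X x \<in> borel_measurable (law X)"
proof (rule borel_measurableI_less)
  fix r assume x: "x \<in> pts X"
  have "{y \<in> space (law X). gds_dist X x y < r} = mball x r" using x by auto
  then show "{y \<in> space (law X). gds_dist X x y < r} \<in> sets (law X)" by simp
qed

end

section \<open>Borel sets of the product and couplings\<close>

lemma openin_prod_sets:
  assumes "geometric_data_set X" "geometric_data_set Y"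
    and U: "openin (prod_topology (gds_top X) (gds_top Y)) U"
  shows "U \<in> sets (law X \<Otimes>\<^sub>M law Y)"
proof -
  interpret X: gds_space X using assms by unfold_locales
  interpret Y: gds_space Y using assms by unfold_locales
  obtain c where c: "X.dense_seq c" using X.ex_dense_seq by blast
  obtain c' where c': "Y.dense_seq c'" using Y.ex_dense_seq by blast
  \<comment> \<open>A countable base of the product topology. Separability enters here: an open set
    becomes a countable union of measurable rectangles.\<close>
  define B where "B = (\<lambda>(i, j, k). X.mball (c i) (1 / real (Suc k)) \<times> Y.mball (c' j) (1 / real (Suc k)))"
  define I where "I = {t. B t \<subseteq> U}"
  have "U = (\<Union>t\<in>I. B t)"
  proof (intro equalityI subsetI)
    fix p assume p: "p \<in> U"
    obtain x y where xy: "p = (x, y)" by (cases p)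
    obtain V W where VW: "openin X.mtopology V" "openin Y.mtopology W" "x \<in> V" "y \<in> W" "V \<times> W \<subseteq> U"
      using U p unfolding xy openin_prod_topology_alt X.gds_top_eq Y.gds_top_eq by meson
    have xin: "x \<in> pts X" and yin: "y \<in> pts Y"
      using openin_subset[OF VW(1)] openin_subset[OF VW(2)] VW(3,4) by auto
    obtain r where r: "r > 0" "X.mball x r \<subseteq> V" using VW(1,3) unfolding X.openin_mtopology by blast
    obtain s where s: "s > 0" "Y.mball y s \<subseteq> W" using VW(2,4) unfolding Y.openin_mtopology by blast
    \<comment> \<open>The factor 2 is there because a ball of radius \<open>e\<close> around a
      centre within \<open>e\<close> of \<open>x\<close> lies in the ball of radius
      \<open>2 * e\<close> around \<open>x\<close>.\<close>
    obtain k where k: "1 / real (Suc k) < min r s / 2"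
      using nat_approx_posE[of "min r s / 2"] r s by auto
    define e where "e = 1 / real (Suc k)"
    have e: "e > 0" "2 * e < r" "2 * e < s" using k unfolding e_def by auto
    obtain i where i: "gds_dist X (c i) x < e" using X.dense_seqD(2)[OF c xin e(1)] by blast
    obtain j where j: "gds_dist Y (c' j) y < e" using Y.dense_seqD(2)[OF c' yin e(1)] by blast
    have ci: "c i \<in> pts X" and cj: "c' j \<in> pts Y"
      using X.dense_seqD(1)[OF c] Y.dense_seqD(1)[OF c'] by auto
    have "X.mball (c i) e \<subseteq> X.mball x r"
    proof
      fix z assume "z \<in> X.mball (c i) e"
      then show "z \<in> X.mball x r"
        using X.triangle[of x "c i" z] i e ci xin by (auto simp: X.commute)
    qed
    moreover have "Y.mball (c' j) e \<subseteq> Y.mball y s"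
    proof
      fix z assume "z \<in> Y.mball (c' j) e"
      then show "z \<in> Y.mball y s"
        using Y.triangle[of y "c' j" z] j e cj yin by (auto simp: Y.commute)
    qed
    ultimately have "B (i, j, k) \<subseteq> U"
      using r(2) s(2) VW(5) unfolding B_def prod.case e_def[symmetric] by blast
    moreover have "p \<in> B (i, j, k)"
      using i j ci cj xin yin xy unfolding B_def e_def by auto
    ultimately show "p \<in> (\<Union>t\<in>I. B t)" unfolding I_def by blast
  qed (auto simp: I_def)
  moreover have "(\<Union>t\<in>I. B t) \<in> sets (law X \<Otimes>\<^sub>M law Y)"
    by (rule sets.countable_UN') (auto simp: B_def)
  ultimately show ?thesis by simp
qed

text \<open>Continuity of the two projections gives the inclusion converse to
  \<open>openin_prod_sets\<close>.\<close>

lemma sets_prod_borel: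
  assumes "geometric_data_set X" "geometric_data_set Y"
  shows "sets (borel_of (prod_topology (gds_top X) (gds_top Y))) = sets (law X \<Otimes>\<^sub>M law Y)"
proof -
  interpret X: gds_space X using assms by unfold_locales
  interpret Y: gds_space Y using assms by unfold_locales
  let ?T = "prod_topology (gds_top X) (gds_top Y)"
  have "sets (borel_of ?T) \<subseteq> sets (law X \<Otimes>\<^sub>M law Y)"
    unfolding sets_borel_of
    using sets.sigma_sets_subset[of "{U. openin ?T U}" "law X \<Otimes>\<^sub>M law Y"] openin_prod_sets[OF assms]
    by (auto simp: space_pair_measure)
  moreover have "sets (law X \<Otimes>\<^sub>M law Y) \<subseteq> sets (borel_of ?T)"
  proof -
    have 1: "fst \<in> borel_of ?T \<rightarrow>\<^sub>M law X"
      using measurable_borel_of_continuous[OF continuous_map_fst, of "gds_top X" "gds_top Y"]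
      by (simp add: measurable_cong_sets[OF refl X.sets_law] X.gds_top_eq)
    have 2: "snd \<in> borel_of ?T \<rightarrow>\<^sub>M law Y"
      using measurable_borel_of_continuous[OF continuous_map_snd, of "gds_top X" "gds_top Y"]
      by (simp add: measurable_cong_sets[OF refl Y.sets_law] Y.gds_top_eq)
    have "(\<lambda>p. p) \<in> borel_of ?T \<rightarrow>\<^sub>M law X \<Otimes>\<^sub>M law Y"
      using measurable_Pair[OF 1 2] by simp
    note id = this
    show ?thesis
    proof
      fix A assume A: "A \<in> sets (law X \<Otimes>\<^sub>M law Y)"
      then have "A \<subseteq> pts X \<times> pts Y"
        using sets.sets_into_space[OF A] by (simp add: space_pair_measure)
      then have "(\<lambda>p. p) -` A \<inter> space (borel_of ?T) = A" by auto
      then show "A \<in> sets (borel_of ?T)" using measurable_sets[OF id A] by simp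
    qed
  qed
  ultimately show ?thesis by blast
qed

text \<open>Moves the Borel structure of the definition over to the laws, so that measure theory on
  \<open>law X \<Otimes>\<^sub>M law Y\<close> applies.\<close>

lemma couplings_iff:
  assumes X: "geometric_data_set X" and Y: "geometric_data_set Y"
  shows "\<pi> \<in> couplings X Y \<longleftrightarrow> sets \<pi> = sets (law X \<Otimes>\<^sub>M law Y) \<and> prob_space \<pi> \<and>
     distr \<pi> (law X) fst = law X \<and> distr \<pi> (law Y) snd = law Y"
proof -
  interpret X: gds_space X using assms by unfold_locales
  interpret Y: gds_space Y using assms by unfold_locales
  have 1: "distr \<pi> (borel_of (gds_top X)) fst = distr \<pi> (law X) fst" for \<pi> :: "('a \<times> 'b) measure"
    by (rule distr_cong) (auto simp: X.sets_law X.gds_top_eq)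
  have 2: "distr \<pi> (borel_of (gds_top Y)) snd = distr \<pi> (law Y) snd" for \<pi> :: "('a \<times> 'b) measure"
    by (rule distr_cong) (auto simp: Y.sets_law Y.gds_top_eq)
  have 3: "sets \<pi> = sets (law X \<Otimes>\<^sub>M law Y) \<Longrightarrow> space \<pi> = pts X \<times> pts Y"
    using sets_eq_imp_space_eq[of \<pi> "law X \<Otimes>\<^sub>M law Y"] by (simp add: space_pair_measure)
  show ?thesis
    unfolding couplings_def sets_prod_borel[OF X Y] 1 2 using 3 by auto
qed

section \<open>Couplings and relations between features\<close>

text \<open>A correspondence, as used for the Gromov-Hausdorff distance: a Hausdorff bound between
  two sets amounts to a correspondence whose related members are close.\<close>

definition full_rel :: "'a gds \<Rightarrow> 'b gds \<Rightarrow> (('a \<Rightarrow> real) \<times> ('b \<Rightarrow> real)) set \<Rightarrow> bool" where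
  "full_rel X Y R \<longleftrightarrow> R \<subseteq> feats X \<times> feats Y \<and> fst ` R = feats X \<and> snd ` R = feats Y"

text \<open>The largest set on which all related features differ by at most \<open>b\<close>; it
  removes the choice of \<open>S\<close> from the box distance.\<close>

definition agree :: "'a gds \<Rightarrow> 'b gds \<Rightarrow> (('a \<Rightarrow> real) \<times> ('b \<Rightarrow> real)) set \<Rightarrow> real \<Rightarrow> ('a \<times> 'b) set" where
  "agree X Y R b = {(x, y) \<in> pts X \<times> pts Y. \<forall>(f, g)\<in>R. \<bar>f x - g y\<bar> \<le> b}"

definition near :: "'a gds \<Rightarrow> 'b gds \<Rightarrow> real \<Rightarrow> real \<Rightarrow> bool" where
  "near X Y a b \<longleftrightarrow> (\<exists>\<pi>\<in>couplings X Y. \<exists>R. full_rel X Y R \<and> 1 - a \<le> measure \<pi> (agree X Y R b))"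

text \<open>This is \<open>near\<close> for the coupling that draws \<open>x\<close> from
  \<open>law X\<close> and then \<open>y\<close> from \<open>\<kappa> x\<close>, expressed without a
  joint measure. The integral is the mass that this coupling puts off \<open>agree\<close>.\<close>

definition kernel_near :: "'a gds \<Rightarrow> 'b gds \<Rightarrow> real \<Rightarrow> real \<Rightarrow> bool" where
  "kernel_near X Y a b \<longleftrightarrow>
     (\<exists>\<kappa> \<in> law X \<rightarrow>\<^sub>M prob_algebra (law Y). law X \<bind> \<kappa> = law Y \<and>
        (\<exists>R. full_rel X Y R \<and>
          (\<integral>\<^sup>+x. emeasure (\<kappa> x) {y \<in> pts Y. (x, y) \<notin> agree X Y R b} \<partial>law X) \<le> ennreal a))"

lemma full_relD:
  assumes "full_rel X Y R"
  shows "(f, g) \<in> R \<Longrightarrow> f \<in> feats X" "(f, g) \<in> R \<Longrightarrow> g \<in> feats Y"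
    "f \<in> feats X \<Longrightarrow> \<exists>g. (f, g) \<in> R" "g \<in> feats Y \<Longrightarrow> \<exists>f. (f, g) \<in> R"
  using assms unfolding full_rel_def by force+

lemma full_relI:
  assumes "\<And>f g. (f, g) \<in> R \<Longrightarrow> f \<in> feats X \<and> g \<in> feats Y"
    "\<And>f. f \<in> feats X \<Longrightarrow> \<exists>g. (f, g) \<in> R" "\<And>g. g \<in> feats Y \<Longrightarrow> \<exists>f. (f, g) \<in> R"
  shows "full_rel X Y R"
  using assms unfolding full_rel_def by force

lemma full_rel_relcomp: "full_rel X Y R \<Longrightarrow> full_rel Y Z Q \<Longrightarrow> full_rel X Z (R O Q)"
  by (rule full_relI) (blast dest: full_relD)+

lemma agree_iff: "(x, y) \<in> agree X Y R b \<longleftrightarrow>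
    x \<in> pts X \<and> y \<in> pts Y \<and> (\<forall>f g. (f, g) \<in> R \<longrightarrow> \<bar>f x - g y\<bar> \<le> b)"
  by (auto simp: agree_def)

lemma agree_relcomp:
  assumes "(x, y) \<in> agree X Y R b" "(y, z) \<in> agree Y Z Q c"
  shows "(x, z) \<in> agree X Z (R O Q) (b + c)"
proof -
  have "\<bar>f x - h z\<bar> \<le> b + c" if fh: "(f, h) \<in> R O Q" for f h
  proof -
    obtain g where "(f, g) \<in> R" "(g, h) \<in> Q" using fh by blast
    then have "\<bar>f x - g y\<bar> \<le> b" "\<bar>g y - h z\<bar> \<le> c" using assms by (auto simp: agree_iff)
    then show ?thesis by linarith
  qed
  then show ?thesis using assms by (auto simp: agree_iff)
qed

lemma agree_mono: "b \<le> c \<Longrightarrow> agree X Y R b \<subseteq> agree X Y R c"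
  by (force simp: agree_def)

text \<open>Features are 1-Lipschitz. The lemma serves for \<open>x\<close> and \<open>x'\<close> in
  one cell of a partition of \<open>X\<close>.\<close>

lemma agree_perturb:
  assumes X: "geometric_data_set X" and R: "full_rel X Y R"
    and "(x, y) \<in> agree X Y R b" "x' \<in> pts X" "gds_dist X x x' \<le> e"
  shows "(x', y) \<in> agree X Y R (b + e)"
proof -
  interpret X: gds_space X using X by unfold_locales
  have "\<bar>f x' - g y\<bar> \<le> b + e" if "(f, g) \<in> R" for f g
    using X.feat_lipschitz[of f x x'] full_relD(1)[OF R that] that assms(3-5) by (fastforce simp: agree_iff)
  then show ?thesis using assms by (auto simp: agree_iff)
qed

text \<open>A difference of two feature values picks up the error \<open>b\<close> once at each
  point, and the metrics are suprema of such differences. Fullness on either side yields one of the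
  two inequalities.\<close>

lemma agree_dist_le:
  assumes X: "geometric_data_set X" and R: "full_rel X Y R"
    and Y: "geometric_data_set Y"
    and xy: "(x, y) \<in> agree X Y R b" "(x', y') \<in> agree X Y R b"
  shows "\<bar>gds_dist X x x' - gds_dist Y y y'\<bar> \<le> 2 * b"
proof -
  interpret X: gds_space X using X by unfold_locales
  interpret Y: gds_space Y using Y by unfold_locales
  have ab: "\<bar>f x - g y\<bar> \<le> b" "\<bar>f x' - g y'\<bar> \<le> b" if "(f, g) \<in> R" for f g
    using xy that by (auto simp: agree_iff)
  have pts: "x \<in> pts X" "x' \<in> pts X" "y \<in> pts Y" "y' \<in> pts Y"
    using xy by (auto simp: agree_iff)
  have "gds_dist X x x' \<le> gds_dist Y y y' + 2 * b"
  proof (rule X.dist_le)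
    fix f assume "f \<in> feats X"
    then obtain g where g: "(f, g) \<in> R" using full_relD(3)[OF R] by blast
    then show "\<bar>f x - f x'\<bar> \<le> gds_dist Y y y' + 2 * b"
      using ab[OF g] Y.feat_lipschitz[of g y y'] full_relD(2)[OF R g] pts by linarith
  qed (use pts in auto)
  moreover have "gds_dist Y y y' \<le> gds_dist X x x' + 2 * b"
  proof (rule Y.dist_le)
    fix g assume "g \<in> feats Y"
    then obtain f where g: "(f, g) \<in> R" using full_relD(4)[OF R] by blast
    then show "\<bar>g y - g y'\<bar> \<le> gds_dist X x x' + 2 * b"
      using ab[OF g] X.feat_lipschitz[of f x x'] full_relD(1)[OF R g] pts by linarith
  qed (use pts in auto)
  ultimately show ?thesis by linarith
qed

lemma closedin_agree:
  assumes X: "geometric_data_set X" and Y: "geometric_data_set Y" and R: "full_rel X Y R"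
  shows "closedin (prod_topology (gds_top X) (gds_top Y)) (agree X Y R b)"
proof -
  interpret X: gds_space X using X by unfold_locales
  interpret Y: gds_space Y using Y by unfold_locales
  let ?T = "prod_topology (gds_top X) (gds_top Y)"
  have "closedin ?T {p \<in> topspace ?T. f (fst p) - g (snd p) \<in> {-b..b}}" if fg: "(f, g) \<in> R" for f g
  proof (rule closedin_continuous_map_preimage[where Y=euclideanreal])
    have "continuous_map ?T euclideanreal (f \<circ> fst)" "continuous_map ?T euclideanreal (g \<circ> snd)"
      using X.feat_continuous[OF full_relD(1)[OF R fg]] Y.feat_continuous[OF full_relD(2)[OF R fg]]
      by (auto intro!: continuous_map_compose[where X'="gds_top X"] continuous_map_compose[where X'="gds_top Y"]
          continuous_map_fst continuous_map_snd simp: X.gds_top_eq Y.gds_top_eq)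
    then show "continuous_map ?T euclideanreal (\<lambda>p. f (fst p) - g (snd p))"
      using continuous_map_diff[of ?T "f \<circ> fst" "g \<circ> snd"] by (simp add: comp_def)
  qed simp
  \<comment> \<open>The intersection over an empty \<open>R\<close> would be the whole type instead
    of the product of the carriers.\<close>
  moreover have "R \<noteq> {}" using R X.feats_nonempty unfolding full_rel_def by auto
  moreover have "agree X Y R b = (\<Inter>(f, g)\<in>R. {p \<in> topspace ?T. f (fst p) - g (snd p) \<in> {-b..b}})"
    using \<open>R \<noteq> {}\<close> by (force simp: agree_def abs_le_iff)
  ultimately show ?thesis by (auto intro!: closedin_INT)
qed

lemma agree_sets:
  assumes X: "geometric_data_set X" and Y: "geometric_data_set Y" and R: "full_rel X Y R"
  shows "agree X Y R b \<in> sets (law X \<Otimes>\<^sub>M law Y)"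
proof -
  interpret X: gds_space X using X by unfold_locales
  interpret Y: gds_space Y using Y by unfold_locales
  let ?T = "prod_topology (gds_top X) (gds_top Y)"
  have "topspace ?T - agree X Y R b \<in> sets (law X \<Otimes>\<^sub>M law Y)"
    using openin_prod_sets[OF X Y] closedin_agree[OF X Y R] by (simp add: closedin_def)
  from sets.compl_sets[OF this] show ?thesis
    using closedin_subset[OF closedin_agree[OF X Y R, of b]]
    by (simp add: space_pair_measure double_diff)
qed

lemma couplingsD:
  assumes X: "geometric_data_set X" and Y: "geometric_data_set Y" and "\<pi> \<in> couplings X Y"
  shows "prob_space \<pi>" "sets \<pi> = sets (law X \<Otimes>\<^sub>M law Y)" "space \<pi> = pts X \<times> pts Y"
    "distr \<pi> (law X) fst = law X" "distr \<pi> (law Y) snd = law Y"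
    "fst \<in> \<pi> \<rightarrow>\<^sub>M law X" "snd \<in> \<pi> \<rightarrow>\<^sub>M law Y"
    "A \<in> sets (law X) \<Longrightarrow> emeasure \<pi> (A \<times> pts Y) = emeasure (law X) A"
    "B \<in> sets (law Y) \<Longrightarrow> emeasure \<pi> (pts X \<times> B) = emeasure (law Y) B"
proof -
  interpret X: gds_space X using X by unfold_locales
  interpret Y: gds_space Y using Y by unfold_locales
  show *: "prob_space \<pi>" "sets \<pi> = sets (law X \<Otimes>\<^sub>M law Y)"
    "distr \<pi> (law X) fst = law X" "distr \<pi> (law Y) snd = law Y"
    using assms couplings_iff[OF X Y] by auto
  show sp: "space \<pi> = pts X \<times> pts Y"
    using sets_eq_imp_space_eq[OF *(2)] by (simp add: space_pair_measure)
  show m: "fst \<in> \<pi> \<rightarrow>\<^sub>M law X" "snd \<in> \<pi> \<rightarrow>\<^sub>M law Y"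
    by (simp_all add: measurable_cong_sets[OF *(2) refl])
  show "emeasure \<pi> (A \<times> pts Y) = emeasure (law X) A" if A: "A \<in> sets (law X)"
  proof -
    have "emeasure (law X) A = emeasure (distr \<pi> (law X) fst) A" using * by simp
    also have "\<dots> = emeasure \<pi> (fst -` A \<inter> space \<pi>)" by (rule emeasure_distr[OF m(1) A])
    also have "fst -` A \<inter> space \<pi> = A \<times> pts Y" using sets.sets_into_space[OF A] sp by auto
    finally show ?thesis by simp
  qed
  show "emeasure \<pi> (pts X \<times> B) = emeasure (law Y) B" if A: "B \<in> sets (law Y)"
  proof -
    have "emeasure (law Y) B = emeasure (distr \<pi> (law Y) snd) B" using * by simp
    also have "\<dots> = emeasure \<pi> (snd -` B \<inter> space \<pi>)" by (rule emeasure_distr[OF m(2) A])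
    also have "snd -` B \<inter> space \<pi> = pts X \<times> B" using sets.sets_into_space[OF A] sp by auto
    finally show ?thesis by simp
  qed
qed

section \<open>Translation between the box distance and \<open>near\<close>\<close>

lemma nearI:
  assumes "\<pi> \<in> couplings X Y" "full_rel X Y R" "1 - a \<le> measure \<pi> (agree X Y R b)"
  shows "near X Y a b"
  using assms unfolding near_def by blast

text \<open>Relating all features that differ by at most \<open>c / 2\<close> on \<open>S\<close>
  turns the Hausdorff bound into a correspondence. Strictness is what provides an actual partner
  below an infimum.\<close>

lemma near_if_box_less:
  assumes X: "geometric_data_set X" and Y: "geometric_data_set Y" and box: "box_dist X Y < ennreal c"
  shows "near X Y c (c / 2)"
proof -
  interpret X: gds_space X using X by unfold_locales
  interpret Y: gds_space Y using Y by unfold_locales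
  \<comment> \<open>For \<open>c \<le> 0\<close> the value \<open>ennreal c\<close> is 0, and
    nothing lies strictly below it.\<close>
  have c: "c > 0" using box by (metis ennreal_eq_0_iff not_less_zero not_le)
  let ?T = "prod_topology (gds_top X) (gds_top Y)"
  let ?p = "\<lambda>f. compose (pts X \<times> pts Y) f fst" and ?q = "\<lambda>g. compose (pts X \<times> pts Y) g snd"
  let ?F = "precomp (pts X \<times> pts Y) (feats X) fst" and ?G = "precomp (pts X \<times> pts Y) (feats Y) snd"
  obtain \<pi> S where \<pi>: "\<pi> \<in> couplings X Y" and S: "closedin ?T S"
    and less: "max (ennreal (1 - measure \<pi> S)) (2 * hausdorff_dist (sup_dist S) ?F ?G) < ennreal c"
    using box unfolding box_dist_def INF_less_iff by auto
  note \<pi>D = couplingsD[OF X Y \<pi>]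
  interpret \<pi>: prob_space \<pi> by (rule \<pi>D)
  have SS: "S \<subseteq> pts X \<times> pts Y" using closedin_subset[OF S] by simp
  let ?H = "hausdorff_dist (sup_dist S) ?F ?G"
  have H: "?H < ennreal (c / 2)"
  proof (rule ccontr)
    assume "\<not> ?H < ennreal (c / 2)"
    then have "2 * ennreal (c / 2) \<le> 2 * ?H" by (intro mult_left_mono) auto
    moreover have "2 * ennreal (c / 2) = ennreal c"
      using c by (simp add: ennreal_mult[symmetric] flip: ennreal_numeral)
    ultimately show False using less by auto
  qed
  define R where "R = {(f, g). f \<in> feats X \<and> g \<in> feats Y \<and> (\<forall>x y. (x, y) \<in> S \<longrightarrow> \<bar>f x - g y\<bar> \<le> c / 2)}"
  have sd: "(f, g) \<in> R" if "f \<in> feats X" "g \<in> feats Y"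
     and sd: "sup_dist S (?p f) (?q g) < ennreal (c / 2)" for f g
  proof -
    have "\<bar>f x - g y\<bar> \<le> c / 2" if xy: "(x, y) \<in> S" for x y
    proof -
      have "ennreal \<bar>f x - g y\<bar> \<le> sup_dist S (?p f) (?q g)"
        unfolding sup_dist_def using SS xy by (intro SUP_upper2[OF xy]) (auto simp: compose_def)
      also have "\<dots> \<le> ennreal (c / 2)" using sd by (rule less_imp_le)
      finally show ?thesis using c by (simp add: ennreal_le_iff)
    qed
    then show ?thesis using that unfolding R_def by auto
  qed
  have full: "full_rel X Y R"
  proof (rule full_relI)
    fix f assume f: "f \<in> feats X"
    have "(INF b\<in>?G. sup_dist S (?p f) b) \<le> ?H"
      unfolding hausdorff_dist_def using f by (intro max.coboundedI1 SUP_upper2[of "?p f"])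
        (auto simp: precomp_def)
    then have "(INF b\<in>?G. sup_dist S (?p f) b) < ennreal (c / 2)"
      using H by (rule order.strict_trans1)
    then show "\<exists>g. (f, g) \<in> R"
      unfolding INF_less_iff using sd[OF f] by (auto simp: precomp_def)
  next
    fix g assume g: "g \<in> feats Y"
    have "(INF a\<in>?F. sup_dist S a (?q g)) \<le> ?H"
      unfolding hausdorff_dist_def using g by (intro max.coboundedI2 SUP_upper2[of "?q g"])
        (auto simp: precomp_def)
    then have "(INF a\<in>?F. sup_dist S a (?q g)) < ennreal (c / 2)"
      using H by (rule order.strict_trans1)
    then show "\<exists>f. (f, g) \<in> R"
      unfolding INF_less_iff using sd[OF _ g] by (auto simp: precomp_def)
  qed (auto simp: R_def)
  have "S \<subseteq> agree X Y R (c / 2)"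
    using SS by (auto simp: agree_iff R_def)
  then have "measure \<pi> S \<le> measure \<pi> (agree X Y R (c / 2))"
    using agree_sets[OF X Y full] \<pi>D(2) by (intro \<pi>.finite_measure_mono) auto
  moreover have "1 - measure \<pi> S < c"
    using less c by (simp add: ennreal_less_iff)
  ultimately show ?thesis by (intro nearI[OF \<pi> full]) linarith
qed

text \<open>The set \<open>agree\<close> is closed, hence admissible as \<open>S\<close>. The bound
  obtained is not strict, so the two translations match only up to an arbitrarily small loss, and
  later arguments insert an intermediate constant.\<close>

lemma box_le_if_near:
  assumes X: "geometric_data_set X" and Y: "geometric_data_set Y" and near: "near X Y c (c / 2)" and "0 \<le> c"
  shows "box_dist X Y \<le> ennreal c"
proof -
  obtain \<pi> R where \<pi>: "\<pi> \<in> couplings X Y" and R: "full_rel X Y R"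
    and m: "1 - c \<le> measure \<pi> (agree X Y R (c / 2))"
    using near unfolding near_def by auto
  define S where "S = agree X Y R (c / 2)"
  let ?p = "\<lambda>f. compose (pts X \<times> pts Y) f fst" and ?q = "\<lambda>g. compose (pts X \<times> pts Y) g snd"
  let ?F = "precomp (pts X \<times> pts Y) (feats X) fst" and ?G = "precomp (pts X \<times> pts Y) (feats Y) snd"
  have sd: "sup_dist S (?p f) (?q g) \<le> ennreal (c / 2)"
    if "(f, g) \<in> R" for f g
    unfolding sup_dist_def
  proof (rule SUP_least)
    fix p assume "p \<in> S"
    then show "ennreal \<bar>?p f p - ?q g p\<bar> \<le> ennreal (c / 2)"
      using that by (cases p) (auto simp: S_def agree_iff compose_def intro!: ennreal_leI)
  qed
  have H: "hausdorff_dist (sup_dist S) ?F ?G \<le> ennreal (c / 2)"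
    unfolding hausdorff_dist_def
  proof (rule max.boundedI; rule SUP_least)
    fix a assume "a \<in> ?F"
    then obtain f where f: "f \<in> feats X" "a = ?p f" by (auto simp: precomp_def)
    obtain g where "(f, g) \<in> R" using full_relD(3)[OF R f(1)] by blast
    then show "(INF b\<in>?G. sup_dist S a b) \<le> ennreal (c / 2)"
      using full_relD(2)[OF R] f(2) sd by (intro INF_lower2[of "?q g"]) (auto simp: precomp_def)
  next
    fix b assume "b \<in> ?G"
    then obtain g where f: "g \<in> feats Y" "b = ?q g" by (auto simp: precomp_def)
    obtain f where "(f, g) \<in> R" using full_relD(4)[OF R f(1)] by blast
    then show "(INF a\<in>?F. sup_dist S a b) \<le> ennreal (c / 2)"
      using full_relD(1)[OF R] f(2) sd by (intro INF_lower2[of "?p f"]) (auto simp: precomp_def)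
  qed
  have "2 * hausdorff_dist (sup_dist S) ?F ?G \<le> 2 * ennreal (c / 2)"
    using H by (rule mult_left_mono) simp
  also have "\<dots> = ennreal c"
    using \<open>0 \<le> c\<close> by (simp add: ennreal_mult[symmetric] flip: ennreal_numeral)
  finally have "max (ennreal (1 - measure \<pi> S)) (2 * hausdorff_dist (sup_dist S) ?F ?G) \<le> ennreal c"
    using m by (auto simp: S_def intro!: ennreal_leI)
  then show ?thesis
    unfolding box_dist_def using \<pi> closedin_agree[OF X Y R, of "c / 2"]
    by (intro INF_lower2[of "(\<pi>, S)"]) (auto simp: S_def)
qed

section \<open>Symmetry and boundedness of the box distance\<close>

lemma near_sym:
  assumes X: "geometric_data_set X" and Y: "geometric_data_set Y" and near: "near X Y a b"
  shows "near Y X a b"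
proof -
  interpret X: gds_space X using X by unfold_locales
  interpret Y: gds_space Y using Y by unfold_locales
  obtain \<pi> R where \<pi>: "\<pi> \<in> couplings X Y" and R: "full_rel X Y R"
    and m: "1 - a \<le> measure \<pi> (agree X Y R b)"
    using near unfolding near_def by auto
  note \<pi>D = couplingsD[OF X Y \<pi>]
  let ?s = "\<lambda>p. (snd p, fst p)"
  let ?\<rho> = "distr \<pi> (law Y \<Otimes>\<^sub>M law X) ?s"
  have s: "?s \<in> \<pi> \<rightarrow>\<^sub>M law Y \<Otimes>\<^sub>M law X"
    using measurable_Pair[OF \<pi>D(7,6)] .
  have "distr ?\<rho> (law Y) fst = law Y" "distr ?\<rho> (law X) snd = law X"
    using \<pi>D(4,5) by (simp_all add: distr_distr[OF _ s] comp_def)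
  then have \<rho>: "?\<rho> \<in> couplings Y X"
    unfolding couplings_iff[OF Y X] using prob_space.prob_space_distr[OF \<pi>D(1) s] by simp
  have R': "full_rel Y X (R\<inverse>)"
    by (rule full_relI) (use full_relD[OF R] in auto)
  have "measure ?\<rho> (agree Y X (R\<inverse>) b) = measure \<pi> (?s -` agree Y X (R\<inverse>) b \<inter> space \<pi>)"
    by (rule measure_distr[OF s agree_sets[OF Y X R']])
  also have "?s -` agree Y X (R\<inverse>) b \<inter> space \<pi> = agree X Y R b"
    using \<pi>D(3) by (auto simp: agree_iff) (metis abs_minus_commute)+
  finally show ?thesis using m by (intro nearI[OF \<rho> R']) simp
qed

lemma box_dist_sym_le:
  assumes X: "geometric_data_set X" and Y: "geometric_data_set Y"
  shows "box_dist Y X \<le> box_dist X Y"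
proof (rule ccontr)
  assume "\<not> ?thesis"
  then obtain q where q: "box_dist X Y < q" "q < box_dist Y X" using dense by (meson not_le)
  then obtain c where c: "q = ennreal c" "0 \<le> c" by (cases q) auto
  have "box_dist Y X \<le> ennreal c"
    using near_sym[OF X Y near_if_box_less[OF X Y]] q c by (intro box_le_if_near[OF Y X]) auto
  then show False using q c by simp
qed

lemma box_dist_sym:
  assumes X: "geometric_data_set X" and Y: "geometric_data_set Y"
  shows "box_dist X Y = box_dist Y X"
  using box_dist_sym_le[OF X Y] box_dist_sym_le[OF Y X] by (rule order.antisym[rotated])

text \<open>The product coupling with \<open>S = {}\<close> has mass defect 1 and Hausdorff term 0.
  The bound also makes the distance finite.\<close>

lemma box_dist_le_1:
  assumes X: "geometric_data_set X" and Y: "geometric_data_set Y"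
  shows "box_dist X Y \<le> 1"
proof -
  interpret X: gds_space X using X by unfold_locales
  interpret Y: gds_space Y using Y by unfold_locales
  interpret XY: pair_prob_space "law X" "law Y" by unfold_locales
  let ?\<pi> = "law X \<Otimes>\<^sub>M law Y"
  have 2: "distr ?\<pi> (law Y) snd = law Y"
  proof (rule measure_eqI)
    fix A assume "A \<in> sets (distr ?\<pi> (law Y) snd)"
    then have A: "A \<in> sets (law Y)" by simp
    then have "snd -` A \<inter> space ?\<pi> = pts X \<times> A"
      using sets.sets_into_space[OF A] by (auto simp: space_pair_measure)
    then show "emeasure (distr ?\<pi> (law Y) snd) A = emeasure (law Y) A"
      using A X.law.emeasure_space_1 Y.law.emeasure_pair_measure_Times[of "pts X" "law X" A]
        sets.top[of "law X"] by (simp add: emeasure_distr)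
  qed simp
  have "?\<pi> \<in> couplings X Y"
    unfolding couplings_iff[OF X Y] using Y.law.distr_pair_fst[of "law X"] 2 XY.prob_space_axioms by simp
  then show ?thesis
    \<comment> \<open>Non-empty feature sets matter even for \<open>S = {}\<close>, as an infimum
      over the empty set would be \<top>.\<close>
    unfolding box_dist_def using X.feats_nonempty Y.feats_nonempty
    by (intro INF_lower2[of "(?\<pi>, {})"])
      (auto simp: hausdorff_dist_def sup_dist_def precomp_def bot_ennreal)
qed

section \<open>Kernels and the triangle inequality\<close>

lemma nn_integral_countable_partition:
  fixes idx :: "'a \<Rightarrow> nat" and h :: "nat \<Rightarrow> ennreal"
  assumes idx: "idx \<in> M \<rightarrow>\<^sub>M count_space UNIV"
  shows "(\<integral>\<^sup>+x. h (idx x) \<partial>M) = (\<Sum>i. h i * emeasure M {x \<in> space M. idx x = i})"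
proof -
  have B: "{x \<in> space M. idx x = i} \<in> sets M" for i
    using measurable_sets[OF idx, of "{i}"] by (simp add: vimage_def Int_def conj_commute)
  have "(\<integral>\<^sup>+x. h (idx x) \<partial>M) = (\<integral>\<^sup>+x. (\<Sum>i. h i * indicator {x \<in> space M. idx x = i} x) \<partial>M)"
  proof (rule nn_integral_cong)
    fix x assume x: "x \<in> space M"
    have "(\<Sum>i. h i * indicator {x \<in> space M. idx x = i} x) = (\<Sum>i\<in>{idx x}. h i * indicator {x \<in> space M. idx x = i} x)"
      by (rule suminf_finite) (auto simp: indicator_def)
    then show "h (idx x) = (\<Sum>i. h i * indicator {x \<in> space M. idx x = i} x)"
      using x by simp
  qed
  also have "\<dots> = (\<Sum>i. \<integral>\<^sup>+x. h i * indicator {x \<in> space M. idx x = i} x \<partial>M)"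
    by (rule nn_integral_suminf) (use B in auto)
  also have "\<dots> = (\<Sum>i. h i * emeasure M {x \<in> space M. idx x = i})"
    using B by (simp add: nn_integral_cmult_indicator)
  finally show ?thesis .
qed

text \<open>The index of a point is the first term of a dense sequence within \<open>e / 2\<close>
  of it, so each cell is a ball minus finitely many others and its points share a centre.\<close>

lemma (in gds_space) ex_small_partition:
  assumes "0 < e"
  obtains idx :: "'a \<Rightarrow> nat" where "idx \<in> law X \<rightarrow>\<^sub>M count_space UNIV"
    "\<And>x y. x \<in> pts X \<Longrightarrow> y \<in> pts X \<Longrightarrow> idx x = idx y \<Longrightarrow> gds_dist X x y < e"
proof -
  obtain c where c: "dense_seq c" using ex_dense_seq by blast
  define idx where "idx x = (LEAST i. gds_dist X (c i) x < e / 2)" for x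
  have "idx \<in> law X \<rightarrow>\<^sub>M count_space UNIV"
    unfolding idx_def
  proof (rule measurable_Least)
    fix i :: nat
    have "{x \<in> space (law X). gds_dist X (c i) x < e / 2} = mball (c i) (e / 2)"
      using dense_seqD(1)[OF c] by auto
    then show "Measurable.pred (law X) (\<lambda>x. gds_dist X (c i) x < e / 2)"
      unfolding pred_def by (simp only: mball_sets)
  qed
  moreover have "gds_dist X x y < e" if xy: "x \<in> pts X" "y \<in> pts X" "idx x = idx y" for x y
  proof -
    have "gds_dist X (c (idx z)) z < e / 2" if "z \<in> pts X" for z
    proof -
      have "0 < e / 2" using assms by simp
      from dense_seqD(2)[OF c that this] show ?thesis unfolding idx_def by (rule LeastI_ex)
    qed
    from this[OF xy(1)] this[OF xy(2)] show ?thesis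
      using triangle[OF xy(1) dense_seqD(1)[OF c, of "idx x"] xy(2)] xy(3) by (simp add: commute)
  qed
  ultimately show ?thesis using that by blast
qed

text \<open>Conditioning the coupling on the cells of a partition of \<open>X\<close> into countably many small
  pieces replaces its disintegration, at the cost of an arbitrarily small loss in the features.\<close>

lemma kernel_near_if_near:
  assumes X: "geometric_data_set X" and Y: "geometric_data_set Y"
    and near: "near X Y a b" and "0 < e"
  shows "kernel_near X Y a (b + e)"
proof -
  interpret X: gds_space X using X by unfold_locales
  interpret Y: gds_space Y using Y by unfold_locales
  obtain \<pi> R where \<pi>: "\<pi> \<in> couplings X Y" and R: "full_rel X Y R"
    and m: "1 - a \<le> measure \<pi> (agree X Y R b)"
    using near unfolding near_def by auto
  note \<pi>D = couplingsD[OF X Y \<pi>]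
  interpret \<pi>: prob_space \<pi> by (rule \<pi>D)
  obtain idx :: "'a \<Rightarrow> nat" where idx: "idx \<in> law X \<rightarrow>\<^sub>M count_space UNIV"
    and close: "\<And>x y. x \<in> pts X \<Longrightarrow> y \<in> pts X \<Longrightarrow> idx x = idx y \<Longrightarrow> gds_dist X x y < e"
    using X.ex_small_partition[OF \<open>0 < e\<close>] by blast
  define B where "B i = {x \<in> pts X. idx x = i}" for i
  have B [measurable]: "B i \<in> sets (law X)" for i
    unfolding B_def using measurable_sets[OF idx, of "{i}"] by (simp add: vimage_def Int_def conj_commute)
  define w where "w i = emeasure (law X) (B i)" for i
  have w: "emeasure \<pi> (B i \<times> pts Y) = w i" "w i \<noteq> \<top>" for i
    unfolding w_def by (simp_all add: \<pi>D(8) X.law.emeasure_finite)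
  have BY: "B i \<times> C \<in> sets \<pi>" if "C \<in> sets (law Y)" for i C
    using that by (simp add: \<pi>D(2))
  have tY: "pts Y \<in> sets (law Y)" using sets.top[of "law Y"] by simp
  \<comment> \<open>The law of the second component, conditioned on the first one lying in cell
    \<open>i\<close>. On a null cell \<open>law Y\<close> is a default that makes \<open>K i\<close>
    a probability measure.\<close>
  define K where "K i = (if w i = 0 then law Y else distr (uniform_measure \<pi> (B i \<times> pts Y)) (law Y) snd)" for i
  have K: "K i \<in> space (prob_algebra (law Y))" for i
  proof (cases "w i = 0")
    case False
    have "prob_space (uniform_measure \<pi> (B i \<times> pts Y))"
      by (rule prob_space_uniform_measure) (use w False in auto)
    then have "prob_space (distr (uniform_measure \<pi> (B i \<times> pts Y)) (law Y) snd)"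
      by (rule prob_space.prob_space_distr) (use \<pi>D(7) in simp)
    then show ?thesis using False by (simp add: K_def space_prob_algebra)
  qed (simp add: K_def space_prob_algebra Y.law.prob_space_axioms)
  have Kem: "emeasure (K i) C = emeasure \<pi> (B i \<times> C) / w i" if C: "C \<in> sets (law Y)" "w i \<noteq> 0" for i C
  proof -
    have *: "snd -` C \<inter> space \<pi> = pts X \<times> C"
      using sets.sets_into_space[OF C(1)] \<pi>D(3) by auto
    have "emeasure (K i) C = emeasure (uniform_measure \<pi> (B i \<times> pts Y)) (snd -` C \<inter> space \<pi>)"
      using \<pi>D(7) C by (simp add: K_def emeasure_distr)
    also have "\<dots> = emeasure \<pi> ((B i \<times> pts Y) \<inter> (snd -` C \<inter> space \<pi>)) / w i"
      using BY[OF tY] measurable_sets[OF \<pi>D(7) C(1)] w by simp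
    also have "(B i \<times> pts Y) \<inter> (snd -` C \<inter> space \<pi>) = B i \<times> C"
      using sets.sets_into_space[OF C(1)] unfolding * B_def by auto
    finally show ?thesis .
  qed
  have wdiv: "(p / w i) * w i = p" if "w i \<noteq> 0" for p i
    using w(2)[of i] that by (simp add: ennreal_divide_times divide_eq_1_ennreal mult.commute ennreal_times_divide
        ennreal_mult_divide_eq)
  define \<kappa> where "\<kappa> x = K (idx x)" for x
  have \<kappa>: "\<kappa> \<in> law X \<rightarrow>\<^sub>M prob_algebra (law Y)"
    unfolding \<kappa>_def by (rule measurable_compose[OF idx]) (use K in auto)
  have wi: "emeasure (law X) {x \<in> pts X. idx x = i} = w i" for i
    by (simp add: w_def B_def)
  have disj: "disjoint_family (\<lambda>i. B i \<times> C)" for C :: "'b set"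
    by (auto simp: disjoint_family_on_def B_def)
  have in_prob: "law X \<in> space (prob_algebra (law X))"
    by (simp add: space_prob_algebra X.law.prob_space_axioms)
  have bind: "law X \<bind> \<kappa> = law Y"
  proof (rule measure_eqI)
    show s: "sets (law X \<bind> \<kappa>) = sets (law Y)"
      by (rule sets_bind'[OF in_prob \<kappa>])
    fix C assume "C \<in> sets (law X \<bind> \<kappa>)"
    then have C: "C \<in> sets (law Y)" using s by simp
    have "emeasure (law X \<bind> \<kappa>) C = (\<integral>\<^sup>+x. emeasure (K (idx x)) C \<partial>law X)"
      using emeasure_bind_prob_algebra[OF in_prob \<kappa> C] by (simp add: \<kappa>_def)
    also have "\<dots> = (\<Sum>i. emeasure (K i) C * w i)"
      by (subst nn_integral_countable_partition[OF idx]) (simp add: wi)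
    also have "\<dots> = (\<Sum>i. emeasure \<pi> (B i \<times> C))"
    proof (rule suminf_cong)
      fix i
      show "emeasure (K i) C * w i = emeasure \<pi> (B i \<times> C)"
      proof (cases "w i = 0")
        case True
        have "emeasure \<pi> (B i \<times> C) \<le> emeasure \<pi> (B i \<times> pts Y)"
          using sets.sets_into_space[OF C] by (intro emeasure_mono BY tY) auto
        then show ?thesis using True w(1) by simp
      qed (use Kem C wdiv in simp)
    qed
    also have "\<dots> = emeasure \<pi> (\<Union>i. B i \<times> C)"
      by (rule suminf_emeasure) (use BY C disj in auto)
    also have "(\<Union>i. B i \<times> C) = pts X \<times> C" by (auto simp: B_def)
    also have "emeasure \<pi> (pts X \<times> C) = emeasure (law Y) C" by (rule \<pi>D(9)[OF C])
    finally show "emeasure (law X \<bind> \<kappa>) C = emeasure (law Y) C" .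
  qed
  let ?E = "agree X Y R b" and ?E' = "agree X Y R (b + e)"
  have E: "?E \<in> sets \<pi>" using agree_sets[OF X Y R] \<pi>D(2) by simp
  \<comment> \<open>On a null cell the value 1 dominates any kernel mass, and the weight
    \<open>w i = 0\<close> removes it from the sum.\<close>
  define h where "h i = (if w i = 0 then 1 else emeasure \<pi> (B i \<times> pts Y - ?E) / w i)" for i
  have le: "emeasure (\<kappa> x) {y \<in> pts Y. (x, y) \<notin> ?E'} \<le> h (idx x)" if x: "x \<in> space (law X)" for x
  proof (cases "w (idx x) = 0")
    case True
    interpret kx: prob_space "\<kappa> x" using measurable_space[OF \<kappa> x] by (simp add: space_prob_algebra)
    show ?thesis using True kx.emeasure_le_1 by (simp add: h_def)
  next
    case False
    have "{y \<in> pts Y. (x, y) \<notin> ?E'} = Pair x -` (space (law X \<Otimes>\<^sub>M law Y) - ?E')"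
      using x by (auto simp: space_pair_measure)
    then have C: "{y \<in> pts Y. (x, y) \<notin> ?E'} \<in> sets (law Y)"
      using sets_Pair1[OF sets.compl_sets[OF agree_sets[OF X Y R, of "b + e"]]] by simp
    \<comment> \<open>If \<open>(x, y)\<close> violates the bound \<open>b + e\<close>, then
      \<open>(x', y)\<close> violates \<open>b\<close> for every \<open>x'\<close> in the cell of
      \<open>x\<close>; a bad fibre over one point thus spreads to a bad strip over the
      cell.\<close>
    have "B (idx x) \<times> {y \<in> pts Y. (x, y) \<notin> ?E'} \<subseteq> B (idx x) \<times> pts Y - ?E"
    proof clarsimp
      fix x' y assume "x' \<in> B (idx x)" "y \<in> pts Y" "(x, y) \<notin> ?E'" "(x', y) \<in> ?E"
      then show False
        using agree_perturb[OF X R, of x' y b x e] close[of x' x] x by (auto simp: B_def)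
    qed
    then have "emeasure \<pi> (B (idx x) \<times> {y \<in> pts Y. (x, y) \<notin> ?E'}) \<le> emeasure \<pi> (B (idx x) \<times> pts Y - ?E)"
      by (intro emeasure_mono sets.Diff E BY tY)
    then show ?thesis
      using False by (simp add: \<kappa>_def Kem[OF C] h_def divide_right_mono_ennreal)
  qed
  have "(\<integral>\<^sup>+x. emeasure (\<kappa> x) {y \<in> pts Y. (x, y) \<notin> ?E'} \<partial>law X) \<le> (\<integral>\<^sup>+x. h (idx x) \<partial>law X)"
    by (rule nn_integral_mono) (rule le)
  also have "\<dots> = (\<Sum>i. h i * w i)"
    by (subst nn_integral_countable_partition[OF idx]) (simp add: wi)
  also have "\<dots> = (\<Sum>i. emeasure \<pi> (B i \<times> pts Y - ?E))"
  proof (rule suminf_cong)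
    fix i
    show "h i * w i = emeasure \<pi> (B i \<times> pts Y - ?E)"
    proof (cases "w i = 0")
      case True
      have "emeasure \<pi> (B i \<times> pts Y - ?E) \<le> emeasure \<pi> (B i \<times> pts Y)"
        by (intro emeasure_mono BY tY) auto
      then show ?thesis using True w(1) by simp
    qed (simp add: h_def wdiv)
  qed
  also have "\<dots> = emeasure \<pi> (\<Union>i. B i \<times> pts Y - ?E)"
  proof (rule suminf_emeasure)
    show "disjoint_family (\<lambda>i. B i \<times> pts Y - ?E)"
      by (auto simp: disjoint_family_on_def B_def)
  qed (use BY tY E in auto)
  also have "(\<Union>i. B i \<times> pts Y - ?E) = space \<pi> - ?E" by (auto simp: B_def \<pi>D(3))
  also have "emeasure \<pi> (space \<pi> - ?E) \<le> ennreal a"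
    using \<pi>.prob_compl[OF E] m by (simp add: \<pi>.emeasure_eq_measure ennreal_leI)
  finally show ?thesis
    unfolding kernel_near_def using \<kappa> bind R by blast
qed

text \<open>The coupling of \<open>X\<close> and \<open>Y\<close> is prolonged by the kernel from
  \<open>Y\<close>, and \<open>Y\<close> is forgotten. A pair \<open>(x, z)\<close> that violates
  the composed bound comes from a triple in which one of the two agreements fails, so the mass
  defects add up.\<close>

lemma near_compose:
  assumes X: "geometric_data_set X" and Y: "geometric_data_set Y" and Z: "geometric_data_set Z"
    and near: "near X Y a b" and kernel: "kernel_near Y Z a' b'" and "0 \<le> a" "0 \<le> a'"
  shows "near X Z (a + a') (b + b')"
proof -
  interpret X: gds_space X using X by unfold_locales
  interpret Y: gds_space Y using Y by unfold_locales
  interpret Z: gds_space Z using Z by unfold_locales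
  obtain \<pi> R where \<pi>: "\<pi> \<in> couplings X Y" and R: "full_rel X Y R"
    and m: "1 - a \<le> measure \<pi> (agree X Y R b)"
    using near unfolding near_def by auto
  note \<pi>D = couplingsD[OF X Y \<pi>]
  interpret \<pi>: prob_space \<pi> by (rule \<pi>D)
  obtain \<kappa> Q where \<kappa>: "\<kappa> \<in> law Y \<rightarrow>\<^sub>M prob_algebra (law Z)" and bind: "law Y \<bind> \<kappa> = law Z"
    and Q: "full_rel Y Z Q"
    and le: "(\<integral>\<^sup>+y. emeasure (\<kappa> y) {z \<in> pts Z. (y, z) \<notin> agree Y Z Q b'} \<partial>law Y) \<le> ennreal a'"
    using kernel unfolding kernel_near_def by blast
  let ?N = "law X \<Otimes>\<^sub>M law Z"
  \<comment> \<open>For \<open>p = (x, y)\<close> this is the law of \<open>(x, z)\<close> with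
    \<open>z\<close> drawn from \<open>\<kappa> y\<close>.\<close>
  define \<theta> where "\<theta> p = distr (\<kappa> (snd p)) ?N (\<lambda>z. (fst p, z))" for p
  have \<kappa>s: "(\<lambda>p. \<kappa> (snd p)) \<in> \<pi> \<rightarrow>\<^sub>M prob_algebra (law Z)"
    by (rule measurable_compose[OF \<pi>D(7) \<kappa>])
  have pair: "(\<lambda>(p, z). (fst p, z)) \<in> \<pi> \<Otimes>\<^sub>M law Z \<rightarrow>\<^sub>M ?N"
    using measurable_Pair[OF measurable_compose[OF measurable_fst \<pi>D(6)] measurable_snd]
    by (simp add: split_beta')
  have \<theta>: "\<theta> \<in> \<pi> \<rightarrow>\<^sub>M prob_algebra ?N"
    unfolding \<theta>_def by (rule measurable_distr_prob_space2[OF \<kappa>s pair])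
  have in_prob: "\<pi> \<in> space (prob_algebra \<pi>)"
    by (simp add: space_prob_algebra \<pi>.prob_space_axioms)
  have in_probY: "law Y \<in> space (prob_algebra (law Y))"
    by (simp add: space_prob_algebra Y.law.prob_space_axioms)
  define \<rho> where "\<rho> = \<pi> \<bind> \<theta>"
  have s\<rho>: "sets \<rho> = sets ?N" unfolding \<rho>_def by (rule sets_bind'[OF in_prob \<theta>])
  have p\<rho>: "prob_space \<rho>" unfolding \<rho>_def by (rule prob_space_bind'[OF in_prob \<theta>])
  interpret \<rho>: prob_space \<rho> by (rule p\<rho>)
  have sp\<rho>: "space \<rho> = pts X \<times> pts Z"
    using sets_eq_imp_space_eq[OF s\<rho>] by (simp add: space_pair_measure)
  have \<kappa>p: "prob_space (\<kappa> y)" "sets (\<kappa> y) = sets (law Z)" "space (\<kappa> y) = pts Z" if "y \<in> pts Y" for y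
    using measurable_space[OF \<kappa>, of y] that sets_eq_imp_space_eq[of "\<kappa> y" "law Z"]
    by (auto simp: space_prob_algebra)
  have em: "emeasure \<rho> A = (\<integral>\<^sup>+p. emeasure (\<kappa> (snd p)) {z \<in> pts Z. (fst p, z) \<in> A} \<partial>\<pi>)"
    if A: "A \<in> sets ?N" for A
  proof -
    have "emeasure \<rho> A = (\<integral>\<^sup>+p. emeasure (\<theta> p) A \<partial>\<pi>)"
      unfolding \<rho>_def by (rule emeasure_bind_prob_algebra[OF in_prob \<theta> A])
    also have "\<dots> = (\<integral>\<^sup>+p. emeasure (\<kappa> (snd p)) {z \<in> pts Z. (fst p, z) \<in> A} \<partial>\<pi>)"
    proof (rule nn_integral_cong)
      fix p assume "p \<in> space \<pi>"
      then have p: "fst p \<in> pts X" "snd p \<in> pts Y" by (auto simp: \<pi>D(3))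
      have "(\<lambda>z. (fst p, z)) \<in> \<kappa> (snd p) \<rightarrow>\<^sub>M ?N"
        using p by (simp add: measurable_cong_sets[OF \<kappa>p(2) refl])
      then have "emeasure (\<theta> p) A = emeasure (\<kappa> (snd p)) ((\<lambda>z. (fst p, z)) -` A \<inter> space (\<kappa> (snd p)))"
        unfolding \<theta>_def using A by (rule emeasure_distr)
      also have "(\<lambda>z. (fst p, z)) -` A \<inter> space (\<kappa> (snd p)) = {z \<in> pts Z. (fst p, z) \<in> A}"
        using \<kappa>p(3) p by auto
      finally show "emeasure (\<theta> p) A = emeasure (\<kappa> (snd p)) {z \<in> pts Z. (fst p, z) \<in> A}" .
    qed
    finally show ?thesis .
  qed
  have fst\<rho>: "fst \<in> \<rho> \<rightarrow>\<^sub>M law X" and snd\<rho>: "snd \<in> \<rho> \<rightarrow>\<^sub>M law Z"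
    by (simp_all add: measurable_cong_sets[OF s\<rho> refl])
  have "distr \<rho> (law X) fst = law X"
  proof (rule measure_eqI)
    fix A assume "A \<in> sets (distr \<rho> (law X) fst)"
    then have A: "A \<in> sets (law X)" by simp
    have "fst -` A \<inter> space \<rho> = A \<times> pts Z"
      using sets.sets_into_space[OF A] sp\<rho> by auto
    then have "emeasure (distr \<rho> (law X) fst) A = emeasure \<rho> (A \<times> pts Z)"
      using emeasure_distr[OF fst\<rho> A] by simp
    also have "\<dots> = (\<integral>\<^sup>+p. emeasure (\<kappa> (snd p)) {z \<in> pts Z. (fst p, z) \<in> A \<times> pts Z} \<partial>\<pi>)"
      using A sets.top[of "law Z"] by (intro em) simp
    also have "\<dots> = (\<integral>\<^sup>+p. indicator (A \<times> pts Y) p \<partial>\<pi>)"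
    proof (rule nn_integral_cong)
      fix p assume p: "p \<in> space \<pi>"
      interpret k: prob_space "\<kappa> (snd p)" using p \<kappa>p by (auto simp: \<pi>D(3))
      show "emeasure (\<kappa> (snd p)) {z \<in> pts Z. (fst p, z) \<in> A \<times> pts Z} = indicator (A \<times> pts Y) p"
        using k.emeasure_space_1 \<kappa>p(3)[of "snd p"] p
        by (cases "fst p \<in> A") (auto simp: \<pi>D(3) indicator_def)
    qed
    also have "\<dots> = emeasure \<pi> (A \<times> pts Y)"
      using A sets.top[of "law Y"] by (intro nn_integral_indicator) (simp add: \<pi>D(2))
    also have "\<dots> = emeasure (law X) A" by (rule \<pi>D(8)[OF A])
    finally show "emeasure (distr \<rho> (law X) fst) A = emeasure (law X) A" .
  qed simp
  moreover have "distr \<rho> (law Z) snd = law Z"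
  proof (rule measure_eqI)
    fix A assume "A \<in> sets (distr \<rho> (law Z) snd)"
    then have A: "A \<in> sets (law Z)" by simp
    have "snd -` A \<inter> space \<rho> = pts X \<times> A"
      using sets.sets_into_space[OF A] sp\<rho> by auto
    then have "emeasure (distr \<rho> (law Z) snd) A = emeasure \<rho> (pts X \<times> A)"
      using emeasure_distr[OF snd\<rho> A] by simp
    also have "\<dots> = (\<integral>\<^sup>+p. emeasure (\<kappa> (snd p)) {z \<in> pts Z. (fst p, z) \<in> pts X \<times> A} \<partial>\<pi>)"
      using A sets.top[of "law X"] by (intro em) simp
    also have "\<dots> = (\<integral>\<^sup>+p. emeasure (\<kappa> (snd p)) A \<partial>\<pi>)"
    proof (rule nn_integral_cong)
      fix p assume p: "p \<in> space \<pi>"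
      then have "{z \<in> pts Z. (fst p, z) \<in> pts X \<times> A} = A"
        using sets.sets_into_space[OF A] by (auto simp: \<pi>D(3))
      then show "emeasure (\<kappa> (snd p)) {z \<in> pts Z. (fst p, z) \<in> pts X \<times> A} = emeasure (\<kappa> (snd p)) A" by simp
    qed
    also have "\<dots> = (\<integral>\<^sup>+y. emeasure (\<kappa> y) A \<partial>distr \<pi> (law Y) snd)"
      using A measurable_prob_algebraD[OF \<kappa>]
      by (intro nn_integral_distr[symmetric] \<pi>D(7)) (simp add: measurable_emeasure_kernel)
    also have "\<dots> = emeasure (law Y \<bind> \<kappa>) A"
      unfolding \<pi>D(5) by (rule emeasure_bind_prob_algebra[OF in_probY \<kappa> A, symmetric])
    finally show "emeasure (distr \<rho> (law Z) snd) A = emeasure (law Z) A" using bind by simp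
  qed simp
  ultimately have coup: "\<rho> \<in> couplings X Z"
    unfolding couplings_iff[OF X Z] using s\<rho> p\<rho> by simp
  let ?E1 = "agree X Y R b" and ?E2 = "agree Y Z Q b'" and ?E = "agree X Z (R O Q) (b + b')"
  have RQ: "full_rel X Z (R O Q)" by (rule full_rel_relcomp[OF R Q])
  have E: "?E \<in> sets ?N" by (rule agree_sets[OF X Z RQ])
  have E1: "?E1 \<in> sets \<pi>" using agree_sets[OF X Y R] \<pi>D(2) by simp
  have E2s: "{z \<in> pts Z. (y, z) \<notin> ?E2} \<in> sets (law Z)" if "y \<in> pts Y" for y
  proof -
    have "{z \<in> pts Z. (y, z) \<notin> ?E2} = Pair y -` (space (law Y \<Otimes>\<^sub>M law Z) - ?E2)"
      using that by (auto simp: space_pair_measure)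
    then show ?thesis
      using sets_Pair1[OF sets.compl_sets[OF agree_sets[OF Y Z Q, of b']]] by simp
  qed
  define h where "h y = emeasure (\<kappa> y) {z \<in> pts Z. (y, z) \<notin> ?E2}" for y
  have h: "h \<in> borel_measurable (law Y)"
    unfolding h_def
  proof (rule emeasure_measurable_subprob_algebra2[where N="law Z"])
    have "Sigma (space (law Y)) (\<lambda>y. {z \<in> pts Z. (y, z) \<notin> ?E2}) = space (law Y \<Otimes>\<^sub>M law Z) - ?E2"
      by (auto simp: space_pair_measure)
    then show "Sigma (space (law Y)) (\<lambda>y. {z \<in> pts Z. (y, z) \<notin> ?E2}) \<in> sets (law Y \<Otimes>\<^sub>M law Z)"
      using sets.compl_sets[OF agree_sets[OF Y Z Q, of b']] by simp
  qed (rule measurable_prob_algebraD[OF \<kappa>])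
  have "emeasure \<rho> (space ?N - ?E) = (\<integral>\<^sup>+p. emeasure (\<kappa> (snd p)) {z \<in> pts Z. (fst p, z) \<in> space ?N - ?E} \<partial>\<pi>)"
    by (rule em[OF sets.compl_sets[OF E]])
  also have "\<dots> \<le> (\<integral>\<^sup>+p. indicator (space \<pi> - ?E1) p + h (snd p) \<partial>\<pi>)"
  proof (rule nn_integral_mono)
    fix p assume p: "p \<in> space \<pi>"
    obtain x y where xy: "p = (x, y)" "x \<in> pts X" "y \<in> pts Y" using p by (auto simp: \<pi>D(3))
    interpret k: prob_space "\<kappa> y" using xy \<kappa>p by auto
    show "emeasure (\<kappa> (snd p)) {z \<in> pts Z. (fst p, z) \<in> space ?N - ?E} \<le> indicator (space \<pi> - ?E1) p + h (snd p)"
    proof (cases "p \<in> ?E1")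
      case False
      then show ?thesis using p xy k.emeasure_le_1 by (simp add: add_increasing2)
    next
      case True
      have "{z \<in> pts Z. (x, z) \<in> space ?N - ?E} \<subseteq> {z \<in> pts Z. (y, z) \<notin> ?E2}"
        using agree_relcomp[OF True[unfolded xy(1)], of _ Z Q b'] by blast
      then have "emeasure (\<kappa> y) {z \<in> pts Z. (x, z) \<in> space ?N - ?E} \<le> h y"
        unfolding h_def using E2s[OF xy(3)] \<kappa>p(2)[OF xy(3)] by (intro emeasure_mono) auto
      then show ?thesis using True xy by simp
    qed
  qed
  also have "\<dots> = emeasure \<pi> (space \<pi> - ?E1) + (\<integral>\<^sup>+p. h (snd p) \<partial>\<pi>)"
    using E1 measurable_compose[OF \<pi>D(7) h]
    by (subst nn_integral_add) auto
  also have "(\<integral>\<^sup>+p. h (snd p) \<partial>\<pi>) = (\<integral>\<^sup>+y. h y \<partial>distr \<pi> (law Y) snd)"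
    by (rule nn_integral_distr[symmetric, OF \<pi>D(7)]) (use h in simp)
  also have "\<dots> \<le> ennreal a'" unfolding \<pi>D(5) h_def by (rule le)
  also have "emeasure \<pi> (space \<pi> - ?E1) \<le> ennreal a"
    using \<pi>.prob_compl[OF E1] m by (simp add: \<pi>.emeasure_eq_measure ennreal_leI)
  finally have "emeasure \<rho> (space \<rho> - ?E) \<le> ennreal (a + a')"
    using assms by (simp add: ennreal_plus sp\<rho> space_pair_measure)
  then have "measure \<rho> (space \<rho> - ?E) \<le> a + a'"
    unfolding \<rho>.emeasure_eq_measure using assms by (subst (asm) ennreal_le_iff) auto
  moreover have "measure \<rho> (space \<rho> - ?E) = 1 - measure \<rho> ?E"
    by (rule \<rho>.prob_compl) (use E s\<rho> in simp)
  ultimately show ?thesis by (intro nearI[OF coup RQ]) linarith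
qed

lemma near_mono:
  assumes X: "geometric_data_set X" and Y: "geometric_data_set Y"
    and near: "near X Y a b" and ab: "a \<le> a'" "b \<le> b'"
  shows "near X Y a' b'"
proof -
  obtain \<pi> R where \<pi>: "\<pi> \<in> couplings X Y" and R: "full_rel X Y R"
    and m: "1 - a \<le> measure \<pi> (agree X Y R b)"
    using near unfolding near_def by auto
  interpret \<pi>: prob_space \<pi> by (rule couplingsD[OF X Y \<pi>])
  have "measure \<pi> (agree X Y R b) \<le> measure \<pi> (agree X Y R b')"
    using agree_sets[OF X Y R] couplingsD(2)[OF X Y \<pi>] agree_mono[OF ab(2), of X Y R]
    by (intro \<pi>.finite_measure_mono) auto
  then show ?thesis using m ab by (intro nearI[OF \<pi> R]) linarith
qed

lemma box_dist_triangle: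
  assumes X: "geometric_data_set X" and Y: "geometric_data_set Y" and Z: "geometric_data_set Z"
  shows "box_dist X Z \<le> box_dist X Y + box_dist Y Z"
proof -
  obtain p where p: "box_dist X Y = ennreal p" "0 \<le> p"
    using box_dist_le_1[OF X Y] by (cases "box_dist X Y") (auto simp: top_unique)
  obtain q where q: "box_dist Y Z = ennreal q" "0 \<le> q"
    using box_dist_le_1[OF Y Z] by (cases "box_dist Y Z") (auto simp: top_unique)
  have "box_dist X Z \<le> ennreal (p + q) + ennreal e" if e: "0 < e" for e
  proof -
    have 1: "near X Y (p + e / 4) (p / 2 + e / 8)"
    proof -
      have "box_dist X Y < ennreal (p + e / 4)"
        unfolding p(1) by (rule ennreal_lessI) (use p(2) e in auto)
      from near_if_box_less[OF X Y this] show ?thesis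
        by (simp only: add_divide_distrib) simp
    qed
    have 2: "near Y Z (q + e / 4) (q / 2 + e / 8)"
    proof -
      have "box_dist Y Z < ennreal (q + e / 4)"
        unfolding q(1) by (rule ennreal_lessI) (use q(2) e in auto)
      from near_if_box_less[OF Y Z this] show ?thesis
        by (simp only: add_divide_distrib) simp
    qed
    \<comment> \<open>The slack \<open>e / 4\<close> in each distance becomes \<open>e / 8\<close>
      in the features; the third \<open>e / 8\<close> pays for the passage to a kernel. The total
      \<open>3 * e / 8\<close> stays below \<open>e / 2\<close>.\<close>
    have "near X Z ((p + e / 4) + (q + e / 4)) ((p / 2 + e / 8) + ((q / 2 + e / 8) + e / 8))"
      by (rule near_compose[OF X Y Z 1 kernel_near_if_near[OF Y Z 2]]) (use e p q in auto)
    then have "near X Z (p + q + e) ((p + q + e) / 2)"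
      by (rule near_mono[OF X Z]) (use e in \<open>auto simp: field_simps\<close>)
    then have "box_dist X Z \<le> ennreal (p + q + e)"
      by (rule box_le_if_near[OF X Z]) (use e p q in auto)
    then show ?thesis using e p q by (simp add: ennreal_plus)
  qed
  then have "box_dist X Z \<le> ennreal (p + q)"
    by (rule ennreal_le_epsilon)
  then show ?thesis using p q by (simp add: ennreal_plus)
qed

section \<open>Distance zero and isomorphism\<close>

lemma (in gds_space) feats_Lip1: "feats X \<subseteq> Lip1 X"
proof
  fix f assume f: "f \<in> feats X"
  show "f \<in> Lip1 X" using feat_lipschitz[OF f] feats_ext[OF f] by (simp add: Lip1_def)
qed

text \<open>A basic open set of the product topology restricts finitely many coordinates, and the
  smallest of the radii involved serves as a common \<open>e\<close>.\<close>

lemma (in gds_space) feats_closure_iff: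
  "g \<in> feats_closure X \<longleftrightarrow> g \<in> Lip1 X \<and>
     (\<forall>K e. finite K \<and> K \<subseteq> pts X \<and> 0 < e \<longrightarrow> (\<exists>f\<in>feats X. \<forall>x\<in>K. \<bar>g x - f x\<bar> < e))"
    (is "?L \<longleftrightarrow> g \<in> Lip1 X \<and> ?R")
proof -
  let ?P = "product_topology (\<lambda>_. euclideanreal) (pts X)"
  have L: "Lip1 X \<subseteq> pts X \<rightarrow>\<^sub>E UNIV" by (auto simp: Lip1_def)
  have cl: "?L \<longleftrightarrow> g \<in> Lip1 X \<and> (\<forall>V. g \<in> V \<and> openin ?P V \<longrightarrow> (\<exists>f\<in>feats X. f \<in> V))"
  proof -
    have ts: "topspace (subtopology ?P (Lip1 X)) = Lip1 X"
      using L by auto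
    show ?thesis
      unfolding feats_closure_def in_closure_of ts openin_subtopology
    proof (intro conj_cong refl iffI allI impI)
      fix V assume g: "g \<in> Lip1 X" and V: "g \<in> V \<and> openin ?P V"
        and *: "\<forall>T. g \<in> T \<and> (\<exists>V. openin ?P V \<and> T = V \<inter> Lip1 X) \<longrightarrow> (\<exists>y. y \<in> feats X \<and> y \<in> T)"
      show "\<exists>f\<in>feats X. f \<in> V"
        using *[rule_format, of "V \<inter> Lip1 X"] g V by blast
    next
      fix T assume T: "g \<in> T \<and> (\<exists>V. openin ?P V \<and> T = V \<inter> Lip1 X)"
        and *: "\<forall>V. g \<in> V \<and> openin ?P V \<longrightarrow> (\<exists>f\<in>feats X. f \<in> V)"
      from T obtain V where V: "openin ?P V" "T = V \<inter> Lip1 X" by blast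
      then obtain f where "f \<in> feats X" "f \<in> V" using * T by blast
      then show "\<exists>y. y \<in> feats X \<and> y \<in> T" using V feats_Lip1 by blast
    qed
  qed
  show ?thesis
  proof (cases "g \<in> Lip1 X")
    case g: True
    have "(\<forall>V. g \<in> V \<and> openin ?P V \<longrightarrow> (\<exists>f\<in>feats X. f \<in> V)) \<longleftrightarrow> ?R"
    proof (intro iffI allI impI)
      fix K e assume V: "\<forall>V. g \<in> V \<and> openin ?P V \<longrightarrow> (\<exists>f\<in>feats X. f \<in> V)"
        and K: "finite K \<and> K \<subseteq> pts X \<and> 0 < (e::real)"
      let ?U = "\<lambda>x. if x \<in> K then ball (g x) e else UNIV"
      have "finite {x. ?U x \<noteq> topspace euclideanreal}"
        by (rule finite_subset[of _ K]) (use K in auto)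
      then have "openin ?P (PiE (pts X) ?U)"
        by (intro product_topology_basis) auto
      moreover have "g \<in> PiE (pts X) ?U" using g L K by (auto simp: PiE_iff)
      ultimately obtain f where "f \<in> feats X" "f \<in> PiE (pts X) ?U" using V by blast
      then show "\<exists>f\<in>feats X. \<forall>x\<in>K. \<bar>g x - f x\<bar> < e"
        using K by (intro bexI[of _ f]) (auto simp: PiE_iff dist_real_def split: if_splits)
    next
      fix V assume R: ?R and V: "g \<in> V \<and> openin ?P V"
      then obtain U where U: "g \<in> PiE (pts X) U" "\<And>x. open (U x)" "finite {x. U x \<noteq> UNIV}" "PiE (pts X) U \<subseteq> V"
        using product_topology_open_contains_basis[of "\<lambda>_. euclideanreal" "pts X" V g] by auto
      let ?K = "{x. U x \<noteq> UNIV} \<inter> pts X"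
      have "\<exists>r>0. ball (g x) r \<subseteq> U x" if "x \<in> ?K" for x
        using U(1,2) that by (auto simp: PiE_iff open_contains_ball)
      then obtain r where r: "\<And>x. x \<in> ?K \<Longrightarrow> 0 < r x \<and> ball (g x) (r x) \<subseteq> U x" by metis
      \<comment> \<open>Inserting 1 keeps the minimum defined when no coordinate is
        restricted.\<close>
      define e where "e = Min (insert 1 (r ` ?K))"
      have fin: "finite (insert 1 (r ` ?K))" using U(3) by auto
      have "0 < e" unfolding e_def using fin r by (subst Min_gr_iff) auto
      have er: "e \<le> r x" if "x \<in> ?K" for x unfolding e_def using fin that by (intro Min_le) auto
      obtain f where f: "f \<in> feats X" "\<forall>x\<in>?K. \<bar>g x - f x\<bar> < e"
        using R[rule_format, of ?K e] U(3) \<open>0 < e\<close> by auto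
      have "f x \<in> U x" if x: "x \<in> pts X" for x
      proof (cases "x \<in> ?K")
        case True
        then have "\<bar>g x - f x\<bar> < r x" using f(2) er[OF True] by (meson order.strict_trans2)
        then show ?thesis using r[OF True] by (auto simp: dist_real_def)
      qed (use x in auto)
      then have "f \<in> PiE (pts X) U" using feats_ext[OF f(1)] by (auto simp: PiE_iff)
      then show "\<exists>f\<in>feats X. f \<in> V" using U f by blast
    qed
    then show ?thesis using cl g by blast
  qed (use cl in blast)
qed

lemma (in gds_space) feats_closureD:
  assumes "g \<in> feats_closure X"
  shows "g \<in> Lip1 X" "finite K \<Longrightarrow> K \<subseteq> pts X \<Longrightarrow> 0 < e \<Longrightarrow> \<exists>f\<in>feats X. \<forall>x\<in>K. \<bar>g x - f x\<bar> < e"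
  using assms feats_closure_iff by auto

lemma (in gds_space) feats_subset_closure: "feats X \<subseteq> feats_closure X"
proof
  fix f assume "f \<in> feats X"
  then show "f \<in> feats_closure X"
    unfolding feats_closure_iff using feats_Lip1 by force
qed

text \<open>The coupling is carried by the graph of \<open>\<phi>\<close>. The closures consist of
  pointwise limits, so features can be matched on finitely many points only; being Lipschitz spreads
  the match over balls of almost full mass. The three \<open>e\<close> are the error at the centre
  and the moves of \<open>f\<close> and of \<open>g\<close> composed with \<open>\<phi>\<close> from
  the centre to \<open>x\<close>.\<close>

lemma near_if_iso:
  assumes X: "geometric_data_set X" and Y: "geometric_data_set Y" and iso: "gds_iso X Y" and "0 < e"
  shows "near X Y e (3 * e)"
proof -
  interpret X: gds_space X using X by unfold_locales
  interpret Y: gds_space Y using Y by unfold_locales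
  obtain \<phi> where \<phi>0: "\<phi> \<in> borel_of (gds_top X) \<rightarrow>\<^sub>M borel_of (gds_top Y)"
    and law0: "distr (law X) (borel_of (gds_top Y)) \<phi> = law Y"
    and cl: "precomp (pts X) (feats_closure Y) \<phi> = feats_closure X"
    using iso unfolding gds_iso_def by blast
  have \<phi>: "\<phi> \<in> law X \<rightarrow>\<^sub>M law Y"
    using \<phi>0 unfolding measurable_cong_sets[OF X.sets_law Y.sets_law] X.gds_top_eq Y.gds_top_eq .
  have "distr (law X) (law Y) \<phi> = distr (law X) (borel_of (gds_top Y)) \<phi>"
    by (rule distr_cong) (simp_all add: Y.sets_law Y.gds_top_eq)
  then have law: "distr (law X) (law Y) \<phi> = law Y" unfolding law0 .
  have \<phi>in: "\<phi> x \<in> pts Y" if "x \<in> pts X" for x using measurable_space[OF \<phi>] that by simp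
  have up: "\<exists>g\<in>feats_closure Y. \<forall>x\<in>pts X. f x = g (\<phi> x)" if f: "f \<in> feats X" for f
  proof -
    have "f \<in> precomp (pts X) (feats_closure Y) \<phi>" using f cl X.feats_subset_closure by blast
    then show ?thesis by (auto simp: precomp_def compose_def)
  qed
  have down: "\<exists>f\<in>feats_closure X. \<forall>x\<in>pts X. f x = g (\<phi> x)" if g: "g \<in> feats Y" for g
  proof -
    have "compose (pts X) g \<phi> \<in> feats_closure X" 
      using g cl Y.feats_subset_closure by (auto simp: precomp_def)
    then show ?thesis by (rule bexI[rotated]) (auto simp: compose_def)
  qed
  obtain c where c: "X.dense_seq c" using X.ex_dense_seq by blast
  obtain J :: nat where J: "measure (law X) (\<Union>i<J. X.mball (c i) e) > 1 - e"
    using X.finite_balls_large[OF c \<open>0 < e\<close> \<open>0 < e\<close>] by blast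
  have cin: "c i \<in> pts X" for i by (rule X.dense_seqD(1)[OF c])
  define R where "R = {(f, g). f \<in> feats X \<and> g \<in> feats Y \<and> (\<forall>i<J. \<bar>f (c i) - g (\<phi> (c i))\<bar> \<le> e)}"
  have R: "full_rel X Y R"
  proof (rule full_relI)
    fix f assume f: "f \<in> feats X"
    then obtain g where g: "g \<in> feats_closure Y" "\<forall>x\<in>pts X. f x = g (\<phi> x)" using up by blast
    have "finite ((\<phi> \<circ> c) ` {..<J})" "(\<phi> \<circ> c) ` {..<J} \<subseteq> pts Y" using cin \<phi>in by auto
    from Y.feats_closureD(2)[OF g(1) this \<open>0 < e\<close>]
    obtain h where "h \<in> feats Y" "\<forall>y\<in>(\<phi> \<circ> c) ` {..<J}. \<bar>g y - h y\<bar> < e" by blast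
    then show "\<exists>g. (f, g) \<in> R"
      using f g cin by (intro exI[of _ h]) (auto simp: R_def less_imp_le)
  next
    fix g assume g: "g \<in> feats Y"
    then obtain f where f: "f \<in> feats_closure X" "\<forall>x\<in>pts X. f x = g (\<phi> x)" using down by blast
    have "finite (c ` {..<J})" "c ` {..<J} \<subseteq> pts X" using cin by auto
    from X.feats_closureD(2)[OF f(1) this \<open>0 < e\<close>]
    obtain h where "h \<in> feats X" "\<forall>x\<in>c ` {..<J}. \<bar>f x - h x\<bar> < e" by blast
    then show "\<exists>f. (f, g) \<in> R"
      using f g cin by (intro exI[of _ h]) (force simp: R_def less_imp_le abs_minus_commute)
  qed (auto simp: R_def)
  let ?N = "law X \<Otimes>\<^sub>M law Y" and ?s = "\<lambda>x. (x, \<phi> x)"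
  have s: "?s \<in> law X \<rightarrow>\<^sub>M ?N" using \<phi> by simp
  let ?\<pi> = "distr (law X) ?N ?s"
  have \<pi>: "?\<pi> \<in> couplings X Y"
    unfolding couplings_iff[OF X Y] using X.law.prob_space_distr[OF s] law
    by (simp add: distr_distr[OF _ s] comp_def distr_id2)
  \<comment> \<open>The map \<open>\<phi>\<close> is merely measurable; the Lipschitz bound comes
    from the composite being a member of \<open>feats_closure X\<close>.\<close>
  have lipg: "\<bar>g (\<phi> x) - g (\<phi> x')\<bar> \<le> gds_dist X x x'" if g: "g \<in> feats Y" and x: "x \<in> pts X" "x' \<in> pts X" for g x x'
  proof -
    obtain f where f: "f \<in> feats_closure X" "\<forall>x\<in>pts X. f x = g (\<phi> x)" using down[OF g] by blast
    then have "f \<in> Lip1 X" using X.feats_closureD(1) by blast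
    then show ?thesis using f(2) x by (auto simp: Lip1_def)
  qed
  have "(\<Union>i<J. X.mball (c i) e) \<subseteq> ?s -` agree X Y R (3 * e) \<inter> space (law X)"
  proof
    fix x assume "x \<in> (\<Union>i<J. X.mball (c i) e)"
    then obtain i where i: "i < J" and x: "x \<in> pts X" "c i \<in> pts X" "gds_dist X (c i) x < e" by auto
    have "\<bar>f x - g (\<phi> x)\<bar> \<le> 3 * e" if fg: "(f, g) \<in> R" for f g
    proof -
      have "\<bar>f (c i) - g (\<phi> (c i))\<bar> \<le> e" "f \<in> feats X" "g \<in> feats Y" using fg i by (auto simp: R_def)
      then show ?thesis
        using X.feat_lipschitz[of f "c i" x] lipg[of g "c i" x] x by linarith
    qed
    then show "x \<in> ?s -` agree X Y R (3 * e) \<inter> space (law X)" using x \<phi>in by (auto simp: agree_iff)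
  qed
  then have "measure (law X) (\<Union>i<J. X.mball (c i) e) \<le> measure (law X) (?s -` agree X Y R (3 * e) \<inter> space (law X))"
    by (rule X.law.finite_measure_mono) (rule measurable_sets[OF s agree_sets[OF X Y R]])
  also have "\<dots> = measure ?\<pi> (agree X Y R (3 * e))"
    by (rule measure_distr[symmetric, OF s agree_sets[OF X Y R]])
  finally show ?thesis using J by (intro nearI[OF \<pi> R]) linarith
qed

lemma box_zero_if_iso:
  assumes X: "geometric_data_set X" and Y: "geometric_data_set Y" and iso: "gds_iso X Y"
  shows "box_dist X Y = 0"
proof -
  have "box_dist X Y \<le> 0 + ennreal e" if "0 < e" for e
  proof -
    have "near X Y (e / 6) (3 * (e / 6))"
      by (rule near_if_iso[OF X Y iso]) (use that in auto)
    then have "near X Y e (e / 2)"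
      by (rule near_mono[OF X Y]) (use that in auto)
    then show ?thesis using box_le_if_near[OF X Y] that by simp
  qed
  then have "box_dist X Y \<le> 0" by (rule ennreal_le_epsilon)
  then show ?thesis by simp
qed

section \<open>From distance zero to an isomorphism\<close>

text \<open>The hypotheses say that the Levy-Prokhorov distance is zero. The neighbourhoods of a
  closed set shrink to it, so the measures agree on closed sets, hence on open sets, which form an
  intersection-stable generator.\<close>

lemma (in gds_space) measure_eqI_neighbourhoods:
  assumes "prob_space M" "prob_space N" "sets M = sets (law X)" "sets N = sets (law X)"
    and MN: "\<And>C e. closedin mtopology C \<Longrightarrow> 0 < e \<Longrightarrow> measure M C \<le> measure N (\<Union>x\<in>C. mball x e) + e"
    and NM: "\<And>C e. closedin mtopology C \<Longrightarrow> 0 < e \<Longrightarrow> measure N C \<le> measure M (\<Union>x\<in>C. mball x e) + e"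
  shows "M = N"
proof -
  have le: "measure M C \<le> measure N C"
    if "prob_space N" "sets N = sets (law X)" and C: "closedin mtopology C"
      and MN: "\<And>e. 0 < e \<Longrightarrow> measure M C \<le> measure N (\<Union>x\<in>C. mball x e) + e" for M N C
  proof -
    interpret N: prob_space N by fact
    define A where "A n = (\<Union>x\<in>C. mball x (1 / real (Suc n)))" for n
    have CM: "C \<subseteq> pts X" using closedin_subset[OF C] by simp
    have "(\<Inter>n. A n) = C"
    proof (intro equalityI subsetI)
      fix x assume x: "x \<in> (\<Inter>n. A n)"
      then have xp: "x \<in> pts X" by (auto simp: A_def)
      show "x \<in> C"
      proof (rule ccontr)
        assume "x \<notin> C"
        then obtain r where r: "r > 0" "disjnt C (mball x r)"
          using C xp unfolding closedin_metric by blast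
        obtain n where n: "1 / real (Suc n) < r" using r(1) nat_approx_posE by blast
        obtain y where "y \<in> C" "x \<in> mball y (1 / real (Suc n))" using x by (auto simp: A_def)
        then have "y \<in> mball x r" using n by (auto simp: commute)
        then show False using r \<open>y \<in> C\<close> by (auto simp: disjnt_iff)
      qed
    next
      fix x assume "x \<in> C"
      then show "x \<in> (\<Inter>n. A n)" using CM unfolding A_def by (auto intro!: bexI[of _ x])
    qed
    moreover have "decseq A"
    proof (rule decseq_SucI)
      fix n
      have "1 / real (Suc (Suc n)) \<le> 1 / real (Suc n)" by (simp add: frac_le)
      then show "A (Suc n) \<subseteq> A n" unfolding A_def using mball_subset_concentric by blast
    qed
    moreover have "A n \<in> sets N" for n
      unfolding that(2) A_def by (intro openin_sets openin_Union) auto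
    ultimately have "(\<lambda>n. measure N (A n)) \<longlonglongrightarrow> measure N C"
      using N.finite_Lim_measure_decseq[of A] by (metis image_subsetI)
    moreover have "(\<lambda>n. 1 / real (Suc n)) \<longlonglongrightarrow> 0"
      using LIMSEQ_inverse_real_of_nat by (simp add: inverse_eq_divide)
    ultimately have "(\<lambda>n. measure N (A n) + 1 / real (Suc n)) \<longlonglongrightarrow> measure N C + 0"
      by (rule tendsto_add)
    then have "measure M C \<le> measure N C + 0"
    proof (rule LIMSEQ_le_const, intro exI allI impI)
      show "measure M C \<le> measure N (A n) + 1 / real (Suc n)" for n
        unfolding A_def by (rule MN) simp
    qed
    then show ?thesis by simp
  qed
  interpret M: prob_space M by fact
  interpret N: prob_space N by fact
  have spM: "space M = pts X" and spN: "space N = pts X"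
    using assms(3,4)[THEN sets_eq_imp_space_eq] by simp_all
  have closed: "measure M C = measure N C" if C: "closedin mtopology C" for C
    using le[OF assms(2,4) C MN[OF C]] le[OF assms(1,3) C NM[OF C]] by linarith
  show ?thesis
  proof (rule measure_eqI_generator_eq[where \<Omega>="pts X" and E="{U. openin mtopology U}" and A="\<lambda>_. pts X"])
    show "Int_stable {U. openin mtopology U}" by (auto simp: Int_stable_def)
    show "{U. openin mtopology U} \<subseteq> Pow (pts X)" using openin_subset by fastforce
    show "sets M = sigma_sets (pts X) {U. openin mtopology U}" "sets N = sigma_sets (pts X) {U. openin mtopology U}"
      using assms(3,4) by (simp_all add: sets_law sets_borel_of)
    show "emeasure M U = emeasure N U" if "U \<in> {U. openin mtopology U}" for U
    proof -
      have U: "openin mtopology U" using that by simp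
      then have Us: "U \<in> sets M" "U \<in> sets N" "U \<subseteq> pts X"
        using openin_sets assms(3,4) openin_subset[OF U] by auto
      have "closedin mtopology (pts X - U)" using U by blast
      from closed[OF this] have "measure M U = measure N U"
        using M.prob_compl[OF Us(1)] N.prob_compl[OF Us(2)] spM spN by simp
      then show ?thesis by (simp add: M.emeasure_eq_measure N.emeasure_eq_measure)
    qed
    show "range (\<lambda>_. pts X) \<subseteq> {U. openin mtopology U}"
      using openin_topspace[of mtopology] by simp
  qed auto
qed

text \<open>The definition demands centres in \<open>S\<close>; a ball that meets \<open>S\<close>
  is recentred at a point of \<open>S\<close> at the price of doubling its radius.\<close>

lemma (in Metric_space) mtotally_bounded_if_finite_cover:
  assumes "S \<subseteq> M" and "\<And>r. 0 < r \<Longrightarrow> \<exists>C. finite C \<and> C \<subseteq> M \<and> S \<subseteq> (\<Union>x\<in>C. mball x r)"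
  shows "mtotally_bounded S"
  unfolding mtotally_bounded_def
proof (intro allI impI)
  fix e :: real assume "0 < e"
  then obtain C where C: "finite C" "C \<subseteq> M" "S \<subseteq> (\<Union>x\<in>C. mball x (e / 2))"
    using assms(2)[of "e / 2"] by auto
  define D where "D = {x \<in> C. mball x (e / 2) \<inter> S \<noteq> {}}"
  have "\<forall>x\<in>D. \<exists>p. p \<in> mball x (e / 2) \<inter> S" unfolding D_def by blast
  from bchoice[OF this] obtain p where p: "\<And>x. x \<in> D \<Longrightarrow> p x \<in> mball x (e / 2) \<inter> S" by blast
  have "s \<in> (\<Union>x\<in>p ` D. mball x e)" if s: "s \<in> S" for s
  proof -
    obtain x where x: "x \<in> C" "s \<in> mball x (e / 2)" using C s by blast
    then have "x \<in> D" using s by (auto simp: D_def)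
    from p[OF this] have "s \<in> mball (p x) e"
      using x(2) triangle[of "p x" x s] by (auto simp: commute)
    then show ?thesis using \<open>x \<in> D\<close> by blast
  qed
  then have "S \<subseteq> (\<Union>x\<in>p ` D. mball x e)" by blast
  moreover have "finite (p ` D)" using C(1) by (simp add: D_def)
  moreover have "p ` D \<subseteq> S" using p by blast
  ultimately show "\<exists>K. finite K \<and> K \<subseteq> S \<and> S \<subseteq> (\<Union>x\<in>K. mball x e)" by blast
qed

text \<open>The couplings concentrate near the graph of \<open>\<phi>\<close>, which identifies the
  image measure with \<open>law Y\<close>. That measure has full support, so the image of
  \<open>\<phi>\<close> meets every ball, and completeness of \<open>X\<close> makes
  \<open>\<phi>\<close> onto. Errors on finite sets of points are exactly what membership in the
  feature closures tolerates, so \<open>rel\<close> matches the closures.\<close>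

lemma iso_if_almost_isometry:
  fixes X :: "'a gds" and Y :: "'b gds"
  assumes X: "geometric_data_set X" and Y: "geometric_data_set Y"
    and in_Y: "\<And>x. x \<in> pts X \<Longrightarrow> \<phi> x \<in> pts Y"
    and isom: "\<And>x x'. x \<in> pts X \<Longrightarrow> x' \<in> pts X \<Longrightarrow> gds_dist Y (\<phi> x) (\<phi> x') = gds_dist X x x'"
    and coup: "\<And>e. 0 < e \<Longrightarrow> \<exists>\<pi>\<in>couplings X Y. \<exists>A\<in>sets \<pi>. measure \<pi> A \<ge> 1 - e \<and>
        (\<forall>(a, b)\<in>A. gds_dist Y (\<phi> a) b < e)"
    and rel: "\<And>K e. finite K \<Longrightarrow> K \<subseteq> pts X \<Longrightarrow> 0 < e \<Longrightarrow>
        \<exists>R. full_rel X Y R \<and> (\<forall>(f, g)\<in>R. \<forall>x\<in>K. \<bar>f x - g (\<phi> x)\<bar> < e)"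
  shows "gds_iso X Y"
proof -
  interpret X: gds_space X using X by unfold_locales
  interpret Y: gds_space Y using Y by unfold_locales
  have "continuous_map X.mtopology Y.mtopology \<phi>"
    unfolding X.metric_continuous_map[OF Y.Metric_space_axioms]
  proof (intro conjI ballI allI impI)
    fix a e assume "a \<in> pts X" "0 < (e::real)"
    then show "\<exists>d>0. \<forall>x. x \<in> pts X \<and> gds_dist X a x < d \<longrightarrow> gds_dist Y (\<phi> a) (\<phi> x) < e"
      using isom by (intro exI[of _ e]) auto
  qed (use in_Y in auto)
  then have meas: "\<phi> \<in> borel_of (gds_top X) \<rightarrow>\<^sub>M borel_of (gds_top Y)"
    unfolding X.gds_top_eq Y.gds_top_eq by (rule measurable_borel_of_continuous)
  have meas': "\<phi> \<in> law X \<rightarrow>\<^sub>M law Y"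
    using meas unfolding measurable_cong_sets[OF X.sets_law Y.sets_law] X.gds_top_eq Y.gds_top_eq .
  let ?\<nu> = "distr (law X) (law Y) \<phi>"
  have \<nu>: "measure ?\<nu> C = measure (law X) (\<phi> -` C \<inter> pts X)" if "C \<in> sets (law Y)" for C
    using measure_distr[OF meas' that] by simp
  have nbhd: "(\<Union>y\<in>C. Y.mball y e) \<in> sets (law Y)" for C e
    by (intro Y.openin_sets openin_Union) auto
  have push: "?\<nu> = law Y"
  proof (rule Y.measure_eqI_neighbourhoods)
    show "prob_space ?\<nu>" by (rule X.law.prob_space_distr[OF meas'])
  next
    fix C e assume C: "closedin Y.mtopology C" and e: "0 < (e::real)"
    let ?U = "\<Union>y\<in>C. Y.mball y e"
    have CY: "C \<subseteq> pts Y" using closedin_subset[OF C] by simp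
    have Cs: "C \<in> sets (law Y)" by (rule Y.closedin_sets[OF C])
    obtain \<pi> A where \<pi>: "\<pi> \<in> couplings X Y" and A: "A \<in> sets \<pi>" and mA: "measure \<pi> A \<ge> 1 - e"
      and close: "\<And>a b. (a, b) \<in> A \<Longrightarrow> gds_dist Y (\<phi> a) b < e"
      using coup[OF e] by blast
    note \<pi>D = couplingsD[OF X Y \<pi>]
    interpret \<pi>: prob_space \<pi> by (rule \<pi>D)
    have AXY: "A \<subseteq> pts X \<times> pts Y" using sets.sets_into_space[OF A] \<pi>D(3) by simp
    have mX: "measure \<pi> (B \<times> pts Y) = measure (law X) B" if "B \<in> sets (law X)" for B
      using \<pi>D(8)[OF that] by (simp add: measure_def)
    have mY: "measure \<pi> (pts X \<times> B) = measure (law Y) B" if "B \<in> sets (law Y)" for B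
      using \<pi>D(9)[OF that] by (simp add: measure_def)
    \<comment> \<open>Restricting any event to \<open>A\<close> loses at most the mass
      \<open>e\<close> outside \<open>A\<close>.\<close>
    have split: "measure \<pi> B \<le> measure \<pi> (A \<inter> B) + e" if B: "B \<in> sets \<pi>" for B
    proof -
      have "measure \<pi> B \<le> measure \<pi> ((A \<inter> B) \<union> (space \<pi> - A))"
        using A B sets.sets_into_space[OF B] by (intro \<pi>.finite_measure_mono) auto
      also have "\<dots> \<le> measure \<pi> (A \<inter> B) + measure \<pi> (space \<pi> - A)"
        using A B by (intro measure_Un_le) auto
      also have "measure \<pi> (space \<pi> - A) \<le> e" using \<pi>.prob_compl[OF A] mA by simp
      finally show ?thesis by simp
    qed
    have sX: "\<phi> -` B \<inter> pts X \<in> sets (law X)" if "B \<in> sets (law Y)" for B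
      using measurable_sets[OF meas' that] by simp
    have sx: "B \<times> pts Y \<in> sets \<pi>" if "B \<in> sets (law X)" for B
      using that sets.top[of "law Y"] by (simp add: \<pi>D(2))
    have sy: "pts X \<times> B \<in> sets \<pi>" if "B \<in> sets (law Y)" for B
      using that sets.top[of "law X"] by (simp add: \<pi>D(2))
    have "measure (law X) (\<phi> -` C \<inter> pts X) \<le> measure \<pi> (A \<inter> (\<phi> -` C \<inter> pts X) \<times> pts Y) + e"
      using split[OF sx[OF sX[OF Cs]]] mX[OF sX[OF Cs]] by simp
    also have "measure \<pi> (A \<inter> (\<phi> -` C \<inter> pts X) \<times> pts Y) \<le> measure \<pi> (pts X \<times> ?U)"
    proof (rule \<pi>.finite_measure_mono)
      show "A \<inter> (\<phi> -` C \<inter> pts X) \<times> pts Y \<subseteq> pts X \<times> ?U"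
        using AXY close CY in_Y by fastforce
      show "pts X \<times> ?U \<in> sets \<pi>" by (rule sy[OF nbhd])
    qed
    also have "\<dots> = measure (law Y) ?U" by (rule mY[OF nbhd])
    finally show "measure ?\<nu> C \<le> measure (law Y) ?U + e" unfolding \<nu>[OF Cs] by simp
    have "measure (law Y) C \<le> measure \<pi> (A \<inter> pts X \<times> C) + e"
      using split[OF sy[OF Cs]] mY[OF Cs] by simp
    also have "measure \<pi> (A \<inter> pts X \<times> C) \<le> measure \<pi> ((\<phi> -` ?U \<inter> pts X) \<times> pts Y)"
    proof (rule \<pi>.finite_measure_mono)
      show "A \<inter> pts X \<times> C \<subseteq> (\<phi> -` ?U \<inter> pts X) \<times> pts Y"
        using AXY close CY in_Y Y.commute by fastforce
      show "(\<phi> -` ?U \<inter> pts X) \<times> pts Y \<in> sets \<pi>" by (rule sx[OF sX[OF nbhd]])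
    qed
    also have "\<dots> = measure (law X) (\<phi> -` ?U \<inter> pts X)" by (rule mX[OF sX[OF nbhd]])
    finally show "measure (law Y) C \<le> measure ?\<nu> ?U + e" unfolding \<nu>[OF nbhd] by simp
  qed (auto simp: Y.law.prob_space_axioms)
  have surj: "\<exists>x\<in>pts X. \<phi> x = y" if y: "y \<in> pts Y" for y
  proof -
    have "\<exists>x\<in>pts X. gds_dist Y (\<phi> x) y < 1 / real (Suc n)" for n
    proof (rule ccontr)
      assume "\<not> ?thesis"
      then have "\<phi> -` Y.mball y (1 / real (Suc n)) \<inter> pts X = {}" by (auto simp: Y.commute)
      then have "measure ?\<nu> (Y.mball y (1 / real (Suc n))) = 0" using \<nu> by simp
      then show False using Y.mball_pos[OF y, of "1 / real (Suc n)"] push by simp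
    qed
    then obtain x where x: "\<And>n. x n \<in> pts X" "\<And>n. gds_dist Y (\<phi> (x n)) y < 1 / real (Suc n)" by metis
    have lim0: "(\<lambda>n. 1 / real (Suc n)) \<longlonglongrightarrow> 0"
      using LIMSEQ_inverse_real_of_nat by (simp add: inverse_eq_divide)
    have "(\<lambda>n. gds_dist Y (\<phi> (x n)) y) \<longlonglongrightarrow> 0"
      by (rule tendsto_sandwich[OF _ _ tendsto_const lim0]; rule always_eventually; intro allI)
        (rule Y.nonneg, rule less_imp_le[OF x(2)])
    then have L: "limitin Y.mtopology (\<lambda>n. \<phi> (x n)) y sequentially"
      unfolding Y.limitin_metric_dist_null using y x in_Y by auto
    have "Y.MCauchy (\<lambda>n. \<phi> (x n))"
      by (rule Y.convergent_imp_MCauchy[OF _ L]) (use x in_Y in auto)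
    then have "X.MCauchy x"
      unfolding X.MCauchy_def Y.MCauchy_def using x isom by auto
    then obtain x' where x': "limitin X.mtopology x x' sequentially"
      using X.mcomplete unfolding X.mcomplete_def by blast
    then have "limitin Y.mtopology (\<lambda>n. \<phi> (x n)) (\<phi> x') sequentially"
      unfolding Y.limitin_metric_dist_null X.limitin_metric_dist_null using x in_Y isom by simp
    then have "\<phi> x' = y" using L Y.limitin_metric_unique by fastforce
    moreover have "x' \<in> pts X" using x' X.limitin_mspace by blast
    ultimately show ?thesis by blast
  qed
  have "distr (law X) (borel_of (gds_top Y)) \<phi> = ?\<nu>"
    by (rule distr_cong) (auto simp: Y.sets_law Y.gds_top_eq)
  then have push': "distr (law X) (borel_of (gds_top Y)) \<phi> = law Y" using push by simp
  have "compose (pts X) g \<phi> \<in> feats_closure X" if g: "g \<in> feats_closure Y" for g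
    unfolding X.feats_closure_iff
  proof (intro conjI allI impI)
    show "compose (pts X) g \<phi> \<in> Lip1 X"
    proof -
      have "\<bar>g (\<phi> x) - g (\<phi> y)\<bar> \<le> gds_dist X x y" if x: "x \<in> pts X" "y \<in> pts X" for x y
      proof -
        have "\<bar>g (\<phi> x) - g (\<phi> y)\<bar> \<le> gds_dist Y (\<phi> x) (\<phi> y)"
          using Y.feats_closureD(1)[OF g] in_Y[OF x(1)] in_Y[OF x(2)] unfolding Lip1_def by blast
        then show ?thesis unfolding isom[OF x] .
      qed
      then show ?thesis by (simp add: Lip1_def compose_def)
    qed
  next
    fix K e assume K: "finite K \<and> K \<subseteq> pts X \<and> 0 < (e::real)"
    have "\<exists>h\<in>feats Y. \<forall>y\<in>\<phi> ` K. \<bar>g y - h y\<bar> < e / 2"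
      by (rule Y.feats_closureD(2)[OF g]) (use K in_Y in auto)
    then obtain h where h: "h \<in> feats Y" "\<And>x. x \<in> K \<Longrightarrow> \<bar>g (\<phi> x) - h (\<phi> x)\<bar> < e / 2" by blast
    obtain R where R: "full_rel X Y R" "\<And>f g x. (f, g) \<in> R \<Longrightarrow> x \<in> K \<Longrightarrow> \<bar>f x - g (\<phi> x)\<bar> < e / 2"
      using rel[of K "e / 2"] K by fastforce
    obtain f where f: "(f, h) \<in> R" using full_relD(4)[OF R(1) h(1)] by blast
    have "\<bar>compose (pts X) g \<phi> x - f x\<bar> < e" if "x \<in> K" for x
    proof -
      have "compose (pts X) g \<phi> x = g (\<phi> x)" using K that by (auto simp: compose_def)
      then show ?thesis using h(2)[OF that] R(2)[OF f that] by linarith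
    qed
    then show "\<exists>f\<in>feats X. \<forall>x\<in>K. \<bar>compose (pts X) g \<phi> x - f x\<bar> < e"
      using full_relD(1)[OF R(1) f] by blast
  qed
  moreover have "\<exists>g\<in>feats_closure Y. f = compose (pts X) g \<phi>" if f: "f \<in> feats_closure X" for f
  proof -
    \<comment> \<open>The inverse isometry, through which members of \<open>feats_closure X\<close>
      are transported to \<open>Y\<close>.\<close>
    define \<psi> where "\<psi> y = (SOME x. x \<in> pts X \<and> \<phi> x = y)" for y
    have \<psi>: "\<psi> y \<in> pts X" "\<phi> (\<psi> y) = y" if "y \<in> pts Y" for y
      using someI_ex[of "\<lambda>x. x \<in> pts X \<and> \<phi> x = y"] surj[OF that] unfolding \<psi>_def by blast+
    have \<psi>\<phi>: "\<psi> (\<phi> x) = x" if "x \<in> pts X" for x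
    proof -
      have "gds_dist X (\<psi> (\<phi> x)) x = gds_dist Y (\<phi> x) (\<phi> x)"
        using isom[of "\<psi> (\<phi> x)" x] \<psi>[OF in_Y[OF that]] that by simp
      then show ?thesis using \<psi>[OF in_Y[OF that]] that in_Y[OF that] by simp
    qed
    define g where "g = (\<lambda>y\<in>pts Y. f (\<psi> y))"
    have "g \<in> feats_closure Y"
      unfolding Y.feats_closure_iff
    proof (intro conjI allI impI)
      have "\<bar>g y - g y'\<bar> \<le> gds_dist Y y y'" if y: "y \<in> pts Y" "y' \<in> pts Y" for y y'
        using X.feats_closureD(1)[OF f] \<psi>[OF y(1)] \<psi>[OF y(2)] isom[of "\<psi> y" "\<psi> y'"] y
        by (auto simp: g_def Lip1_def)
      then show "g \<in> Lip1 Y" by (auto simp: Lip1_def g_def)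
    next
      fix K e assume K: "finite K \<and> K \<subseteq> pts Y \<and> 0 < (e::real)"
      then have K': "finite (\<psi> ` K)" "\<psi> ` K \<subseteq> pts X" "0 < e / 2" using \<psi> by auto
      obtain h where h: "h \<in> feats X" "\<And>y. y \<in> K \<Longrightarrow> \<bar>f (\<psi> y) - h (\<psi> y)\<bar> < e / 2"
        using X.feats_closureD(2)[OF f K'] by blast
      obtain R where R: "full_rel X Y R" "\<And>f g x. (f, g) \<in> R \<Longrightarrow> x \<in> \<psi> ` K \<Longrightarrow> \<bar>f x - g (\<phi> x)\<bar> < e / 2"
        using rel[OF K'] by fastforce
      obtain k where k: "(h, k) \<in> R" using full_relD(3)[OF R(1) h(1)] by blast
      have "\<bar>g y - k y\<bar> < e" if y: "y \<in> K" for y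
      proof -
        have "g y = f (\<psi> y)" "\<phi> (\<psi> y) = y" using K y \<psi> by (auto simp: g_def)
        then show ?thesis using h(2)[OF y] R(2)[OF k imageI[OF y]] by (simp only:)
      qed
      then show "\<exists>f\<in>feats Y. \<forall>x\<in>K. \<bar>g x - f x\<bar> < e"
        using full_relD(2)[OF R(1) k] by blast
    qed
    moreover have "f = compose (pts X) g \<phi>"
    proof
      fix x show "f x = compose (pts X) g \<phi> x"
        using X.feats_closureD(1)[OF f] in_Y \<psi>\<phi>
        by (cases "x \<in> pts X") (auto simp: g_def compose_def Lip1_def PiE_iff extensional_def)
    qed
    ultimately show ?thesis by blast
  qed
  ultimately have "precomp (pts X) (feats_closure Y) \<phi> = feats_closure X"
    unfolding precomp_def by blast
  then show ?thesis unfolding gds_iso_def using meas push' by blast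
qed

text \<open>If the distance is zero, then almost isometric relations \<open>E n\<close> carry almost all of couplings
  \<open>\<pi> n\<close>. Follow pairs in \<open>E n\<close> whose first components converge to a given \<open>x\<close>. Their second
  components are surrounded by balls whose masses are bounded below, and hence are totally bounded;
  along a diagonal subsequence they converge to the image of \<open>x\<close> under the isomorphism. This
  replaces an appeal to Prokhorov's theorem for the couplings.\<close>

lemma iso_if_box_zero:
  fixes X :: "'a gds" and Y :: "'b gds"
  assumes X: "geometric_data_set X" and Y: "geometric_data_set Y" and box: "box_dist X Y = 0"
  shows "gds_iso X Y"
proof -
  interpret X: gds_space X using X by unfold_locales
  interpret Y: gds_space Y using Y by unfold_locales
  \<comment> \<open>The exponent \<open>Suc n\<close> keeps \<open>e n\<close> below 1, so that
    \<open>E n\<close> is never empty.\<close>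
  define e :: "nat \<Rightarrow> real" where "e n = (1 / 2) ^ Suc n" for n
  have e: "0 < e n" "e n < 1" for n
    using power_le_one[of "1 / 2 :: real" n] by (auto simp: e_def)
  have e0: "e \<longlonglongrightarrow> 0"
    unfolding e_def by (intro LIMSEQ_Suc LIMSEQ_power_zero) simp
  have ev_e: "\<forall>\<^sub>F n in sequentially. e n < r" if "0 < r" for r
    by (rule order_tendstoD(2)[OF e0 that])
  have "near X Y (e n) (e n)" for n
  proof -
    have "near X Y (e n) (e n / 2)"
      by (rule near_if_box_less[OF X Y]) (use e in \<open>simp add: box\<close>)
    then show ?thesis by (rule near_mono[OF X Y]) (use e[of n] in auto)
  qed
  then obtain \<pi> R where \<pi>: "\<And>n. \<pi> n \<in> couplings X Y" and R: "\<And>n. full_rel X Y (R n)"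
    and m: "\<And>n. 1 - e n \<le> measure (\<pi> n) (agree X Y (R n) (e n))"
    unfolding near_def by metis
  define E where "E n = agree X Y (R n) (e n)" for n
  note \<pi>D = couplingsD[OF X Y \<pi>]
  have E: "E n \<in> sets (\<pi> n)" for n
    using agree_sets[OF X Y R] \<pi>D(2) by (simp add: E_def)
  have Ein: "a \<in> pts X" "b \<in> pts Y" if "(a, b) \<in> E n" for a b n
    using that by (auto simp: E_def agree_iff)
  have Edist: "\<bar>gds_dist X a a' - gds_dist Y b b'\<bar> \<le> 2 * e n" if "(a, b) \<in> E n" "(a', b') \<in> E n" for a b a' b' n
    using that unfolding E_def by (rule agree_dist_le[OF X R Y])
  have mE: "measure (law X) A - e n \<le> measure (\<pi> n) (E n \<inter> A \<times> pts Y)" if A: "A \<in> sets (law X)" for A n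
  proof -
    interpret \<pi>: prob_space "\<pi> n" by (rule \<pi>D)
    have As: "A \<times> pts Y \<in> sets (\<pi> n)" using A sets.top[of "law Y"] by (simp add: \<pi>D(2))
    have "measure (law X) A = measure (\<pi> n) (A \<times> pts Y)"
      using \<pi>D(8)[OF A, of n] by (simp add: measure_def)
    also have "\<dots> \<le> measure (\<pi> n) ((E n \<inter> A \<times> pts Y) \<union> (space (\<pi> n) - E n))"
      using As E sets.sets_into_space[OF As] by (intro \<pi>.finite_measure_mono) auto
    also have "\<dots> \<le> measure (\<pi> n) (E n \<inter> A \<times> pts Y) + measure (\<pi> n) (space (\<pi> n) - E n)"
      using As E by (intro measure_Un_le) auto
    also have "measure (\<pi> n) (space (\<pi> n) - E n) \<le> e n"
      using \<pi>.prob_compl[OF E] m[of n] by (simp add: E_def)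
    finally show ?thesis by simp
  qed
  have meets: "\<exists>a b. (a, b) \<in> E n \<and> a \<in> A" if "A \<in> sets (law X)" "e n < measure (law X) A" for n A
  proof (rule ccontr)
    assume "\<not> ?thesis"
    then have "E n \<inter> A \<times> pts Y = {}" by auto
    then show False using mE[OF that(1), of n] that(2) by simp
  qed
  \<comment> \<open>The pair \<open>p x n\<close> has a first component nearly as close to
    \<open>x\<close> as \<open>E n\<close> permits. Since balls around \<open>x\<close> have
    positive mass, \<open>E n\<close> eventually reaches into each of them, and the first components
    converge to \<open>x\<close>.\<close>
  have "\<exists>p. \<forall>n. p n \<in> E n \<and> gds_dist X x (fst (p n)) < (INF q\<in>E n. gds_dist X x (fst q)) + e n" for x
  proof (rule choice, intro allI)
    fix n
    let ?D = "(\<lambda>q. gds_dist X x (fst q)) ` E n"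
    have "E n \<noteq> {}"
      using meets[OF sets.top, of n] e(2)[of n] X.law.prob_space by auto
    then show "\<exists>p. p \<in> E n \<and> gds_dist X x (fst p) < Inf ?D + e n"
      using cInf_lessD[of ?D "Inf ?D + e n"] e(1)[of n] by auto
  qed
  then obtain p where p: "\<And>x n. p x n \<in> E n"
    and pinf: "\<And>x n. gds_dist X x (fst (p x n)) < (INF q\<in>E n. gds_dist X x (fst q)) + e n"
    by metis
  define u where "u x n = fst (p x n)" for x n
  define v where "v x n = snd (p x n)" for x n
  have uvE: "(u x n, v x n) \<in> E n" for x n using p by (simp add: u_def v_def)
  have u: "u x n \<in> pts X" and v: "v x n \<in> pts Y" for x n using Ein[OF uvE] by auto
  have ulim: "(\<lambda>n. gds_dist X x (u x n)) \<longlonglongrightarrow> 0" if x: "x \<in> pts X" for x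
  proof (rule tendstoI)
    fix r :: real assume r: "0 < r"
    have "\<forall>\<^sub>F n in sequentially. e n < measure (law X) (X.mball x (r / 2))"
      by (rule ev_e[OF X.mball_pos[OF x]]) (use r in simp)
    moreover have "\<forall>\<^sub>F n in sequentially. e n < r / 2" by (rule ev_e) (use r in simp)
    ultimately show "\<forall>\<^sub>F n in sequentially. dist (gds_dist X x (u x n)) 0 < r"
    proof eventually_elim
      case (elim n)
      obtain a b where ab: "(a, b) \<in> E n" "a \<in> X.mball x (r / 2)"
        using meets[OF X.mball_sets elim(1)] by blast
      have "(INF q\<in>E n. gds_dist X x (fst q)) \<le> gds_dist X x (fst (a, b))"
        by (rule cINF_lower[OF _ ab(1)]) (auto intro!: bdd_belowI2[of _ 0])
      then show ?case using pinf[of x n] ab(2) elim(2) by (simp add: u_def dist_real_def)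
    qed
  qed
  have tb: "Y.mtotally_bounded (range (v x))" if x: "x \<in> pts X" for x
  proof (rule Y.mtotally_bounded_if_finite_cover)
    fix r0 :: real assume r0: "0 < r0"
    \<comment> \<open>Distances from \<open>b\<close> to \<open>v x n\<close> will be below
      \<open>4 * r\<close>, and the ball around \<open>c i\<close> adds one more \<open>r\<close>,
      which stays below \<open>r0 = 6 * r\<close>.\<close>
    define r where "r = r0 / 6"
    have r: "0 < r" using r0 by (simp add: r_def)
    define w where "w = measure (law X) (X.mball x r)"
    have w: "0 < w" unfolding w_def by (rule X.mball_pos[OF x r])
    obtain c where c: "Y.dense_seq c" using Y.ex_dense_seq by blast
    obtain J :: nat where J: "measure (law Y) (\<Union>i<J. Y.mball (c i) r) > 1 - w / 2"
      using Y.finite_balls_large[OF c r, of "w / 2"] w by auto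
    have "\<forall>\<^sub>F n in sequentially. e n < w / 2 \<and> e n < r \<and> gds_dist X x (u x n) < r"
      using ev_e[of "w / 2"] ev_e[OF r] order_tendstoD(2)[OF ulim[OF x] r] w by (auto intro: eventually_conj)
    then obtain N where N: "\<And>n. N \<le> n \<Longrightarrow> e n < w / 2 \<and> e n < r \<and> gds_dist X x (u x n) < r"
      by (auto simp: eventually_sequentially)
    \<comment> \<open>If \<open>v x n\<close> were far from all the centres, the part of
      \<open>E n\<close> over the ball around \<open>x\<close>, of mass at least
      \<open>w - e n > w / 2\<close>, would be disjoint from the part of the product over the balls
      around the centres, of mass above \<open>1 - w / 2\<close>.\<close>
    have cov: "\<exists>i<J. v x n \<in> Y.mball (c i) r0" if n: "N \<le> n" for n
    proof (rule ccontr)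
      assume no: "\<not> ?thesis"
      interpret \<pi>: prob_space "\<pi> n" by (rule \<pi>D)
      let ?A = "E n \<inter> X.mball x r \<times> pts Y" and ?B = "pts X \<times> (\<Union>i<J. Y.mball (c i) r)"
      have B: "(\<Union>i<J. Y.mball (c i) r) \<in> sets (law Y)" by auto
      have Bs: "?B \<in> sets (\<pi> n)"
        using B sets.top[of "law X"] unfolding \<pi>D(2) by (intro pair_measureI) auto
      have As: "?A \<in> sets (\<pi> n)" using E[of n] sets.top[of "law Y"] by (auto simp: \<pi>D(2))
      have "?A \<inter> ?B = {}"
      proof (rule ccontr)
        assume "?A \<inter> ?B \<noteq> {}"
        then obtain a b i where ab: "(a, b) \<in> E n" "a \<in> X.mball x r" and i: "i < J" "b \<in> Y.mball (c i) r" by blast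
        have "gds_dist Y b (v x n) \<le> gds_dist X a (u x n) + 2 * e n"
          using Edist[OF ab(1) uvE[of x n]] by linarith
        also have "gds_dist X a (u x n) \<le> gds_dist X x a + gds_dist X x (u x n)"
          using X.triangle[of a x "u x n"] ab(2) u[of x n] by (simp add: X.commute)
        finally have "gds_dist Y b (v x n) < 4 * r" using N[OF n] ab(2) by simp
        then have "gds_dist Y (c i) (v x n) < r0"
          using Y.triangle[of "c i" b "v x n"] i(2) v[of x n] r_def r by auto
        then show False using no i v[of x n] by auto
      qed
      have "measure (\<pi> n) ?A + measure (\<pi> n) ?B = measure (\<pi> n) (?A \<union> ?B)"
        by (rule \<pi>.finite_measure_Union[symmetric, OF As Bs]) fact
      also have "\<dots> \<le> 1" by simp
      finally have "measure (\<pi> n) ?A + measure (\<pi> n) ?B \<le> 1" .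
      moreover have "measure (\<pi> n) ?B > 1 - w / 2"
        using J \<pi>D(9)[OF B, of n] by (simp add: measure_def)
      moreover have "measure (\<pi> n) ?A \<ge> w - e n"
        unfolding w_def by (rule mE) simp
      ultimately show False using N[OF n] by linarith
    qed
    let ?C = "c ` {..<J} \<union> v x ` {..<N}"
    have "v x n \<in> (\<Union>y\<in>?C. Y.mball y r0)" for n
    proof (cases "N \<le> n")
      case False
      then have "v x n \<in> ?C" "v x n \<in> Y.mball (v x n) r0" using v r0 by auto
      then show ?thesis by blast
    qed (use cov in blast)
    then have "range (v x) \<subseteq> (\<Union>y\<in>?C. Y.mball y r0)" by blast
    moreover have "finite ?C" "?C \<subseteq> pts Y" using v Y.dense_seqD(1)[OF c] by auto
    ultimately show "\<exists>C. finite C \<and> C \<subseteq> pts Y \<and> range (v x) \<subseteq> (\<Union>y\<in>C. Y.mball y r0)" by blast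
  qed (use v in auto)
  obtain c where c: "X.dense_seq c" using X.ex_dense_seq by blast
  have cin: "c i \<in> pts X" for i by (rule X.dense_seqD(1)[OF c])
  \<comment> \<open>The diagonal argument yields one subsequence along which \<open>v (c i)\<close>
    is Cauchy for every point of a dense sequence.\<close>
  interpret sub: subseqs "\<lambda>i s. Y.MCauchy (v (c i) \<circ> s)"
  proof
    fix i and s :: "nat \<Rightarrow> nat" assume "strict_mono s"
    have "range (v (c i) \<circ> s) \<subseteq> range (v (c i))" by auto
    then show "\<exists>r'. strict_mono r' \<and> Y.MCauchy (v (c i) \<circ> (s \<circ> r'))"
      using tb[OF cin, of i] unfolding Y.mtotally_bounded_sequentially by (simp add: comp_assoc[symmetric])
  qed
  define s where "s = sub.diagseq"
  have s: "strict_mono s" unfolding s_def by (rule sub.subseq_diagseq)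
  \<comment> \<open>Only the tail from \<open>Suc i\<close> on is a subsequence of the one chosen
    for \<open>c i\<close>.\<close>
  have Cauchy_c: "Y.MCauchy (v (c i) \<circ> (s \<circ> (+) (Suc i)))" for i
    unfolding s_def
  proof (rule sub.diagseq_holds)
    fix r s' :: "nat \<Rightarrow> nat" and n assume "strict_mono r" "Y.MCauchy (v (c n) \<circ> s')"
    then show "Y.MCauchy (v (c n) \<circ> (s' \<circ> r))"
      using Y.MCauchy_subsequence[of r "v (c n) \<circ> s'"] by (simp add: comp_assoc)
  qed
  have es: "(\<lambda>k. e (s k)) \<longlonglongrightarrow> 0"
    using LIMSEQ_subseq_LIMSEQ[OF e0 s] by (simp add: comp_def)
  define d where "d x k = gds_dist X x (u x (s k))" for x k
  have dlim: "d x \<longlonglongrightarrow> 0" if "x \<in> pts X" for x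
    using LIMSEQ_subseq_LIMSEQ[OF ulim[OF that] s] by (simp add: comp_def d_def[abs_def])
  have vdist: "gds_dist Y (v x (s k)) (v x' (s k)) \<le> gds_dist X x x' + d x k + d x' k + 2 * e (s k)"
    if x: "x \<in> pts X" "x' \<in> pts X" for x x' k
    using Edist[OF uvE[of x "s k"] uvE[of x' "s k"]] X.triangle[of "u x (s k)" x "u x' (s k)"]
      X.triangle[of x x' "u x' (s k)"] x u by (auto simp: d_def X.commute)
  \<comment> \<open>By \<open>vdist\<close>, \<open>v x\<close> and \<open>v (c i)\<close> stay
    about as close as \<open>x\<close> and \<open>c i\<close>, so the Cauchy property passes from
    the dense points to all \<open>x\<close>. The errors \<open>r / 12\<close>, taken three times,
    and \<open>2 * (r / 24)\<close> sum to \<open>r / 3\<close>.\<close>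
  have "\<exists>l. limitin Y.mtopology (\<lambda>k. v x (s k)) l sequentially" if x: "x \<in> pts X" for x
  proof -
    have "Y.MCauchy (\<lambda>k. v x (s k))"
      unfolding Y.MCauchy_def
    proof (intro conjI allI impI)
      fix r :: real assume r: "0 < r"
      obtain i where i: "gds_dist X (c i) x < r / 12"
        using X.dense_seqD(2)[OF c x, of "r / 12"] r by auto
      obtain N1 where N1: "\<And>n n'. N1 \<le> n \<Longrightarrow> N1 \<le> n' \<Longrightarrow>
          gds_dist Y (v (c i) (s (Suc i + n))) (v (c i) (s (Suc i + n'))) < r / 3"
        using Cauchy_c[of i] r unfolding Y.MCauchy_def by (force dest!: spec[of _ "r / 3"])
      have "\<forall>\<^sub>F k in sequentially. d x k < r / 12 \<and> d (c i) k < r / 12 \<and> e (s k) < r / 24"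
        using order_tendstoD(2)[OF dlim[OF x], of "r / 12"] order_tendstoD(2)[OF dlim[OF cin], of "r / 12" i]
          order_tendstoD(2)[OF es, of "r / 24"] r by (auto intro: eventually_conj)
      then obtain N2 where N2: "\<And>k. N2 \<le> k \<Longrightarrow> d x k < r / 12 \<and> d (c i) k < r / 12 \<and> e (s k) < r / 24"
        by (auto simp: eventually_sequentially)
      have near: "gds_dist Y (v x (s k)) (v (c i) (s k)) < r / 3" if "N2 \<le> k" for k
        using vdist[OF x cin[of i], of k] N2[OF that] i by (simp add: X.commute)
      show "\<exists>N. \<forall>n n'. N \<le> n \<longrightarrow> N \<le> n' \<longrightarrow> gds_dist Y (v x (s n)) (v x (s n')) < r"
      proof (intro exI[of _ "N1 + N2 + Suc i"] allI impI)
        fix n n' assume n: "N1 + N2 + Suc i \<le> n" "N1 + N2 + Suc i \<le> n'"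
        have "gds_dist Y (v (c i) (s n)) (v (c i) (s n')) < r / 3"
          using N1[of "n - Suc i" "n' - Suc i"] n by simp
        then show "gds_dist Y (v x (s n)) (v x (s n')) < r"
          using near[of n] near[of n'] n
            Y.triangle[of "v x (s n)" "v (c i) (s n)" "v x (s n')"]
            Y.triangle[of "v (c i) (s n)" "v (c i) (s n')" "v x (s n')"] v
          by (simp add: Y.commute)
      qed
    qed (use v in auto)
    then show ?thesis using Y.mcomplete unfolding Y.mcomplete_def by blast
  qed
  then obtain \<phi> where \<phi>: "\<And>x. x \<in> pts X \<Longrightarrow> limitin Y.mtopology (\<lambda>k. v x (s k)) (\<phi> x) sequentially" by metis
  have in_Y: "\<phi> x \<in> pts Y" if "x \<in> pts X" for x using \<phi>[OF that] Y.limitin_mspace by blast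
  define h where "h x k = gds_dist Y (v x (s k)) (\<phi> x)" for x k
  have hlim: "h x \<longlonglongrightarrow> 0" if "x \<in> pts X" for x
    using \<phi>[OF that] unfolding Y.limitin_metric_dist_null by (simp add: h_def[abs_def])
  \<comment> \<open>The error with which pairs in \<open>E (s k)\<close> compare distances to
    \<open>x\<close> with distances to \<open>\<phi> x\<close>: twice \<open>e (s k)\<close> for the
    agreement, \<open>d\<close> and \<open>h\<close> for replacing \<open>u x (s k)\<close> and
    \<open>v x (s k)\<close> by their limits.\<close>
  define g where "g x k = 2 * e (s k) + d x k + h x k" for x k
  have glim: "g x \<longlonglongrightarrow> 0" if "x \<in> pts X" for x
    using tendsto_add[OF tendsto_add[OF tendsto_mult_right_zero[OF es, of 2] dlim[OF that]] hlim[OF that]]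
    by (simp add: g_def[abs_def])
  have ev_g: "\<forall>\<^sub>F k in sequentially. g x k < r" if "x \<in> pts X" "0 < r" for x r
    by (rule order_tendstoD(2)[OF glim[OF that(1)] that(2)])
  have key: "\<bar>gds_dist X a x - gds_dist Y b (\<phi> x)\<bar> \<le> g x k" if ab: "(a, b) \<in> E (s k)" and x: "x \<in> pts X" for a b x k
  proof -
    have "\<bar>gds_dist X a (u x (s k)) - gds_dist Y b (v x (s k))\<bar> \<le> 2 * e (s k)"
      by (rule Edist[OF ab uvE])
    moreover have "\<bar>gds_dist X a x - gds_dist X a (u x (s k))\<bar> \<le> d x k"
      using X.triangle[of a x "u x (s k)"] X.triangle[of a "u x (s k)" x] Ein[OF ab] u x
      by (auto simp: d_def X.commute abs_le_iff)
    moreover have "\<bar>gds_dist Y b (v x (s k)) - gds_dist Y b (\<phi> x)\<bar> \<le> h x k"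
      using Y.triangle[of b "v x (s k)" "\<phi> x"] Y.triangle[of b "\<phi> x" "v x (s k)"] Ein[OF ab] v in_Y[OF x]
      by (auto simp: h_def Y.commute abs_le_iff)
    ultimately show ?thesis unfolding g_def by linarith
  qed
  have isom: "gds_dist Y (\<phi> x) (\<phi> x') = gds_dist X x x'" if x: "x \<in> pts X" "x' \<in> pts X" for x x'
  proof -
    have le: "\<bar>gds_dist Y (\<phi> x) (\<phi> x') - gds_dist X x x'\<bar> \<le> g x' k + d x k + h x k" for k
    proof -
      have "\<bar>gds_dist X (u x (s k)) x' - gds_dist Y (v x (s k)) (\<phi> x')\<bar> \<le> g x' k"
        by (rule key[OF uvE x(2)])
      moreover have "\<bar>gds_dist X x x' - gds_dist X (u x (s k)) x'\<bar> \<le> d x k"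
        using X.triangle[of x "u x (s k)" x'] X.triangle[of "u x (s k)" x x'] u x
        by (auto simp: d_def X.commute abs_le_iff)
      moreover have "\<bar>gds_dist Y (\<phi> x) (\<phi> x') - gds_dist Y (v x (s k)) (\<phi> x')\<bar> \<le> h x k"
        using Y.triangle[of "\<phi> x" "v x (s k)" "\<phi> x'"] Y.triangle[of "v x (s k)" "\<phi> x" "\<phi> x'"] v in_Y x
        by (auto simp: h_def Y.commute abs_le_iff)
      ultimately show ?thesis by linarith
    qed
    have "(\<lambda>k. g x' k + d x k + h x k) \<longlonglongrightarrow> 0 + 0 + 0"
      by (intro tendsto_add glim dlim hlim x)
    then have "\<bar>gds_dist Y (\<phi> x) (\<phi> x') - gds_dist X x x'\<bar> \<le> 0"
      using le by (intro LIMSEQ_le_const[where X="\<lambda>k. g x' k + d x k + h x k"]) auto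
    then show ?thesis by simp
  qed
  show ?thesis
  proof (rule iso_if_almost_isometry[OF X Y in_Y isom])
    fix r :: real assume r: "0 < r"
    \<comment> \<open>Convergence of \<open>g x\<close> is not uniform in \<open>x\<close>, so it is
      used at finitely many centres only, and \<open>\<phi> a\<close> and \<open>b\<close> are both
      compared with the image of a centre near \<open>a\<close>. This spends three of the four
      shares \<open>r / 4\<close>.\<close>
    obtain J :: nat where J: "measure (law X) (\<Union>i<J. X.mball (c i) (r / 4)) > 1 - r / 2"
      using X.finite_balls_large[OF c, of "r / 4" "r / 2"] r by auto
    have "\<forall>\<^sub>F k in sequentially. \<forall>i<J. g (c i) k < r / 4"
    proof -
      have "\<forall>\<^sub>F k in sequentially. \<forall>i\<in>{..<J}. g (c i) k < r / 4"
        by (intro eventually_ball_finite ballI ev_g cin) (use r in auto)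
      then show ?thesis by (simp only: Ball_def lessThan_iff)
    qed
    moreover have "\<forall>\<^sub>F k in sequentially. e (s k) < r / 2"
      using order_tendstoD(2)[OF es, of "r / 2"] r by simp
    ultimately have "\<forall>\<^sub>F k in sequentially. (\<forall>i<J. g (c i) k < r / 4) \<and> e (s k) < r / 2"
      by (rule eventually_conj)
    then obtain k where k: "\<And>i. i < J \<Longrightarrow> g (c i) k < r / 4" "e (s k) < r / 2"
      by (auto simp: eventually_sequentially)
    let ?A = "E (s k) \<inter> (\<Union>i<J. X.mball (c i) (r / 4)) \<times> pts Y"
    have B: "(\<Union>i<J. X.mball (c i) (r / 4)) \<in> sets (law X)" by auto
    have "?A \<in> sets (\<pi> (s k))"
    proof (rule sets.Int[OF E])
      show "(\<Union>i<J. X.mball (c i) (r / 4)) \<times> pts Y \<in> sets (\<pi> (s k))"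
        unfolding \<pi>D(2) using B sets.top[of "law Y"] by (intro pair_measureI) auto
    qed
    moreover have "measure (\<pi> (s k)) ?A \<ge> 1 - r"
      using mE[OF B, of "s k"] J k(2) by linarith
    moreover have "gds_dist Y (\<phi> a) b < r" if ab: "(a, b) \<in> ?A" for a b
    proof -
      obtain i where i: "i < J" "gds_dist X (c i) a < r / 4" "a \<in> pts X" using ab by auto
      have b: "b \<in> pts Y" "(a, b) \<in> E (s k)" using ab by auto
      have "gds_dist Y b (\<phi> (c i)) \<le> gds_dist X a (c i) + g (c i) k"
        using key[OF b(2) cin[of i]] by linarith
      then show ?thesis
        using Y.triangle[of "\<phi> a" "\<phi> (c i)" b] in_Y[OF i(3)] in_Y[OF cin[of i]] b(1) i
          isom[OF i(3) cin[of i]] k(1)[OF i(1)] r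
        by (simp add: X.commute Y.commute)
    qed
    ultimately show "\<exists>\<pi>\<in>couplings X Y. \<exists>A\<in>sets \<pi>. measure \<pi> A \<ge> 1 - r \<and> (\<forall>(a, b)\<in>A. gds_dist Y (\<phi> a) b < r)"
      using \<pi>[of "s k"] by blast
  next
    fix K :: "'a set" and r :: real assume K: "finite K" "K \<subseteq> pts X" and r: "0 < r"
    have "\<forall>\<^sub>F k in sequentially. \<forall>x\<in>K. g x k < r"
      by (intro eventually_ball_finite ballI ev_g) (use K r in auto)
    then obtain k where k: "\<And>x. x \<in> K \<Longrightarrow> g x k < r" by (auto simp: eventually_sequentially)
    have "\<bar>f x - f' (\<phi> x)\<bar> < r" if ff: "(f, f') \<in> R (s k)" and x: "x \<in> K" for f f' x
    proof -
      have xp: "x \<in> pts X" using x K by auto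
      have "\<bar>f (u x (s k)) - f' (v x (s k))\<bar> \<le> e (s k)"
        using uvE[of x "s k"] ff by (auto simp: E_def agree_iff)
      moreover have "\<bar>f x - f (u x (s k))\<bar> \<le> d x k"
        unfolding d_def by (rule X.feat_lipschitz[OF full_relD(1)[OF R ff] xp u])
      moreover have "\<bar>f' (v x (s k)) - f' (\<phi> x)\<bar> \<le> h x k"
        unfolding h_def by (rule Y.feat_lipschitz[OF full_relD(2)[OF R ff] v in_Y[OF xp]])
      ultimately show ?thesis using k[OF x] e(1)[of "s k"] unfolding g_def by linarith
    qed
    then show "\<exists>R. full_rel X Y R \<and> (\<forall>(f, g)\<in>R. \<forall>x\<in>K. \<bar>f x - g (\<phi> x)\<bar> < r)"
      using R[of "s k"] by blast
  qed
qed

section \<open>Realization of a family of random features\<close>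

text \<open>A geometric data set before its points are formed: the family \<open>G\<close> only
  induces a pseudometric, with finite values and the dense sequence \<open>c\<close>, and points may
  have null neighbourhoods. Measurability is imposed on the balls, since these generate the Borel
  sets of the realization.\<close>

locale feature_space = prob_space P for P :: "'w measure" +
  fixes G :: "('w \<Rightarrow> real) set" and c :: "nat \<Rightarrow> 'w"
  assumes G_nonempty: "G \<noteq> {}"
    and bdd: "\<And>w w'. w \<in> space P \<Longrightarrow> w' \<in> space P \<Longrightarrow> bdd_above ((\<lambda>f. \<bar>f w - f w'\<bar>) ` G)"
    and ball_sets: "\<And>w r. w \<in> space P \<Longrightarrow> {w' \<in> space P. (SUP f\<in>G. \<bar>f w - f w'\<bar>) < r} \<in> sets P"
    and c_in: "\<And>i. c i \<in> space P"
    and c_dense: "\<And>w r. w \<in> space P \<Longrightarrow> 0 < r \<Longrightarrow> \<exists>i. (SUP f\<in>G. \<bar>f (c i) - f w\<bar>) < r"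
begin

definition d :: "'w \<Rightarrow> 'w \<Rightarrow> real" where
  "d w w' = (SUP f\<in>G. \<bar>f w - f w'\<bar>)"

lemma feat_le_d: "f \<in> G \<Longrightarrow> w \<in> space P \<Longrightarrow> w' \<in> space P \<Longrightarrow> \<bar>f w - f w'\<bar> \<le> d w w'"
  unfolding d_def by (intro cSUP_upper bdd)

lemma d_le: "(\<And>f. f \<in> G \<Longrightarrow> \<bar>f w - f w'\<bar> \<le> r) \<Longrightarrow> d w w' \<le> r"
  unfolding d_def by (intro cSUP_least G_nonempty)

lemma d_commute: "d w w' = d w' w"
  by (simp add: d_def abs_minus_commute)

lemma d_triangle:
  assumes "u \<in> space P" "v \<in> space P" "w \<in> space P"
  shows "d u w \<le> d u v + d v w"
proof (rule d_le)
  fix f assume "f \<in> G"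
  then show "\<bar>f u - f w\<bar> \<le> d u v + d v w"
    using feat_le_d[of f u v] feat_le_d[of f v w] assms by linarith
qed

definition dball :: "'w \<Rightarrow> real \<Rightarrow> 'w set" where
  "dball w r = {w' \<in> space P. d w w' < r}"

lemma dball_sets: "w \<in> space P \<Longrightarrow> dball w r \<in> sets P"
  unfolding dball_def d_def by (rule ball_sets)

text \<open>The union of the null balls from a countable base for \<open>d\<close>; its complement
  is the support of \<open>P\<close> with respect to \<open>d\<close>.\<close>

definition null_part :: "'w set" where
  "null_part = (\<Union>(i, k)\<in>{(i, k). measure P (dball (c i) (1 / real (Suc k))) = 0}. dball (c i) (1 / real (Suc k)))"

lemma null_part: "null_part \<in> null_sets P"
  unfolding null_part_def
proof (rule null_sets_UN')
  fix t assume "t \<in> {(i, k). measure P (dball (c i) (1 / real (Suc k))) = 0}"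
  then show "(case t of (i, k) \<Rightarrow> dball (c i) (1 / real (Suc k))) \<in> null_sets P"
    using dball_sets[OF c_in] by (auto simp: null_sets_def emeasure_eq_measure)
qed simp

definition core :: "'w set" where
  "core = space P - null_part"

lemma core_space: "w \<in> core \<Longrightarrow> w \<in> space P"
  by (simp add: core_def)

lemma core_sets: "core \<in> sets P"
  using null_part by (auto simp: core_def)

lemma core_nonempty: "core \<noteq> {}"
proof
  assume "core = {}"
  then have "space P \<subseteq> null_part" by (auto simp: core_def)
  then have "space P \<in> null_sets P"
    using null_sets_subset[OF null_part] by auto
  then show False using emeasure_space_1 by (simp add: null_sets_def)
qed

text \<open>A ball around \<open>w\<close> contains a ball of the countable base that in turn
  contains \<open>w\<close>; were that one null, \<open>w\<close> would lie in
  \<open>null_part\<close>.\<close>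

lemma dball_pos:
  assumes w: "w \<in> core" and r: "0 < r"
  shows "0 < measure P (dball w r)"
proof -
  obtain k where k: "1 / real (Suc k) < r / 2" using nat_approx_posE[of "r / 2"] r by auto
  have k0: "0 < 1 / real (Suc k)" by simp
  obtain i where "d (c i) w < 1 / real (Suc k)"
    using c_dense[OF core_space[OF w] k0] unfolding d_def by blast
  then have i: "w \<in> dball (c i) (1 / real (Suc k))"
    using core_space[OF w] by (simp add: dball_def)
  have "dball (c i) (1 / real (Suc k)) \<subseteq> dball w r"
  proof
    fix u assume u: "u \<in> dball (c i) (1 / real (Suc k))"
    then show "u \<in> dball w r"
      using d_triangle[of w "c i" u] i k core_space[OF w] c_in[of i] by (simp add: dball_def d_commute)
  qed
  then have "measure P (dball (c i) (1 / real (Suc k))) \<le> measure P (dball w r)"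
    by (intro finite_measure_mono dball_sets core_space w)
  moreover have "measure P (dball (c i) (1 / real (Suc k))) \<noteq> 0"
    using w i unfolding core_def null_part_def by blast
  ultimately show ?thesis using measure_nonneg[of P "dball (c i) (1 / real (Suc k))"] by linarith
qed

text \<open>Points of \<open>core\<close> are identified with the evaluations at them, which makes the pseudometric \<open>d\<close>
  a metric; closing up under uniform limits makes it complete.\<close>

definition ev_closure :: "(('w \<Rightarrow> real) \<Rightarrow> real) set" where
  "ev_closure = {x \<in> G \<rightarrow>\<^sub>E UNIV. \<forall>r>0. \<exists>w\<in>core. \<forall>f\<in>G. \<bar>x f - f w\<bar> \<le> r}"

definition ev :: "'w \<Rightarrow> ('w \<Rightarrow> real) \<Rightarrow> real" where
  "ev w = (\<lambda>f\<in>G. f w)"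

lemma ev_in_closure: "w \<in> core \<Longrightarrow> ev w \<in> ev_closure"
  by (auto simp: ev_closure_def ev_def intro!: bexI[of _ w])

definition D :: "(('w \<Rightarrow> real) \<Rightarrow> real) \<Rightarrow> (('w \<Rightarrow> real) \<Rightarrow> real) \<Rightarrow> real" where
  "D x y = (SUP f\<in>G. \<bar>x f - y f\<bar>)"

lemma ev_closureD: "x \<in> ev_closure \<Longrightarrow> 0 < r \<Longrightarrow> \<exists>w\<in>core. \<forall>f\<in>G. \<bar>x f - f w\<bar> \<le> r"
  by (auto simp: ev_closure_def)

lemma D_bdd:
  assumes "x \<in> ev_closure" "y \<in> ev_closure"
  shows "bdd_above ((\<lambda>f. \<bar>x f - y f\<bar>) ` G)"
proof -
  obtain v where v: "v \<in> core" "\<And>f. f \<in> G \<Longrightarrow> \<bar>x f - f v\<bar> \<le> 1"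
    using ev_closureD[OF assms(1), of 1] by auto
  obtain w where w: "w \<in> core" "\<And>f. f \<in> G \<Longrightarrow> \<bar>y f - f w\<bar> \<le> 1"
    using ev_closureD[OF assms(2), of 1] by auto
  show ?thesis
  proof (rule bdd_aboveI2)
    fix f assume "f \<in> G"
    then show "\<bar>x f - y f\<bar> \<le> d v w + 2"
      using v(2)[of f] w(2)[of f] feat_le_d[of f v w] core_space[OF v(1)] core_space[OF w(1)] by linarith
  qed
qed

lemma le_D: "x \<in> ev_closure \<Longrightarrow> y \<in> ev_closure \<Longrightarrow> f \<in> G \<Longrightarrow> \<bar>x f - y f\<bar> \<le> D x y"
  unfolding D_def by (intro cSUP_upper D_bdd)

lemma D_le: "(\<And>f. f \<in> G \<Longrightarrow> \<bar>x f - y f\<bar> \<le> r) \<Longrightarrow> D x y \<le> r"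
  unfolding D_def by (intro cSUP_least G_nonempty)

lemma D_ev: "D (ev v) (ev w) = d v w"
  unfolding D_def d_def by (intro SUP_cong refl) (simp add: ev_def)

lemma ev_dense: "x \<in> ev_closure \<Longrightarrow> 0 < r \<Longrightarrow> \<exists>w\<in>core. D x (ev w) < r"
  using ev_closureD[of x "r / 2"] D_le[of x "ev _" "r / 2"]
  by (force simp: ev_def)

lemma Metric_space_ev_closure: "Metric_space ev_closure (\<lambda>x y. if x \<in> ev_closure \<and> y \<in> ev_closure then D x y else 0)"
proof
  show "0 \<le> (if x \<in> ev_closure \<and> y \<in> ev_closure then D x y else 0)" for x y
  proof -
    obtain f where "f \<in> G" using G_nonempty by blast
    then show ?thesis using order_trans[OF abs_ge_zero le_D[of x y f]] by simp
  qed
  show "(if x \<in> ev_closure \<and> y \<in> ev_closure then D x y else 0) = (if y \<in> ev_closure \<and> x \<in> ev_closure then D y x else 0)" for x y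
    by (simp add: D_def abs_minus_commute)
next
  fix x y assume x: "x \<in> ev_closure" "y \<in> ev_closure"
  show "((if x \<in> ev_closure \<and> y \<in> ev_closure then D x y else 0) = 0) = (x = y)"
  proof
    assume "(if x \<in> ev_closure \<and> y \<in> ev_closure then D x y else 0) = 0"
    then have "x f = y f" if "f \<in> G" for f using le_D[OF x that] x by simp
    then show "x = y" using x by (intro PiE_ext[of x G "\<lambda>_. UNIV" y]) (auto simp: ev_closure_def)
  next
    assume "x = y"
    then show "(if x \<in> ev_closure \<and> y \<in> ev_closure then D x y else 0) = 0"
      using G_nonempty by (simp add: D_def)
  qed
next
  fix x y z assume x: "x \<in> ev_closure" "y \<in> ev_closure" "z \<in> ev_closure"
  have "D x z \<le> D x y + D y z"
  proof (rule D_le)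
    fix f assume "f \<in> G"
    then show "\<bar>x f - z f\<bar> \<le> D x y + D y z"
      using le_D[of x y f] le_D[of y z f] x by linarith
  qed
  then show "(if x \<in> ev_closure \<and> z \<in> ev_closure then D x z else 0) \<le>
    (if x \<in> ev_closure \<and> y \<in> ev_closure then D x y else 0) + (if y \<in> ev_closure \<and> z \<in> ev_closure then D y z else 0)"
    using x by simp
qed

text \<open>A point is determined by the countable base balls that contain it, which bounds the
  number of points by the continuum. The centres are evaluations at \<open>c i\<close>, which may
  lie outside \<open>core\<close>.\<close>

lemma ex_code_ev_closure:
  obtains code :: "(('w \<Rightarrow> real) \<Rightarrow> real) \<Rightarrow> nat set" where "inj_on code ev_closure"
proof -
  define code where "code x = {prod_encode (i, k) | i k. \<forall>f\<in>G. \<bar>x f - f (c i)\<bar> \<le> 1 / real (Suc k)}" for x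
  have code_iff: "prod_encode (i, k) \<in> code x \<longleftrightarrow> (\<forall>f\<in>G. \<bar>x f - f (c i)\<bar> \<le> 1 / real (Suc k))" for i k x
    unfolding code_def by auto
  have "inj_on code ev_closure"
  proof (rule inj_onI)
    fix x y assume x: "x \<in> ev_closure" and y: "y \<in> ev_closure" and eq: "code x = code y"
    have "x f = y f" if f: "f \<in> G" for f
    proof (rule ccontr)
      assume "x f \<noteq> y f"
      then have "0 < \<bar>x f - y f\<bar> / 2" by simp
      \<comment> \<open>A base ball of radius below \<open>\<bar>x f - y f\<bar> / 2\<close> cannot
        contain both points.\<close>
      then obtain k where k: "1 / real (Suc k) < \<bar>x f - y f\<bar> / 2" by (rule nat_approx_posE)
      define r where "r = 1 / real (Suc k)"
      have r: "0 < r" by (simp add: r_def)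
      obtain w where w: "w \<in> core" "\<And>g. g \<in> G \<Longrightarrow> \<bar>x g - g w\<bar> \<le> r / 2"
        using ev_closureD[OF x, of "r / 2"] r by auto
      obtain i where i: "d (c i) w < r / 2"
        using c_dense[OF core_space[OF w(1)], of "r / 2"] r unfolding d_def by auto
      have xr: "\<bar>x g - g (c i)\<bar> \<le> r" if "g \<in> G" for g
        using w(2)[OF that] i feat_le_d[OF that c_in core_space[OF w(1)], of i] by linarith
      then have "prod_encode (i, k) \<in> code x" using xr unfolding code_iff r_def by blast
      then have "prod_encode (i, k) \<in> code y" using eq by simp
      then have "\<bar>y f - f (c i)\<bar> \<le> r" using f unfolding code_iff r_def by blast
      moreover have "\<bar>x f - f (c i)\<bar> \<le> r" by (rule xr[OF f])
      moreover have "\<bar>x f - y f\<bar> \<le> \<bar>x f - f (c i)\<bar> + \<bar>y f - f (c i)\<bar>" by linarith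
      ultimately show False using k[folded r_def] by argo
    qed
    then show "x = y" using x y by (intro PiE_ext[of x G "\<lambda>_. UNIV" y]) (auto simp: ev_closure_def)
  qed
  then show ?thesis by (rule that)
qed

end

context feature_space
begin

text \<open>The carrier is a copy of \<open>ev_closure\<close>: \<open>T f\<close> evaluates a point
  at \<open>f\<close>, and \<open>\<Phi> w\<close> is the evaluation at \<open>w\<close>. Discarding
  \<open>null_part\<close> gives full support, and it is also the exceptional set off which
  \<open>T f\<close> composed with \<open>\<Phi>\<close> returns \<open>f\<close>.\<close>

lemma realization:
  fixes inj_real :: "real \<Rightarrow> 'a"
  assumes "inj inj_real"
  obtains X :: "'a gds" and \<Phi> T N where "geometric_data_set X" "N \<in> null_sets P"
    "\<Phi> \<in> P \<rightarrow>\<^sub>M law X" "distr P (law X) \<Phi> = law X" "feats X = T ` G"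
    "\<And>f w. f \<in> G \<Longrightarrow> w \<in> space P - N \<Longrightarrow> T f (\<Phi> w) = f w"
proof -
  obtain code :: "(('w \<Rightarrow> real) \<Rightarrow> real) \<Rightarrow> nat set" where code: "inj_on code ev_closure"
    by (rule ex_code_ev_closure)
  obtain g :: "nat set \<Rightarrow> real" where g: "inj g"
    using nat_sets_eqpoll_reals unfolding eqpoll_def bij_betw_def by blast
  \<comment> \<open>From points to sets of naturals, on to reals and into \<open>'a\<close>.\<close>
  define j where "j x = inj_real (g (code x))" for x
  have j: "inj_on j ev_closure"
    using code g assms by (auto simp: j_def inj_on_def)
  define A where "A = j ` ev_closure"
  define \<psi> where "\<psi> = inv_into ev_closure j"
  have \<psi>: "\<psi> a \<in> ev_closure" "j (\<psi> a) = a" if "a \<in> A" for a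
    using that by (auto simp: A_def \<psi>_def inv_into_into f_inv_into_f)
  have \<psi>j: "\<psi> (j x) = x" if "x \<in> ev_closure" for x
    using j that by (simp add: \<psi>_def)
  have jA: "j x \<in> A" if "x \<in> ev_closure" for x using that by (simp add: A_def)
  define T where "T f = (\<lambda>a\<in>A. \<psi> a f)" for f
  define dA where "dA a b = (if a \<in> A \<and> b \<in> A then D (\<psi> a) (\<psi> b) else 0)" for a b
  interpret Z: Metric_space ev_closure "\<lambda>x y. if x \<in> ev_closure \<and> y \<in> ev_closure then D x y else 0"
    by (rule Metric_space_ev_closure)
  have D_nonneg: "0 \<le> D x y" if "x \<in> ev_closure" "y \<in> ev_closure" for x y
    using Z.nonneg[of x y] that by simp
  interpret A: Metric_space A dA
  proof
    show "0 \<le> dA a b" for a b using D_nonneg \<psi>(1) by (simp add: dA_def)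
    show "dA a b = dA b a" for a b by (simp add: dA_def D_def abs_minus_commute)
    show "dA a b = 0 \<longleftrightarrow> a = b" if "a \<in> A" "b \<in> A" for a b
    proof -
      have "\<psi> a = \<psi> b \<longleftrightarrow> a = b" using \<psi>(2)[OF that(1)] \<psi>(2)[OF that(2)] by metis
      then show ?thesis
        using Z.zero[OF \<psi>(1)[OF that(1)] \<psi>(1)[OF that(2)]] \<psi>(1) that by (simp add: dA_def)
    qed
    show "dA a b' \<le> dA a b + dA b b'" if "a \<in> A" "b \<in> A" "b' \<in> A" for a b b'
      using Z.triangle[of "\<psi> a" "\<psi> b" "\<psi> b'"] \<psi>(1) that by (simp add: dA_def)
  qed
  have dAj: "dA (j x) (j y) = D x y" if "x \<in> ev_closure" "y \<in> ev_closure" for x y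
    using that by (simp add: dA_def \<psi>j jA)
  have le_dA: "\<bar>\<psi> a f - \<psi> b f\<bar> \<le> dA a b" if "a \<in> A" "b \<in> A" "f \<in> G" for a b f
    using le_D[of "\<psi> a" "\<psi> b" f] \<psi>(1) that by (simp add: dA_def)
  have complete: "A.mcomplete"
    unfolding A.mcomplete_def
  proof (intro allI impI)
    fix \<sigma> assume \<sigma>: "A.MCauchy \<sigma>"
    then have \<sigma>A: "\<sigma> n \<in> A" for n unfolding A.MCauchy_def by auto
    have Cau: "\<exists>N. \<forall>n n'. N \<le> n \<longrightarrow> N \<le> n' \<longrightarrow> dA (\<sigma> n) (\<sigma> n') < r" if "0 < r" for r
      using \<sigma> that unfolding A.MCauchy_def by blast
    have "convergent (\<lambda>n. \<psi> (\<sigma> n) f)" if f: "f \<in> G" for f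
    proof (rule Cauchy_convergent, rule CauchyI)
      fix r :: real assume "0 < r"
      then obtain N where N: "\<And>n n'. N \<le> n \<Longrightarrow> N \<le> n' \<Longrightarrow> dA (\<sigma> n) (\<sigma> n') < r" using Cau by blast
      have "norm (\<psi> (\<sigma> m) f - \<psi> (\<sigma> n) f) < r" if "N \<le> m" "N \<le> n" for m n
        using le_dA[OF \<sigma>A[of m] \<sigma>A[of n] f] N[OF that] by simp
      then show "\<exists>M. \<forall>m\<ge>M. \<forall>n\<ge>M. norm (\<psi> (\<sigma> m) f - \<psi> (\<sigma> n) f) < r" by blast
    qed
    then have lim: "(\<lambda>n. \<psi> (\<sigma> n) f) \<longlonglongrightarrow> lim (\<lambda>n. \<psi> (\<sigma> n) f)" if "f \<in> G" for f
      using that by (simp add: convergent_LIMSEQ_iff)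
    \<comment> \<open>The Cauchy condition is uniform in \<open>f\<close>, so this pointwise limit
      is a uniform one and stays in \<open>ev_closure\<close>.\<close>
    define y where "y = (\<lambda>f\<in>G. lim (\<lambda>n. \<psi> (\<sigma> n) f))"
    have close: "\<exists>N. \<forall>n\<ge>N. \<forall>f\<in>G. \<bar>\<psi> (\<sigma> n) f - y f\<bar> \<le> r" if r: "0 < r" for r
    proof -
      obtain N where N: "\<And>n n'. N \<le> n \<Longrightarrow> N \<le> n' \<Longrightarrow> dA (\<sigma> n) (\<sigma> n') < r" using Cau[OF r] by blast
      have "\<bar>\<psi> (\<sigma> n) f - y f\<bar> \<le> r" if n: "N \<le> n" and f: "f \<in> G" for n f
      proof -
        have "(\<lambda>m. \<bar>\<psi> (\<sigma> n) f - \<psi> (\<sigma> m) f\<bar>) \<longlonglongrightarrow> \<bar>\<psi> (\<sigma> n) f - y f\<bar>"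
          using lim[OF f] f by (intro tendsto_rabs tendsto_diff tendsto_const) (simp add: y_def)
        moreover have "\<exists>M. \<forall>m\<ge>M. \<bar>\<psi> (\<sigma> n) f - \<psi> (\<sigma> m) f\<bar> \<le> r"
          using le_dA[OF \<sigma>A \<sigma>A f] N[OF n] by (meson less_imp_le order_trans)
        ultimately show ?thesis by (rule LIMSEQ_le_const2)
      qed
      then show ?thesis by blast
    qed
    have y: "y \<in> ev_closure"
      unfolding ev_closure_def
    proof (intro CollectI conjI allI impI)
      fix r :: real assume r: "0 < r"
      obtain N where N: "\<And>f. f \<in> G \<Longrightarrow> \<bar>\<psi> (\<sigma> N) f - y f\<bar> \<le> r / 2" using close[of "r / 2"] r by auto
      obtain w where w: "w \<in> core" "\<And>f. f \<in> G \<Longrightarrow> \<bar>\<psi> (\<sigma> N) f - f w\<bar> \<le> r / 2"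
        using ev_closureD[OF \<psi>(1)[OF \<sigma>A], of "r / 2" N] r by auto
      have "\<bar>y f - f w\<bar> \<le> r" if "f \<in> G" for f using N[OF that] w(2)[OF that] by linarith
      then show "\<exists>w\<in>core. \<forall>f\<in>G. \<bar>y f - f w\<bar> \<le> r" using w(1) by blast
    qed (simp add: y_def)
    have "limitin A.mtopology \<sigma> (j y) sequentially"
      unfolding A.limitin_metric
    proof (intro conjI allI impI)
      fix r :: real assume r: "0 < r"
      obtain N where N: "\<And>n f. N \<le> n \<Longrightarrow> f \<in> G \<Longrightarrow> \<bar>\<psi> (\<sigma> n) f - y f\<bar> \<le> r / 2" using close[of "r / 2"] r by auto
      have "\<sigma> n \<in> A \<and> dA (\<sigma> n) (j y) < r" if "N \<le> n" for n
      proof -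
        have "D (\<psi> (\<sigma> n)) y \<le> r / 2" by (rule D_le) (rule N[OF that])
        then show ?thesis using r \<sigma>A y by (simp add: dA_def \<psi>j jA)
      qed
      then show "\<forall>\<^sub>F n in sequentially. \<sigma> n \<in> A \<and> dA (\<sigma> n) (j y) < r"
        by (auto simp: eventually_sequentially)
    qed (simp add: jA y)
    then show "\<exists>x. limitin A.mtopology \<sigma> x sequentially" by blast
  qed
  \<comment> \<open>The centres \<open>c i\<close> may fall outside \<open>core\<close>, so one
    point of \<open>core\<close> is picked from each base ball that meets it.\<close>
  define Q where "Q = (\<lambda>(i, k). SOME w. w \<in> core \<and> d (c i) w < 1 / real (Suc k)) `
      {(i, k). \<exists>w. w \<in> core \<and> d (c i) w < 1 / real (Suc k)}"
  have Qcount: "countable Q" unfolding Q_def by (rule countable_image) simp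
  have Qcore: "w \<in> core" if "w \<in> Q" for w
    using that someI_ex[where P="\<lambda>w. w \<in> core \<and> d (c _) w < 1 / real (Suc _)"] unfolding Q_def by force
  have Qdense: "\<exists>q\<in>Q. dA (j (ev q)) a < r" if a: "a \<in> A" and r: "0 < r" for a r
  proof -
    obtain w where w: "w \<in> core" "D (\<psi> a) (ev w) < r / 2" using ev_dense[OF \<psi>(1)[OF a], of "r / 2"] r by auto
    obtain k where k: "1 / real (Suc k) < r / 4" using nat_approx_posE[of "r / 4"] r by auto
    have k0: "0 < 1 / real (Suc k)" by simp
    obtain i where i: "d (c i) w < 1 / real (Suc k)"
      using c_dense[OF core_space[OF w(1)] k0] unfolding d_def by blast
    define q where "q = (SOME w. w \<in> core \<and> d (c i) w < 1 / real (Suc k))"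
    have q: "q \<in> core" "d (c i) q < 1 / real (Suc k)"
      using someI_ex[of "\<lambda>w. w \<in> core \<and> d (c i) w < 1 / real (Suc k)"] w(1) i unfolding q_def by blast+
    have "q \<in> Q" unfolding Q_def q_def using w(1) i by (auto intro!: image_eqI[of _ _ "(i, k)"])
    have "d q w < r / 2"
      using d_triangle[of q "c i" w] i q k core_space[OF q(1)] core_space[OF w(1)] c_in by (simp add: d_commute)
    then have "dA (j (ev q)) (j (ev w)) < r / 2"
      using q w by (simp add: dAj ev_in_closure D_ev)
    moreover have "dA (j (ev w)) a < r / 2"
      using w a A.commute[of a "j (ev w)"] by (simp add: dA_def \<psi>j jA ev_in_closure)
    ultimately show ?thesis
      using A.triangle[of "j (ev q)" "j (ev w)" a] a q w \<open>q \<in> Q\<close> by (force simp: jA ev_in_closure)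
  qed
  have separable: "separable_space A.mtopology"
    unfolding separable_space_def
  proof (intro exI[of _ "(\<lambda>q. j (ev q)) ` Q"] conjI)
    show "countable ((\<lambda>q. j (ev q)) ` Q)" using Qcount by blast
    show *: "(\<lambda>q. j (ev q)) ` Q \<subseteq> topspace A.mtopology" using Qcore by (auto simp: jA ev_in_closure)
    show "A.mtopology closure_of (\<lambda>q. j (ev q)) ` Q = topspace A.mtopology"
      unfolding A.metric_closure_of A.topspace_mtopology
    proof (intro equalityI subsetI)
      fix a assume a: "a \<in> A"
      have "\<exists>y\<in>(\<lambda>q. j (ev q)) ` Q. y \<in> A.mball a r" if r: "0 < r" for r
      proof -
        obtain q where "q \<in> Q" "dA (j (ev q)) a < r" using Qdense[OF a r] by blast
        then show ?thesis using a Qcore by (intro bexI[of _ "j (ev q)"]) (auto simp: A.commute jA ev_in_closure)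
      qed
      then show "a \<in> {x \<in> A. \<forall>r>0. \<exists>y\<in>(\<lambda>q. j (ev q)) ` Q. y \<in> A.mball x r}" using a by blast
    qed auto
  qed
  obtain w0 where w0: "w0 \<in> core" using core_nonempty by blast
  \<comment> \<open>Off \<open>core\<close>, on a null set, an arbitrary point of
    \<open>core\<close> serves as default.\<close>
  define \<Phi> where "\<Phi> w = j (ev (if w \<in> core then w else w0))" for w
  have \<Phi>A: "\<Phi> w \<in> A" for w using w0 by (simp add: \<Phi>_def jA ev_in_closure)
  \<comment> \<open>The preimage is a \<open>d\<close>-ball inside \<open>core\<close>, together
    with all of the null part or none of it, depending on where \<open>w0\<close> lies.\<close>
  have \<Phi>_ball: "\<Phi> -` A.mball (j (ev q)) r \<inter> space P \<in> sets P" if q: "q \<in> core" for q r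
  proof -
    have "\<Phi> -` A.mball (j (ev q)) r \<inter> space P =
        (dball q r \<inter> core) \<union> (if d q w0 < r then null_part \<inter> space P else {})"
    proof -
      have "\<Phi> w \<in> A.mball (j (ev q)) r \<longleftrightarrow> d q (if w \<in> core then w else w0) < r" for w
        using q w0 by (simp add: \<Phi>_def jA ev_in_closure dAj D_ev)
      then show ?thesis by (auto simp: dball_def core_def split: if_splits)
    qed
    also have "\<dots> \<in> sets P"
      using dball_sets[OF core_space[OF q]] core_sets null_part by auto
    finally show ?thesis .
  qed
  have \<Phi>m: "\<Phi> \<in> P \<rightarrow>\<^sub>M borel_of A.mtopology"
  proof (rule measurable_borel_ofI)
    fix U assume U: "openin A.mtopology U"
    define I where "I = {(q, k). q \<in> Q \<and> A.mball (j (ev q)) (1 / real (Suc k)) \<subseteq> U}"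
    have cI: "countable I"
      by (rule countable_subset[of _ "Q \<times> UNIV"]) (use Qcount in \<open>auto simp: I_def\<close>)
    have "U = (\<Union>(q, k)\<in>I. A.mball (j (ev q)) (1 / real (Suc k)))"
    proof (intro equalityI subsetI)
      fix a assume aU: "a \<in> U"
      then have a: "a \<in> A" using openin_subset[OF U] by auto
      obtain r where r: "0 < r" "A.mball a r \<subseteq> U" using U aU unfolding A.openin_mtopology by blast
      obtain k where k: "1 / real (Suc k) < r / 2" using nat_approx_posE[of "r / 2"] r by auto
      have k0: "0 < 1 / real (Suc k)" by simp
      obtain q where q: "q \<in> Q" "dA (j (ev q)) a < 1 / real (Suc k)" using Qdense[OF a k0] by blast
      have qA: "j (ev q) \<in> A" using Qcore[OF q(1)] by (simp add: jA ev_in_closure)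
      have "A.mball (j (ev q)) (1 / real (Suc k)) \<subseteq> A.mball a r"
      proof
        fix b assume b: "b \<in> A.mball (j (ev q)) (1 / real (Suc k))"
        then show "b \<in> A.mball a r"
          using A.triangle[of a "j (ev q)" b] q(2) k a qA by (simp add: A.commute)
      qed
      then have "(q, k) \<in> I" using q(1) r(2) by (auto simp: I_def)
      moreover have "a \<in> A.mball (j (ev q)) (1 / real (Suc k))" using a qA q(2) by simp
      ultimately show "a \<in> (\<Union>(q, k)\<in>I. A.mball (j (ev q)) (1 / real (Suc k)))" by blast
    qed (auto simp: I_def)
    then have "\<Phi> -` U \<inter> space P = (\<Union>(q, k)\<in>I. \<Phi> -` A.mball (j (ev q)) (1 / real (Suc k)) \<inter> space P)"
      by blast
    also have "\<dots> \<in> sets P"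
      by (rule sets.countable_UN'[OF cI]) (auto simp: I_def intro!: \<Phi>_ball Qcore)
    finally show "\<Phi> -` U \<inter> space P \<in> sets P" .
  qed (use \<Phi>A in simp)
  define X where "X = \<lparr>pts = A, feats = T ` G, law = distr P (borel_of A.mtopology) \<Phi>\<rparr>"
  have sel: "pts X = A" "feats X = T ` G" "law X = distr P (borel_of A.mtopology) \<Phi>"
    by (simp_all add: X_def)
  have dX: "gds_dist X = dA"
  proof (intro ext)
    fix a b show "gds_dist X a b = dA a b"
      by (simp add: gds_dist_def sel dA_def D_def image_comp T_def)
  qed
  have topX: "gds_top X = A.mtopology" by (simp add: gds_top_def sel dX)
  have "supp_of A.mtopology (law X) = A"
    unfolding supp_of_def
  proof (intro equalityI subsetI CollectI conjI allI impI)
    fix a U assume a: "a \<in> A" and U: "openin A.mtopology U \<and> a \<in> U"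
    then obtain r where r: "0 < r" "A.mball a r \<subseteq> U" unfolding A.openin_mtopology by blast
    obtain w where w: "w \<in> core" "D (\<psi> a) (ev w) < r / 2" using ev_dense[OF \<psi>(1)[OF a], of "r / 2"] r by auto
    have "dball w (r / 2) - null_part \<subseteq> \<Phi> -` U \<inter> space P"
    proof
      fix v assume v: "v \<in> dball w (r / 2) - null_part"
      then have vc: "v \<in> core" "d w v < r / 2" by (auto simp: core_def dball_def)
      have "dA a (j (ev w)) < r / 2" using a w by (simp add: dA_def jA \<psi>j ev_in_closure)
      moreover have "dA (j (ev w)) (j (ev v)) < r / 2" using w vc by (simp add: dAj ev_in_closure D_ev)
      ultimately have "dA a (\<Phi> v) < r"
        using A.triangle[of a "j (ev w)" "\<Phi> v"] a w(1) vc(1) \<Phi>A[of v] by (simp add: \<Phi>_def jA ev_in_closure)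
      then show "v \<in> \<Phi> -` U \<inter> space P" using r(2) a \<Phi>A[of v] core_space[OF vc(1)] by auto
    qed
    then have "emeasure P (dball w (r / 2) - null_part) \<le> emeasure P (\<Phi> -` U \<inter> space P)"
      using measurable_sets[OF \<Phi>m openin_borel_of] U by (intro emeasure_mono) auto
    moreover have "emeasure P (dball w (r / 2) - null_part) = emeasure P (dball w (r / 2))"
      by (rule emeasure_Diff_null_set[OF null_part dball_sets[OF core_space[OF w(1)]]])
    moreover have "0 < emeasure P (dball w (r / 2))"
      using dball_pos[OF w(1), of "r / 2"] r by (simp add: emeasure_eq_measure)
    moreover have "emeasure (law X) U = emeasure P (\<Phi> -` U \<inter> space P)"
      unfolding sel by (rule emeasure_distr[OF \<Phi>m openin_borel_of]) (use U in simp)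
    ultimately show "0 < emeasure (law X) U" by simp
  qed auto
  moreover have "bdd_above ((\<lambda>f. \<bar>f a - f b\<bar>) ` feats X)" if "a \<in> A" "b \<in> A" for a b
    using D_bdd[OF \<psi>(1)[OF that(1)] \<psi>(1)[OF that(2)]] that by (simp add: sel image_comp T_def comp_def)
  moreover have "A \<noteq> {}" using \<Phi>A by blast
  moreover have "T ` G \<subseteq> A \<rightarrow>\<^sub>E UNIV" by (auto simp: T_def)
  ultimately have "geometric_data_set X"
    unfolding geometric_data_set_def topX
    using G_nonempty A.Metric_space_axioms complete separable prob_space_distr[OF \<Phi>m]
    by (simp add: sel dX)
  moreover have "T f (\<Phi> w) = f w" if "f \<in> G" "w \<in> space P - null_part" for f w
  proof -
    have w: "w \<in> core" using that by (simp add: core_def)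
    then have "T f (\<Phi> w) = ev w f" using \<Phi>A[of w] by (simp add: T_def \<Phi>_def \<psi>j ev_in_closure)
    then show ?thesis using that by (simp add: ev_def)
  qed
  moreover have "\<Phi> \<in> P \<rightarrow>\<^sub>M law X" using \<Phi>m by (simp add: sel)
  moreover have "distr P (law X) \<Phi> = law X"
    unfolding sel by (rule distr_cong) simp_all
  ultimately show ?thesis using null_part sel(2) by (intro that[of X null_part \<Phi> T]) auto
qed

end

section \<open>Markov chains and limits\<close>

text \<open>The Ionescu-Tulcea construction with kernels that see only the last coordinate. Of the
  resulting measure, the laws of single coordinates and of consecutive pairs are recorded; they
  carry the masses of the sets where consecutive features agree.\<close>

lemma markov_chain:
  fixes M :: "nat \<Rightarrow> 'a measure" and \<kappa> :: "nat \<Rightarrow> 'a \<Rightarrow> 'a measure"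
  assumes M: "\<And>n. prob_space (M n)"
    and \<kappa>: "\<And>n. \<kappa> n \<in> M n \<rightarrow>\<^sub>M prob_algebra (M (Suc n))"
    and bind: "\<And>n. M n \<bind> \<kappa> n = M (Suc n)"
  obtains Q where "prob_space Q" "sets Q = sets (PiM UNIV M)"
    "\<And>n A. A \<in> sets (M n) \<Longrightarrow> emeasure Q {w \<in> space Q. w n \<in> A} = emeasure (M n) A"
    "\<And>n A. A \<in> sets (M n \<Otimes>\<^sub>M M (Suc n)) \<Longrightarrow> emeasure Q {w \<in> space Q. (w n, w (Suc n)) \<in> A} =
        (\<integral>\<^sup>+x. emeasure (\<kappa> n x) {y \<in> space (M (Suc n)). (x, y) \<in> A} \<partial>M n)"
proof -
  \<comment> \<open>Kernel \<open>n\<close> draws coordinate \<open>n\<close>: from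
    \<open>M 0\<close> at the start, afterwards by the transition \<open>n - 1\<close> out of
    coordinate \<open>n - 1\<close>.\<close>
  define K where "K n w = (case n of 0 \<Rightarrow> M 0 | Suc k \<Rightarrow> \<kappa> k (w k))" for n and w :: "nat \<Rightarrow> 'a"
  have K0: "K 0 = (\<lambda>w. M 0)" and KSuc: "K (Suc n) = (\<lambda>w. \<kappa> n (w n))" for n by (simp_all add: K_def fun_eq_iff)
  have Kprob: "K n \<in> PiM {0..<n} M \<rightarrow>\<^sub>M prob_algebra (M n)" for n
  proof (cases n)
    case 0
    then show ?thesis using M by (simp add: K0 space_prob_algebra)
  next
    case (Suc k)
    have "(\<lambda>w. w k) \<in> PiM {0..<Suc k} M \<rightarrow>\<^sub>M M k" by (rule measurable_component_singleton) simp
    from measurable_compose[OF this \<kappa>] show ?thesis by (simp add: Suc KSuc)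
  qed
  interpret IT: Ionescu_Tulcea K M
  proof (rule Ionescu_Tulcea.intro)
    fix i and x :: "nat \<Rightarrow> 'a"
    show "K i \<in> PiM {0..<i} M \<rightarrow>\<^sub>M subprob_algebra (M i)"
      by (rule measurable_prob_algebraD[OF Kprob])
    assume "x \<in> space (PiM {0..<i} M)"
    then show "prob_space (K i x)"
      using measurable_space[OF Kprob, of x i] by (simp add: space_prob_algebra)
  qed
  \<comment> \<open>The law of the coordinates \<open>0..<n\<close>, so coordinate \<open>n\<close>
    first appears in \<open>C (Suc n)\<close>. The start \<open>\<lambda>_. undefined\<close> is the
    only trajectory over the empty index set.\<close>
  define C where "C n = IT.C 0 n (\<lambda>_. undefined)" for n
  have Csets: "sets (C n) = sets (PiM {0..<n} M)" for n
    unfolding C_def using IT.sets_C[of "\<lambda>_. undefined" 0 n] by (simp add: space_PiM)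
  have Cspace: "space (C n) = space (PiM {0..<n} M)" for n
    by (rule sets_eq_imp_space_eq[OF Csets])
  have Cprob: "prob_space (C n)" for n
    unfolding C_def by (rule IT.prob_space_C) (simp add: space_PiM)
  have step: "(\<integral>\<^sup>+w. f w \<partial>C (Suc n)) = (\<integral>\<^sup>+w. \<integral>\<^sup>+x. f (w(n := x)) \<partial>K n w \<partial>C n)"
    if f: "f \<in> borel_measurable (PiM {0..<Suc n} M)" for f n
  proof -
    have "(\<integral>\<^sup>+w. f w \<partial>C (Suc n)) = (\<integral>\<^sup>+w. \<integral>\<^sup>+x. f x \<partial>IT.eP n w \<partial>C n)"
      unfolding C_def IT.C.simps add_0
      by (rule nn_integral_bind[OF f])
        (use IT.measurable_eP in \<open>simp add: measurable_cong_sets[OF Csets[unfolded C_def] refl]\<close>)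
    also have "\<dots> = (\<integral>\<^sup>+w. \<integral>\<^sup>+x. f (w(n := x)) \<partial>K n w \<partial>C n)"
      by (rule nn_integral_cong) (rule IT.nn_integral_eP[OF _ f], simp add: Cspace)
    finally show ?thesis .
  qed
  have Kint: "(\<lambda>x. \<integral>\<^sup>+y. h y \<partial>\<kappa> n x) \<in> borel_measurable (M n)" if "h \<in> borel_measurable (M (Suc n))" for h n
    using measurable_compose[OF measurable_prob_algebraD[OF \<kappa>] nn_integral_measurable_subprob_algebra[OF that]] .
  have compm: "(\<lambda>w. h (w n)) \<in> borel_measurable (PiM {0..<Suc n} M)"
    if "h \<in> borel_measurable (M n)" for h :: "'a \<Rightarrow> ennreal" and n
  proof -
    have "(\<lambda>w. w n) \<in> PiM {0..<Suc n} M \<rightarrow>\<^sub>M M n" by (rule measurable_component_singleton) simp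
    from measurable_compose[OF this that] show ?thesis .
  qed
  \<comment> \<open>The induction is over all \<open>h\<close>: integrating against a transition
    turns a function of the last coordinate into one of the coordinate before it.\<close>
  have coord: "(\<integral>\<^sup>+w. h (w n) \<partial>C (Suc n)) = (\<integral>\<^sup>+x. h x \<partial>M n)" if "h \<in> borel_measurable (M n)" for h n
    using that
  proof (induction n arbitrary: h)
    case 0
    interpret C0: prob_space "C 0" by (rule Cprob)
    from step[OF compm[OF 0]] show ?case using C0.emeasure_space_1 by (simp add: K0)
  next
    case (Suc n)
    from step[OF compm[OF Suc.prems]] have "(\<integral>\<^sup>+w. h (w (Suc n)) \<partial>C (Suc (Suc n))) = (\<integral>\<^sup>+w. \<integral>\<^sup>+x. h x \<partial>\<kappa> n (w n) \<partial>C (Suc n))"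
      by (simp add: KSuc)
    also have "\<dots> = (\<integral>\<^sup>+x. \<integral>\<^sup>+y. h y \<partial>\<kappa> n x \<partial>M n)" by (rule Suc.IH[OF Kint[OF Suc.prems]])
    also have "\<dots> = (\<integral>\<^sup>+y. h y \<partial>(M n \<bind> \<kappa> n))"
      by (rule nn_integral_bind[symmetric, OF Suc.prems measurable_prob_algebraD[OF \<kappa>]])
    finally show ?case by (simp add: bind)
  qed
  let ?Q = "IT.PF.lim"
  have spQ: "space ?Q = space (PiM UNIV M)" by simp
  have limC: "emeasure ?Q {w \<in> space ?Q. restrict w {0..<m} \<in> B} = emeasure (C m) B"
    if B: "B \<in> sets (PiM {0..<m} M)" for m B
  proof -
    have "{w \<in> space ?Q. restrict w {0..<m} \<in> B} = IT.PF.emb UNIV {0..<m} B"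
      by (auto simp: prod_emb_def space_PiM)
    then have "emeasure ?Q {w \<in> space ?Q. restrict w {0..<m} \<in> B} = emeasure (IT.CI {0..<m}) B"
      using IT.lim[OF _ B] by simp
    also have "\<dots> = emeasure (C m) (IT.PF.emb {0..<m} {0..<m} B)"
      unfolding C_def by (rule IT.emeasure_CI[OF order.refl B])
    also have "IT.PF.emb {0..<m} {0..<m} B = B"
      by (rule prod_emb_id) (use sets.sets_into_space[OF B] in \<open>simp add: space_PiM\<close>)
    finally show ?thesis .
  qed
  have 1: "prob_space ?Q"
  proof
    have "{w \<in> space ?Q. restrict w {0..<0} \<in> space (PiM {0..<0} M)} = space ?Q"
      by (auto simp: space_PiM)
    then show "emeasure ?Q (space ?Q) = 1"
      using limC[OF sets.top, of 0] prob_space.emeasure_space_1[OF Cprob, of 0] by (simp add: Cspace)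
  qed
  have 2: "emeasure ?Q {w \<in> space ?Q. w n \<in> A} = emeasure (M n) A" if A: "A \<in> sets (M n)" for n A
  proof -
    let ?B = "{w \<in> space (PiM {0..<Suc n} M). w n \<in> A}"
    have ms: "(\<lambda>w. w n) \<in> PiM {0..<Suc n} M \<rightarrow>\<^sub>M M n"
      by (rule measurable_component_singleton) simp
    have B: "?B \<in> sets (PiM {0..<Suc n} M)"
      using measurable_sets[OF ms A] by (simp add: vimage_def Int_def conj_commute)
    have "{w \<in> space ?Q. w n \<in> A} = {w \<in> space ?Q. restrict w {0..<Suc n} \<in> ?B}"
      by (auto simp: space_PiM)
    then have "emeasure ?Q {w \<in> space ?Q. w n \<in> A} = emeasure (C (Suc n)) ?B"
      using limC[OF B] by simp
    also have "\<dots> = (\<integral>\<^sup>+w. indicator ?B w \<partial>C (Suc n))"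
      using B Csets by (intro nn_integral_indicator[symmetric]) simp
    also have "\<dots> = (\<integral>\<^sup>+w. indicator A (w n) \<partial>C (Suc n))"
      by (rule nn_integral_cong) (simp add: Cspace indicator_def)
    also have "\<dots> = (\<integral>\<^sup>+x. indicator A x \<partial>M n)" by (rule coord) (use A in simp)
    finally show ?thesis using A by simp
  qed
  have 3: "emeasure ?Q {w \<in> space ?Q. (w n, w (Suc n)) \<in> A} =
        (\<integral>\<^sup>+x. emeasure (\<kappa> n x) {y \<in> space (M (Suc n)). (x, y) \<in> A} \<partial>M n)"
    if A: "A \<in> sets (M n \<Otimes>\<^sub>M M (Suc n))" for n A
  proof -
    let ?m = "Suc (Suc n)"
    let ?B = "{w \<in> space (PiM {0..<?m} M). (w n, w (Suc n)) \<in> A}"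
    have ms: "(\<lambda>w. (w n, w (Suc n))) \<in> PiM {0..<?m} M \<rightarrow>\<^sub>M M n \<Otimes>\<^sub>M M (Suc n)"
      by (intro measurable_Pair measurable_component_singleton) simp_all
    have B: "?B \<in> sets (PiM {0..<?m} M)"
      using measurable_sets[OF ms A] by (simp add: vimage_def Int_def conj_commute)
    have "{w \<in> space ?Q. (w n, w (Suc n)) \<in> A} = {w \<in> space ?Q. restrict w {0..<?m} \<in> ?B}"
      by (auto simp: space_PiM)
    then have "emeasure ?Q {w \<in> space ?Q. (w n, w (Suc n)) \<in> A} = emeasure (C ?m) ?B"
      using limC[OF B] by simp
    also have "\<dots> = (\<integral>\<^sup>+w. indicator ?B w \<partial>C ?m)"
      using B Csets by (intro nn_integral_indicator[symmetric]) simp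
    also have "\<dots> = (\<integral>\<^sup>+w. indicator A (w n, w (Suc n)) \<partial>C ?m)"
      by (rule nn_integral_cong) (simp add: Cspace indicator_def)
    also have "\<dots> = (\<integral>\<^sup>+w. \<integral>\<^sup>+y. indicator A (w n, y) \<partial>\<kappa> n (w n) \<partial>C (Suc n))"
      using step[of "\<lambda>w. indicator A (w n, w (Suc n))" "Suc n"] measurable_compose[OF ms borel_measurable_indicator[OF A]]
      by (simp add: KSuc)
    also have "\<dots> = (\<integral>\<^sup>+x. \<integral>\<^sup>+y. indicator A (x, y) \<partial>\<kappa> n x \<partial>M n)"
    proof (rule coord)
      show "(\<lambda>x. \<integral>\<^sup>+y. indicator A (x, y) \<partial>\<kappa> n x) \<in> borel_measurable (M n)"
        by (rule nn_integral_measurable_subprob_algebra2[OF _ measurable_prob_algebraD[OF \<kappa>]])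
          (use A in \<open>simp add: split_beta'\<close>)
    qed
    also have "\<dots> = (\<integral>\<^sup>+x. emeasure (\<kappa> n x) {y \<in> space (M (Suc n)). (x, y) \<in> A} \<partial>M n)"
    proof (rule nn_integral_cong)
      fix x assume x: "x \<in> space (M n)"
      have ks: "sets (\<kappa> n x) = sets (M (Suc n))"
        using measurable_space[OF \<kappa> x] by (simp add: space_prob_algebra)
      have S: "{y \<in> space (M (Suc n)). (x, y) \<in> A} = Pair x -` A"
        using sets.sets_into_space[OF A] by (auto simp: space_pair_measure)
      have "(\<integral>\<^sup>+y. indicator A (x, y) \<partial>\<kappa> n x) = (\<integral>\<^sup>+y. indicator (Pair x -` A) y \<partial>\<kappa> n x)"
        by (rule nn_integral_cong) (simp add: indicator_def)
      also have "\<dots> = emeasure (\<kappa> n x) (Pair x -` A)"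
        using sets_Pair1[OF A] ks by (intro nn_integral_indicator) simp
      finally show "(\<integral>\<^sup>+y. indicator A (x, y) \<partial>\<kappa> n x) = emeasure (\<kappa> n x) {y \<in> space (M (Suc n)). (x, y) \<in> A}"
        unfolding S .
    qed
    finally show ?thesis .
  qed
  show ?thesis by (rule that[OF 1 _ 2 3]) simp_all
qed

section \<open>The limit of a fast Cauchy sequence\<close>

text \<open>Fullness on the right extends the chain from \<open>n\<close> back to 0, fullness on the
  left extends it forward from \<open>n\<close> without end.\<close>

lemma ex_chain_through:
  assumes R: "\<And>n. full_rel (X n) (X (Suc n)) (R n)" and f0: "f0 \<in> feats (X n)"
  obtains f where "\<And>k. (f k, f (Suc k)) \<in> R k" "f n = f0"
proof -
  have backward: "\<exists>b. b n = f0 \<and> (\<forall>m<n. (b m, b (Suc m)) \<in> R m)" if "f0 \<in> feats (X n)" for n f0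
    using that
  proof (induction n arbitrary: f0)
    case (Suc n)
    obtain f1 where f1: "(f1, f0) \<in> R n" using full_relD(4)[OF R Suc.prems] by blast
    obtain b where b: "b n = f1" "\<forall>m<n. (b m, b (Suc m)) \<in> R m"
      using Suc.IH[OF full_relD(1)[OF R f1]] by blast
    show ?case
      using f1 b by (intro exI[of _ "b(Suc n := f0)"]) (auto simp: less_Suc_eq)
  qed auto
  obtain b where b: "b n = f0" "\<And>m. m < n \<Longrightarrow> (b m, b (Suc m)) \<in> R m" using backward[OF f0] by blast
  have "\<exists>g. \<forall>i. (g i \<in> feats (X (n + i)) \<and> (i = 0 \<longrightarrow> g i = f0)) \<and> (g i, g (Suc i)) \<in> R (n + i)"
  proof (rule dependent_nat_choice)
    show "\<exists>x. x \<in> feats (X (n + 0)) \<and> (0 = 0 \<longrightarrow> x = f0)" using f0 by simp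
    fix x i assume "x \<in> feats (X (n + i)) \<and> (i = 0 \<longrightarrow> x = f0)"
    then obtain y where y: "(x, y) \<in> R (n + i)" using full_relD(3)[OF R, of x "n + i"] by blast
    then show "\<exists>y. (y \<in> feats (X (n + Suc i)) \<and> (Suc i = 0 \<longrightarrow> y = f0)) \<and> (x, y) \<in> R (n + i)"
      using full_relD(2)[OF R y] by auto
  qed
  then obtain g where g: "g 0 = f0" "\<And>i. (g i, g (Suc i)) \<in> R (n + i)" by auto
  define f where "f m = (if m \<le> n then b m else g (m - n))" for m
  have "(f k, f (Suc k)) \<in> R k" for k
  proof (cases "k < n")
    case True
    then show ?thesis using b(2)[of k] by (simp add: f_def)
  next
    case False
    then have "f k = g (k - n)" "f (Suc k) = g (Suc (k - n))"
      using b(1) g(1) by (auto simp: f_def Suc_diff_le)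
    then show ?thesis using g(2)[of "k - n"] False by simp
  qed
  moreover have "f n = f0" by (simp add: f_def b)
  ultimately show ?thesis by (rule that)
qed

text \<open>The limit is realized on the trajectories of a Markov chain whose transitions are given by the
  kernels between consecutive spaces. Almost every trajectory \<open>w\<close> eventually stays in the sets where
  consecutive features agree up to \<open>2 * r n\<close>, so that along chains of corresponding features
  \<open>f n\<close> the values \<open>f n (w n)\<close> converge; these limits are the features of the limit.\<close>

lemma ex_limit:
  fixes inj_real :: "real \<Rightarrow> 'a" and X :: "nat \<Rightarrow> 'a gds"
  defines "r \<equiv> \<lambda>n. (1 / 2 :: real) ^ n"
  assumes "inj inj_real" and X: "\<And>n. geometric_data_set (X n)"
    and near: "\<And>n. near (X n) (X (Suc n)) (r n) (r n)"
  obtains L :: "'a gds" where "geometric_data_set L" "\<And>n. near (X n) L (4 * r n) (4 * r n)"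
proof -
  interpret X: gds_space "X n" for n using X by unfold_locales
  have r0: "0 < r n" and rSuc: "r (Suc n) = r n / 2" for n by (simp_all add: r_def)
  have rlim: "r \<longlonglongrightarrow> 0" unfolding r_def by (intro LIMSEQ_power_zero) simp
  have r_antimono: "r n \<le> r m" if "m \<le> n" for m n
    unfolding r_def by (rule power_decreasing[OF that]) auto
  \<comment> \<open>Cells of diameter below \<open>r n\<close> double the feature error and leave
    the mass defect as it is.\<close>
  have kn: "kernel_near (X n) (X (Suc n)) (r n) (2 * r n)" for n
    using kernel_near_if_near[OF X X near[of n] r0[of n]] by (simp only: mult_2)
  let ?ok = "\<lambda>n \<kappa>R. fst \<kappa>R \<in> law (X n) \<rightarrow>\<^sub>M prob_algebra (law (X (Suc n))) \<and>
      law (X n) \<bind> fst \<kappa>R = law (X (Suc n)) \<and> full_rel (X n) (X (Suc n)) (snd \<kappa>R) \<and>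
      (\<integral>\<^sup>+x. emeasure (fst \<kappa>R x) {y \<in> pts (X (Suc n)). (x, y) \<notin> agree (X n) (X (Suc n)) (snd \<kappa>R) (2 * r n)}
        \<partial>law (X n)) \<le> ennreal (r n)"
  have "\<forall>n. \<exists>\<kappa>R. ?ok n \<kappa>R"
    using kn unfolding kernel_near_def by (simp add: Bex_def)
  from choice[OF this] obtain \<kappa>R where \<kappa>R: "\<And>n. ?ok n (\<kappa>R n)" by blast
  define \<kappa> where "\<kappa> n = fst (\<kappa>R n)" for n
  define R where "R n = snd (\<kappa>R n)" for n
  have \<kappa>: "\<kappa> n \<in> law (X n) \<rightarrow>\<^sub>M prob_algebra (law (X (Suc n)))"
    and bind: "law (X n) \<bind> \<kappa> n = law (X (Suc n))"
    and R: "full_rel (X n) (X (Suc n)) (R n)"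
    and le: "(\<integral>\<^sup>+x. emeasure (\<kappa> n x) {y \<in> pts (X (Suc n)). (x, y) \<notin> agree (X n) (X (Suc n)) (R n) (2 * r n)}
        \<partial>law (X n)) \<le> ennreal (r n)" for n
    using \<kappa>R[of n] unfolding \<kappa>_def R_def by blast+
  define E where "E n = agree (X n) (X (Suc n)) (R n) (2 * r n)" for n
  obtain Q where Q: "prob_space Q" and sQ: "sets Q = sets (PiM UNIV (\<lambda>n. law (X n)))"
    and Qn: "\<And>n A. A \<in> sets (law (X n)) \<Longrightarrow> emeasure Q {w \<in> space Q. w n \<in> A} = emeasure (law (X n)) A"
    and Qpair: "\<And>n A. A \<in> sets (law (X n) \<Otimes>\<^sub>M law (X (Suc n))) \<Longrightarrow> emeasure Q {w \<in> space Q. (w n, w (Suc n)) \<in> A} =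
        (\<integral>\<^sup>+x. emeasure (\<kappa> n x) {y \<in> space (law (X (Suc n))). (x, y) \<in> A} \<partial>law (X n))"
    by (rule markov_chain[of "\<lambda>n. law (X n)" \<kappa>, OF X.law.prob_space_axioms \<kappa> bind]) blast
  interpret Q: prob_space Q by (rule Q)
  have spQ: "space Q = space (PiM UNIV (\<lambda>n. law (X n)))" by (rule sets_eq_imp_space_eq[OF sQ])
  have win: "w n \<in> pts (X n)" if "w \<in> space Q" for w n
    using that by (auto simp: spQ space_PiM PiE_iff)
  have coord: "(\<lambda>w. w n) \<in> Q \<rightarrow>\<^sub>M law (X n)" for n
    unfolding measurable_cong_sets[OF sQ refl] by (rule measurable_component_singleton) simp
  have pair: "(\<lambda>w. (w n, w (Suc n))) \<in> Q \<rightarrow>\<^sub>M law (X n) \<Otimes>\<^sub>M law (X (Suc n))" for n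
    by (rule measurable_Pair[OF coord coord])
  have Es: "E n \<in> sets (law (X n) \<Otimes>\<^sub>M law (X (Suc n)))" for n
    unfolding E_def by (rule agree_sets[OF X X R])
  define bad where "bad n = {w \<in> space Q. (w n, w (Suc n)) \<notin> E n}" for n
  have bad_eq: "bad n = {w \<in> space Q. (w n, w (Suc n)) \<in> space (law (X n) \<Otimes>\<^sub>M law (X (Suc n))) - E n}" for n
    using win by (auto simp: bad_def space_pair_measure)
  have bad_sets: "bad n \<in> sets Q" for n
    using measurable_sets[OF pair sets.compl_sets[OF Es]] unfolding bad_eq
    by (simp add: vimage_def Int_def conj_commute)
  have bad_le: "emeasure Q (bad n) \<le> ennreal (r n)" for n
  proof -
    have "emeasure Q (bad n) = (\<integral>\<^sup>+x. emeasure (\<kappa> n x) {y \<in> space (law (X (Suc n))). (x, y) \<in>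
        space (law (X n) \<Otimes>\<^sub>M law (X (Suc n))) - E n} \<partial>law (X n))"
      unfolding bad_eq by (rule Qpair[OF sets.compl_sets[OF Es]])
    also have "\<dots> = (\<integral>\<^sup>+x. emeasure (\<kappa> n x) {y \<in> pts (X (Suc n)). (x, y) \<notin> E n} \<partial>law (X n))"
      by (intro nn_integral_cong arg_cong2[where f=emeasure] refl) (auto simp: space_pair_measure)
    also have "\<dots> \<le> ennreal (r n)" using le by (simp add: E_def)
    finally show ?thesis .
  qed
  define good where "good N = {w \<in> space Q. \<forall>n\<ge>N. (w n, w (Suc n)) \<in> E n}" for N
  have good_compl: "space Q - good N = (\<Union>i. bad (N + i))" for N
    unfolding good_def bad_def by (auto simp: nat_le_iff_add)
  have good_sets: "good N \<in> sets Q" for N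
  proof -
    have "good N = space Q - (\<Union>i. bad (N + i))" using good_compl[of N] by (auto simp: good_def)
    then show ?thesis using bad_sets by auto
  qed
  have good_mono: "good m \<subseteq> good n" if "m \<le> n" for m n
    using that by (auto simp: good_def)
  \<comment> \<open>The Borel-Cantelli estimate with its rate: the defects from \<open>N\<close> on
    sum to \<open>2 * r N\<close>.\<close>
  have good_large: "1 - 2 * r N \<le> measure Q (good N)" for N
  proof -
    have s: "(\<lambda>i. r (N + i)) sums (r N * 2)"
      using sums_mult[OF geometric_sums[of "1 / 2 :: real"], of "r N"] by (simp add: r_def power_add)
    have "emeasure Q (space Q - good N) \<le> (\<Sum>i. emeasure Q (bad (N + i)))"
      unfolding good_compl by (rule emeasure_subadditive_countably) (use bad_sets in auto)
    also have "\<dots> \<le> (\<Sum>i. ennreal (r (N + i)))"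
      by (rule suminf_le) (auto intro: bad_le)
    also have "\<dots> = ennreal (r N * 2)"
      by (rule suminf_ennreal_eq[OF _ s]) (simp add: less_imp_le r0)
    finally have "measure Q (space Q - good N) \<le> r N * 2"
      using r0[of N] by (simp add: Q.emeasure_eq_measure)
    then show ?thesis using Q.prob_compl[OF good_sets, of N] by simp
  qed
  define \<Omega> where "\<Omega> = (\<Union>N. good N)"
  have \<Omega>_sets: "\<Omega> \<in> sets Q" unfolding \<Omega>_def using good_sets by auto
  have \<Omega>_sub: "\<Omega> \<subseteq> space Q" by (auto simp: \<Omega>_def good_def)
  have \<Omega>1: "measure Q \<Omega> = 1"
  proof -
    have "1 \<le> measure Q \<Omega>"
    proof (rule LIMSEQ_le_const2)
      have "(\<lambda>N. 1 - 2 * r N) \<longlonglongrightarrow> 1 - 2 * 0" by (intro tendsto_diff tendsto_mult tendsto_const rlim)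
      then show "(\<lambda>N. 1 - 2 * r N) \<longlonglongrightarrow> 1" by simp
      have "1 - 2 * r N \<le> measure Q \<Omega>" for N
        using good_large[of N] Q.finite_measure_mono[OF _ \<Omega>_sets, of "good N"] by (force simp: \<Omega>_def)
      then show "\<exists>N. \<forall>n\<ge>N. 1 - 2 * r n \<le> measure Q \<Omega>" by blast
    qed
    then show ?thesis using Q.prob_le_1[of \<Omega>] by linarith
  qed
  \<comment> \<open>On eventually good trajectories the limit features exist and their supremum
    distances are finite everywhere, not just almost everywhere, as \<open>feature_space\<close>
    demands.\<close>
  define P where "P = restrict_space Q \<Omega>"
  have spP: "space P = \<Omega>" using \<Omega>_sub by (auto simp: P_def space_restrict_space)
  have P_em: "emeasure P A = emeasure Q A" if "A \<subseteq> \<Omega>" for A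
    unfolding P_def by (rule emeasure_restrict_space[OF _ that]) (use \<Omega>_sets in auto)
  have P_sets: "A \<inter> \<Omega> \<in> sets P" if "A \<in> sets Q" for A
    using that \<Omega>_sets by (auto simp: P_def sets_restrict_space_iff)
  have measP: "f \<in> P \<rightarrow>\<^sub>M N" if "f \<in> Q \<rightarrow>\<^sub>M N" for f and N :: "'c measure"
    unfolding P_def by (rule measurable_restrict_space1[OF that])
  have pP: "prob_space P"
  proof
    show "emeasure P (space P) = 1"
      using P_em[of \<Omega>] \<Omega>1 by (simp add: spP Q.emeasure_eq_measure)
  qed
  interpret P: prob_space P by (rule pP)
  define chain where "chain = {f. \<forall>n. (f n, f (Suc n)) \<in> R n}"
  have chainF: "f n \<in> feats (X n)" if "f \<in> chain" for f n
    using that full_relD(1)[OF R] by (auto simp: chain_def)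
  have chain_ex: "\<exists>f\<in>chain. f n = f0" if f0: "f0 \<in> feats (X n)" for n f0
  proof -
    obtain f where "\<And>k. (f k, f (Suc k)) \<in> R k" "f n = f0" by (rule ex_chain_through[where X=X, OF R f0]) blast
    then show ?thesis by (auto simp: chain_def)
  qed
  define val where "val f w = lim (\<lambda>n. f n (w n))" for f :: "nat \<Rightarrow> 'a \<Rightarrow> real" and w
  have step: "\<bar>f n (w n) - f (Suc n) (w (Suc n))\<bar> \<le> 2 * r n" if "f \<in> chain" "w \<in> good N" "N \<le> n" for f w N n
    using that by (auto simp: chain_def good_def E_def agree_iff)
  \<comment> \<open>Since \<open>r\<close> halves, the step error \<open>2 * r n\<close> equals
    \<open>4 * r n - 4 * r (Suc n)\<close>, and the sum telescopes.\<close>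
  have tele: "\<bar>f m (w m) - f (m + k) (w (m + k))\<bar> \<le> 4 * r m - 4 * r (m + k)"
    if "f \<in> chain" "w \<in> good N" "N \<le> m" for f w N m k
  proof (induction k)
    case (Suc k)
    show ?case using Suc step[OF that(1,2), of "m + k"] that(3) rSuc[of "m + k"] by simp
  qed simp
  have val_lim: "(\<lambda>n. f n (w n)) \<longlonglongrightarrow> val f w" if f: "f \<in> chain" and w: "w \<in> good N" for f w N
  proof -
    have "Cauchy (\<lambda>n. f n (w n))"
    proof (rule CauchyI')
      fix e :: real assume e: "0 < e"
      obtain M where M: "r M < e / 4"
        using order_tendstoD(2)[OF rlim, of "e / 4"] e by (auto simp: eventually_sequentially)
      show "\<exists>M. \<forall>m\<ge>M. \<forall>n>m. dist (f m (w m)) (f n (w n)) < e"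
      proof (intro exI[of _ "M + N"] allI impI)
        fix m n assume m: "M + N \<le> m" "m < n"
        have "\<bar>f m (w m) - f n (w n)\<bar> \<le> 4 * r m - 4 * r n"
          using tele[OF f w, of m "n - m"] m by simp
        then show "dist (f m (w m)) (f n (w n)) < e"
          using r0[of n] r_antimono[of M m] M m by (simp add: dist_real_def)
      qed
    qed
    then show ?thesis unfolding val_def by (simp add: Cauchy_convergent_iff convergent_LIMSEQ_iff)
  qed
  have val_close: "\<bar>f m (w m) - val f w\<bar> \<le> 4 * r m" if f: "f \<in> chain" and w: "w \<in> good N" and m: "N \<le> m" for f w N m
  proof (rule LIMSEQ_le_const2)
    show "(\<lambda>n. \<bar>f m (w m) - f n (w n)\<bar>) \<longlonglongrightarrow> \<bar>f m (w m) - val f w\<bar>"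
      by (intro tendsto_rabs tendsto_diff tendsto_const val_lim[OF f w])
    have "\<bar>f m (w m) - f n (w n)\<bar> \<le> 4 * r m" if "m \<le> n" for n
      using tele[OF f w m, of "n - m"] that r0[of n] by simp
    then show "\<exists>N. \<forall>n\<ge>N. \<bar>f m (w m) - f n (w n)\<bar> \<le> 4 * r m" by blast
  qed
  define G where "G = val ` chain"
  define dd where "dd w w' = (SUP g\<in>G. \<bar>g w - g w'\<bar>)" for w w'
  have chain_ne: "chain \<noteq> {}" using X.feats_nonempty[of 0] chain_ex by blast
  have val_le: "\<bar>val f w - val f w'\<bar> \<le> gds_dist (X m) (w m) (w' m) + 8 * r m"
    if f: "f \<in> chain" and w: "w \<in> good N" "w' \<in> good N" and m: "N \<le> m" for f w w' N m
    using val_close[OF f w(1) m] val_close[OF f w(2) m] w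
      X.feat_lipschitz[OF chainF[OF f], of "w m" m "w' m"] win[of w m] win[of w' m] unfolding good_def by auto
  have G_bdd: "bdd_above ((\<lambda>g. \<bar>g w - g w'\<bar>) ` G)" if w: "w \<in> good N" "w' \<in> good N" for w w' N
    using val_le[OF _ w order.refl] by (auto simp: G_def intro!: bdd_aboveI2)
  \<comment> \<open>Each of the two points contributes \<open>4 * r m\<close>. The lower bound on
    \<open>dd\<close> rests on every feature of \<open>X m\<close> lying on some chain.\<close>
  have dd_close: "\<bar>dd w w' - gds_dist (X m) (w m) (w' m)\<bar> \<le> 8 * r m"
    if w: "w \<in> good N" "w' \<in> good N" and m: "N \<le> m" for w w' N m
  proof -
    have "dd w w' \<le> gds_dist (X m) (w m) (w' m) + 8 * r m"
      unfolding dd_def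
    proof (rule cSUP_least)
      show "G \<noteq> {}" using chain_ne by (simp add: G_def)
    qed (use val_le[OF _ w m] in \<open>auto simp: G_def\<close>)
    moreover have "gds_dist (X m) (w m) (w' m) \<le> dd w w' + 8 * r m"
    proof (rule X.dist_le)
      fix f0 assume "f0 \<in> feats (X m)"
      then obtain f where f: "f \<in> chain" "f m = f0" using chain_ex by blast
      have "\<bar>val f w - val f w'\<bar> \<le> dd w w'"
        unfolding dd_def by (rule cSUP_upper[OF _ G_bdd[OF w]]) (use f in \<open>auto simp: G_def\<close>)
      then show "\<bar>f0 (w m) - f0 (w' m)\<bar> \<le> dd w w' + 8 * r m"
        using val_close[OF f(1) w(1) m] val_close[OF f(1) w(2) m] f(2) by (auto simp: abs_le_iff)
    qed (use w win in \<open>auto simp: good_def\<close>)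
    ultimately show ?thesis by linarith
  qed
  have common: "\<exists>N. w \<in> good N \<and> w' \<in> good N" if w: "w \<in> \<Omega>" "w' \<in> \<Omega>" for w w'
  proof -
    obtain N N' where "w \<in> good N" "w' \<in> good N'" using w by (auto simp: \<Omega>_def)
    then have "w \<in> good (max N N')" "w' \<in> good (max N N')" using good_mono by (meson max.cobounded1 max.cobounded2 subsetD)+
    then show ?thesis by blast
  qed
  obtain cs where cs: "\<And>m. X.dense_seq m (cs m)" using X.ex_dense_seq by metis
  \<comment> \<open>For each ball of a countable family in \<open>X m\<close>, one trajectory of
    \<open>good N\<close> that visits it at time \<open>m\<close>, if there is one. Fixing
    \<open>N\<close> matters: \<open>dd_close\<close> compares trajectories in a common
    \<open>good N\<close>.\<close>
  define S where "S = (\<lambda>(N, m, i). SOME q. q \<in> good N \<and> gds_dist (X m) (cs m i) (q m) < r m) `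
      {(N, m, i). \<exists>q. q \<in> good N \<and> gds_dist (X m) (cs m i) (q m) < r m}"
  have S_count: "countable S" unfolding S_def by (rule countable_image) simp
  have S_sub: "S \<subseteq> \<Omega>"
  proof
    fix q0 assume "q0 \<in> S"
    then obtain N m i where q0: "q0 = (SOME q. q \<in> good N \<and> gds_dist (X m) (cs m i) (q m) < r m)"
      and ex: "\<exists>q. q \<in> good N \<and> gds_dist (X m) (cs m i) (q m) < r m" unfolding S_def by auto
    then show "q0 \<in> \<Omega>" using someI_ex[OF ex] unfolding \<Omega>_def by auto
  qed
  have S_dense: "\<exists>q\<in>S. dd q w < e" if w: "w \<in> \<Omega>" and e: "0 < e" for w e
  proof -
    obtain N where N: "w \<in> good N" using w by (auto simp: \<Omega>_def)
    \<comment> \<open>The trajectories are within \<open>2 * r m\<close> at time \<open>m\<close>,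
      and \<open>dd_close\<close> adds \<open>8 * r m\<close>.\<close>
    obtain M where M: "r M < e / 10"
      using order_tendstoD(2)[OF rlim, of "e / 10"] e by (auto simp: eventually_sequentially)
    define m where "m = max M N"
    have m: "N \<le> m" "10 * r m < e" using r_antimono[of M m] M by (auto simp: m_def)
    have wm: "w m \<in> pts (X m)" using N win by (auto simp: good_def)
    obtain i where i: "gds_dist (X m) (cs m i) (w m) < r m" using X.dense_seqD(2)[OF cs wm r0] by blast
    define q where "q = (SOME q. q \<in> good N \<and> gds_dist (X m) (cs m i) (q m) < r m)"
    have ex: "\<exists>q. q \<in> good N \<and> gds_dist (X m) (cs m i) (q m) < r m" using N i by blast
    have q: "q \<in> good N" "gds_dist (X m) (cs m i) (q m) < r m"
      using someI_ex[OF ex] unfolding q_def by blast+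
    have "q \<in> S" unfolding S_def q_def using ex by (intro image_eqI[of _ _ "(N, m, i)"]) auto
    have qm: "q m \<in> pts (X m)" using q win by (auto simp: good_def)
    have "gds_dist (X m) (q m) (w m) < 2 * r m"
      using X.triangle[OF qm X.dense_seqD(1)[OF cs, of m i] wm] i q(2) by (simp add: X.commute)
    then have "dd q w < e" using dd_close[OF q(1) N m(1)] m(2) by linarith
    then show ?thesis using \<open>q \<in> S\<close> by blast
  qed
  have "\<Omega> \<noteq> {}" using \<Omega>1 by auto
  then have "S \<noteq> {}" using S_dense[of _ 1] by auto
  define c where "c = from_nat_into S"
  have c: "range c = S" unfolding c_def by (rule range_from_nat_into[OF \<open>S \<noteq> {}\<close> S_count])
  \<comment> \<open>The family \<open>G\<close> may be uncountable, so measurability of the supremum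
    \<open>dd w\<close> is not automatic; it is the pointwise limit of the distances between the
    coordinates at time \<open>m\<close>, which are measurable.\<close>
  have ball: "{w' \<in> space P. dd w w' < \<rho>} \<in> sets P" if w: "w \<in> \<Omega>" for w \<rho>
  proof -
    have wQ: "w \<in> space Q" using w \<Omega>_sub by blast
    have "dd w \<in> borel_measurable P"
    proof (rule borel_measurable_LIMSEQ_real)
      show "(\<lambda>w'. gds_dist (X m) (w m) (w' m)) \<in> borel_measurable P" for m
        by (rule measP[OF measurable_compose[OF coord X.dist_measurable[OF win[OF wQ]]]])
      fix w' assume "w' \<in> space P"
      then obtain N where N: "w \<in> good N" "w' \<in> good N" using common w by (auto simp: spP)
      have "(\<lambda>m. gds_dist (X m) (w m) (w' m) - dd w w') \<longlonglongrightarrow> 0"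
      proof (rule Lim_null_comparison)
        show "\<forall>\<^sub>F m in sequentially. norm (gds_dist (X m) (w m) (w' m) - dd w w') \<le> 8 * r m"
          using dd_close[OF N] by (auto simp: eventually_sequentially abs_minus_commute)
        show "(\<lambda>m. 8 * r m) \<longlonglongrightarrow> 0" using tendsto_mult_right_zero[OF rlim] .
      qed
      then show "(\<lambda>m. gds_dist (X m) (w m) (w' m)) \<longlonglongrightarrow> dd w w'" by (rule LIM_zero_cancel)
    qed
    then show ?thesis by simp
  qed
  interpret F: feature_space P G c
  proof
    show "G \<noteq> {}" using chain_ne by (simp add: G_def)
    fix w w' assume "w \<in> space P" "w' \<in> space P"
    then obtain N where N: "w \<in> good N" "w' \<in> good N" using common unfolding spP by blast
    show "bdd_above ((\<lambda>f. \<bar>f w - f w'\<bar>) ` G)" by (rule G_bdd[OF N])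
  next
    show "{w' \<in> space P. (SUP f\<in>G. \<bar>f w - f w'\<bar>) < \<rho>} \<in> sets P" if "w \<in> space P" for w \<rho>
      using ball that unfolding dd_def spP by blast
    show "c i \<in> space P" for i using c S_sub unfolding spP by blast
    show "\<exists>i. (SUP f\<in>G. \<bar>f (c i) - f w\<bar>) < \<rho>" if w: "w \<in> space P" "0 < \<rho>" for w \<rho>
    proof -
      obtain q where q: "q \<in> S" "dd q w < \<rho>" using S_dense[of w \<rho>] w unfolding spP by blast
      then obtain i where "c i = q" using c by blast
      then show ?thesis using q(2) unfolding dd_def by blast
    qed
  qed
  obtain L :: "'a gds" and \<Phi> T N where L: "geometric_data_set L" and N: "N \<in> null_sets P"
    and \<Phi>: "\<Phi> \<in> P \<rightarrow>\<^sub>M law L" "distr P (law L) \<Phi> = law L" and T: "feats L = T ` G"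
    and T\<Phi>: "\<And>f w. f \<in> G \<Longrightarrow> w \<in> space P - N \<Longrightarrow> T f (\<Phi> w) = f w"
    by (rule F.realization[OF \<open>inj inj_real\<close>]) blast
  interpret L: gds_space L using L by unfold_locales
  have "near (X n) L (4 * r n) (4 * r n)" for n
  proof -
    let ?N = "law (X n) \<Otimes>\<^sub>M law L" and ?s = "\<lambda>w. (w n, \<Phi> w)"
    have coordP: "(\<lambda>w. w n) \<in> P \<rightarrow>\<^sub>M law (X n)" by (rule measP[OF coord])
    have s: "?s \<in> P \<rightarrow>\<^sub>M ?N" by (rule measurable_Pair[OF coordP \<Phi>(1)])
    let ?\<pi> = "distr P ?N ?s"
    have marg: "distr P (law (X n)) (\<lambda>w. w n) = law (X n)"
    proof (rule measure_eqI)
      fix A assume "A \<in> sets (distr P (law (X n)) (\<lambda>w. w n))"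
      then have A: "A \<in> sets (law (X n))" by simp
      let ?B = "{w \<in> space Q. w n \<in> A}"
      have B: "?B \<in> sets Q"
        using measurable_sets[OF coord A] by (simp add: vimage_def Int_def conj_commute)
      have "emeasure (distr P (law (X n)) (\<lambda>w. w n)) A = emeasure P (?B \<inter> \<Omega>)"
        using emeasure_distr[OF coordP A] \<Omega>_sub by (auto simp: spP intro!: arg_cong2[where f=emeasure])
      also have "\<dots> = emeasure Q (?B \<inter> \<Omega>)" by (rule P_em) auto
      also have "\<dots> = emeasure Q ?B"
      proof (rule emeasure_eq_AE)
        have "AE w in Q. w \<in> \<Omega>" using Q.prob_eq_1[OF \<Omega>_sets] \<Omega>1 by simp
        then show "AE w in Q. (w \<in> ?B \<inter> \<Omega>) = (w \<in> ?B)" by eventually_elim auto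
      qed (use B \<Omega>_sets in auto)
      also have "\<dots> = emeasure (law (X n)) A" by (rule Qn[OF A])
      finally show "emeasure (distr P (law (X n)) (\<lambda>w. w n)) A = emeasure (law (X n)) A" .
    qed simp
    have \<pi>: "?\<pi> \<in> couplings (X n) L"
      unfolding couplings_iff[OF X L] using P.prob_space_distr[OF s] marg \<Phi>(2)
      by (simp add: distr_distr[OF _ s] comp_def)
    \<comment> \<open>A feature of \<open>X n\<close> is related to the limits along all chains
      through it.\<close>
    define Rn where "Rn = (\<lambda>f. (f n, T (val f))) ` chain"
    have Rn: "full_rel (X n) L Rn"
    proof (rule full_relI)
      show "f \<in> feats (X n) \<and> g \<in> feats L" if "(f, g) \<in> Rn" for f g
        using that chainF T by (auto simp: Rn_def G_def)
      show "\<exists>g. (f, g) \<in> Rn" if "f \<in> feats (X n)" for f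
        using chain_ex[OF that] by (auto simp: Rn_def)
      show "\<exists>f. (f, g) \<in> Rn" if "g \<in> feats L" for g
        using that T by (auto simp: Rn_def G_def)
    qed
    have good_sub: "good n \<subseteq> \<Omega>" by (auto simp: \<Omega>_def)
    have Ns: "N \<in> sets P" "N \<subseteq> \<Omega>" using N sets.sets_into_space[of N P] by (auto simp: spP)
    have gs: "good n \<in> sets P" using P_sets[OF good_sets, of n] good_sub by (simp add: Int_absorb2)
    have "good n - N \<subseteq> ?s -` agree (X n) L Rn (4 * r n) \<inter> space P"
    proof
      fix w assume w: "w \<in> good n - N"
      then have wP: "w \<in> space P - N" "w \<in> space Q" using good_sub \<Omega>_sub by (auto simp: spP)
      have "\<bar>f n (w n) - T (val f) (\<Phi> w)\<bar> \<le> 4 * r n" if f: "f \<in> chain" for f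
        using val_close[OF f, of w n n] w T\<Phi>[OF _ wP(1), of "val f"] f by (auto simp: G_def)
      then show "w \<in> ?s -` agree (X n) L Rn (4 * r n) \<inter> space P"
        using wP win[of w n] measurable_space[OF \<Phi>(1), of w] by (auto simp: agree_iff Rn_def)
    qed
    then have "measure P (good n - N) \<le> measure P (?s -` agree (X n) L Rn (4 * r n) \<inter> space P)"
      by (rule P.finite_measure_mono) (rule measurable_sets[OF s agree_sets[OF X L Rn]])
    also have "\<dots> = measure ?\<pi> (agree (X n) L Rn (4 * r n))"
      by (rule measure_distr[symmetric, OF s agree_sets[OF X L Rn]])
    also have "measure P (good n - N) = measure P (good n)"
      by (rule measure_Diff_null_set[OF gs N])
    also have "\<dots> = measure Q (good n)" using P_em[OF good_sub] by (simp add: measure_def)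
    finally have "measure Q (good n) \<le> measure ?\<pi> (agree (X n) L Rn (4 * r n))" .
    then show ?thesis
      using good_large[of n] r0[of n] by (intro nearI[OF \<pi> Rn]) linarith
  qed
  then show ?thesis using L that by blast
qed

section \<open>The space of isomorphism classes\<close>

lemma gds_iso_refl:
  assumes X: "geometric_data_set X"
  shows "gds_iso X X"
  unfolding gds_iso_def
proof (intro bexI conjI)
  interpret X: gds_space X using X by unfold_locales
  show "(\<lambda>x. x) \<in> borel_of (gds_top X) \<rightarrow>\<^sub>M borel_of (gds_top X)" by simp
  show "distr (law X) (borel_of (gds_top X)) (\<lambda>x. x) = law X"
    by (rule distr_id2) (simp add: X.sets_law X.gds_top_eq)
  have "compose (pts X) f (\<lambda>x. x) = f" if "f \<in> feats_closure X" for f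
    using X.feats_closureD(1)[OF that] by (auto simp: Lip1_def compose_def PiE_iff extensional_def fun_eq_iff)
  then show "precomp (pts X) (feats_closure X) (\<lambda>x. x) = feats_closure X"
    unfolding precomp_def by (simp add: image_def)
qed

lemma gds_iso_iff_box_dist:
  assumes "geometric_data_set X" "geometric_data_set Y"
  shows "gds_iso X Y \<longleftrightarrow> box_dist X Y = 0"
  using box_zero_if_iso[OF assms] iso_if_box_zero[OF assms] by blast

lemma box_dist_eq_if_iso:
  assumes X: "geometric_data_set X" "geometric_data_set X'" and Y: "geometric_data_set Y" "geometric_data_set Y'"
    and iso: "gds_iso X X'" "gds_iso Y Y'"
  shows "box_dist X Y = box_dist X' Y'"
proof -
  have 0: "box_dist X X' = 0" "box_dist X' X = 0" "box_dist Y Y' = 0" "box_dist Y' Y = 0"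
    using box_zero_if_iso[OF X iso(1)] box_zero_if_iso[OF Y iso(2)] box_dist_sym X Y by metis+
  have "box_dist X Y \<le> box_dist X X' + (box_dist X' Y' + box_dist Y' Y)"
    using box_dist_triangle[OF X Y(1)] box_dist_triangle[OF X(2) Y(2,1)] by (meson add_left_mono order_trans)
  moreover have "box_dist X' Y' \<le> box_dist X' X + (box_dist X Y + box_dist Y Y')"
    using box_dist_triangle[OF X(2,1) Y(2)] box_dist_triangle[OF X(1) Y] by (meson add_left_mono order_trans)
  ultimately show ?thesis using 0 by simp
qed

section \<open>The box distance as a metric on isomorphism classes\<close>

abbreviation gds_iso_rel :: "('a gds \<times> 'a gds) set" where
  "gds_iso_rel \<equiv> {(X, Y). geometric_data_set X \<and> geometric_data_set Y \<and> gds_iso X Y}"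

text \<open>An isomorphism is a measurable map in one direction, so symmetry is hidden in the
  definition. Symmetry and transitivity are read off from the box distance, whose zeros are the
  isomorphic pairs.\<close>

lemma equiv_gds_iso: "equiv {X. geometric_data_set X} (gds_iso_rel :: ('a gds \<times> 'a gds) set)"
proof (rule equivI)
  show "gds_iso_rel \<subseteq> {X. geometric_data_set X} \<times> {X. geometric_data_set X}" by auto
  show "refl_on {X. geometric_data_set X} gds_iso_rel"
    unfolding refl_on_def using gds_iso_refl by auto
  show "sym gds_iso_rel"
    unfolding sym_def using gds_iso_iff_box_dist box_dist_sym by (metis (mono_tags, lifting) case_prodD case_prodI mem_Collect_eq)
  show "trans (gds_iso_rel :: ('a gds \<times> 'a gds) set)"
  proof (rule transI)
    fix X Y Z :: "'a gds"
    assume "(X, Y) \<in> gds_iso_rel" "(Y, Z) \<in> gds_iso_rel"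
    then have *: "geometric_data_set X" "geometric_data_set Y" "geometric_data_set Z"
      and iso: "box_dist X Y = 0" "box_dist Y Z = 0"
      using gds_iso_iff_box_dist by auto
    have "box_dist X Z = 0" using box_dist_triangle[OF *] iso by simp
    then show "(X, Z) \<in> gds_iso_rel" using * gds_iso_iff_box_dist by auto
  qed
qed

definition gds_class :: "'a gds \<Rightarrow> 'a gds set" where
  "gds_class X = gds_iso_rel `` {X}"

lemma gds_class_in: "geometric_data_set X \<Longrightarrow> gds_class X \<in> gds_classes"
  unfolding gds_class_def gds_classes_def by (rule quotientI) simp

lemma gds_classesE:
  assumes "A \<in> gds_classes"
  obtains X where "geometric_data_set X" "A = gds_class X"
  using assms unfolding gds_classes_def gds_class_def by (auto elim: quotientE)

lemma box_dist_finite: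
  assumes "geometric_data_set X" "geometric_data_set Y"
  shows "ennreal (enn2real (box_dist X Y)) = box_dist X Y"
  using box_dist_le_1[OF assms] by (intro ennreal_enn2real) (auto simp: less_top[symmetric] top_unique)

lemma box_dist_classes_class:
  assumes X: "geometric_data_set X" and Y: "geometric_data_set Y"
  shows "box_dist_classes (gds_class X) (gds_class Y) = enn2real (box_dist X Y)"
proof -
  have "(\<lambda>(X, Y). box_dist X Y) ` (gds_class X \<times> gds_class Y) = {box_dist X Y}"
  proof
    show "(\<lambda>(X, Y). box_dist X Y) ` (gds_class X \<times> gds_class Y) \<subseteq> {box_dist X Y}"
      using box_dist_eq_if_iso[OF X _ Y] by (fastforce simp: gds_class_def)
    have "(X, Y) \<in> gds_class X \<times> gds_class Y"
      using X Y gds_iso_refl by (auto simp: gds_class_def)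
    then show "{box_dist X Y} \<subseteq> (\<lambda>(X, Y). box_dist X Y) ` (gds_class X \<times> gds_class Y)" by force
  qed
  then show ?thesis
    using gds_class_in[OF X] gds_class_in[OF Y] by (simp add: box_dist_classes_def)
qed

lemma Metric_space_gds_classes: "Metric_space gds_classes box_dist_classes"
proof
  fix A B :: "'a gds set"
  show "0 \<le> box_dist_classes A B" by (simp add: box_dist_classes_def)
  show "box_dist_classes A B = box_dist_classes B A"
  proof (cases "A \<in> gds_classes \<and> B \<in> gds_classes")
    case True
    then obtain X Y where XY: "geometric_data_set X" "A = gds_class X" "geometric_data_set Y" "B = gds_class Y"
      by (meson gds_classesE)
    show ?thesis
      unfolding XY(2,4) box_dist_classes_class[OF XY(1,3)] box_dist_classes_class[OF XY(3,1)]
        box_dist_sym[OF XY(1,3)] ..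
  qed (auto simp: box_dist_classes_def)
next
  fix A B :: "'a gds set" assume "A \<in> gds_classes" "B \<in> gds_classes"
  then obtain X Y where XY: "geometric_data_set X" "A = gds_class X" "geometric_data_set Y" "B = gds_class Y"
    by (meson gds_classesE)
  have "box_dist_classes A B = 0 \<longleftrightarrow> box_dist X Y = 0"
    unfolding XY(2,4) box_dist_classes_class[OF XY(1,3)]
    using box_dist_finite[OF XY(1,3)] by (metis enn2real_0 ennreal_0)
  also have "\<dots> \<longleftrightarrow> A = B"
    unfolding XY(2,4) gds_class_def
    using eq_equiv_class_iff[OF equiv_gds_iso, of X Y] XY gds_iso_iff_box_dist[of X Y] by simp
  finally show "box_dist_classes A B = 0 \<longleftrightarrow> A = B" .
next
  fix A B C :: "'a gds set" assume "A \<in> gds_classes" "B \<in> gds_classes" "C \<in> gds_classes"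
  then obtain X Y Z where XYZ: "geometric_data_set X" "A = gds_class X" "geometric_data_set Y" "B = gds_class Y"
      "geometric_data_set Z" "C = gds_class Z"
    by (meson gds_classesE)
  have "ennreal (enn2real (box_dist X Z)) \<le> ennreal (enn2real (box_dist X Y) + enn2real (box_dist Y Z))"
    using box_dist_triangle[OF XYZ(1,3,5)] XYZ by (simp add: box_dist_finite ennreal_plus)
  then have "enn2real (box_dist X Z) \<le> enn2real (box_dist X Y) + enn2real (box_dist Y Z)"
    by (subst (asm) ennreal_le_iff) simp_all
  then show "box_dist_classes A C \<le> box_dist_classes A B + box_dist_classes B C"
    using XYZ by (simp add: box_dist_classes_class)
qed

interpretation classes: Metric_space "gds_classes :: 'a gds set set" box_dist_classes
  by (rule Metric_space_gds_classes)


section \<open>Completeness\<close>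

lemma mcomplete_gds_classes:
  fixes inj_real :: "real \<Rightarrow> 'a"
  assumes "inj inj_real"
  shows "Metric_space.mcomplete (gds_classes :: 'a gds set set) box_dist_classes"
  unfolding classes.mcomplete_def
proof (intro allI impI)
  fix \<sigma> :: "nat \<Rightarrow> 'a gds set" assume \<sigma>: "classes.MCauchy \<sigma>"
  then have "\<sigma> n \<in> gds_classes" for n unfolding classes.MCauchy_def by auto
  then have "\<forall>n. \<exists>X. geometric_data_set X \<and> \<sigma> n = gds_class X" by (meson gds_classesE)
  then obtain X where X: "\<And>n. geometric_data_set (X n)" and \<sigma>X: "\<And>n. \<sigma> n = gds_class (X n)" by metis
  define r :: "nat \<Rightarrow> real" where "r = (\<lambda>n. (1 / 2) ^ n)"
  have r: "0 < r n" for n by (simp add: r_def)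
  have "\<forall>n. \<exists>N. \<forall>m m'. N \<le> m \<longrightarrow> N \<le> m' \<longrightarrow> box_dist_classes (\<sigma> m) (\<sigma> m') < r n"
    using \<sigma> r unfolding classes.MCauchy_def by blast
  then obtain N where N: "\<And>n m m'. N n \<le> m \<Longrightarrow> N n \<le> m' \<Longrightarrow> box_dist_classes (\<sigma> m) (\<sigma> m') < r n" by metis
  \<comment> \<open>A subsequence with consecutive distances below \<open>r n\<close>, as
    \<open>ex_limit\<close> asks; a Cauchy sequence converges along with any of its
    subsequences.\<close>
  have "\<exists>s. \<forall>n. N n \<le> s n \<and> s n < s (Suc n)"
  proof (rule dependent_nat_choice)
    show "\<exists>y. N (Suc n) \<le> y \<and> x < y" for x n
      by (rule exI[of _ "max (N (Suc n)) (Suc x)"]) simp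
  qed blast
  then obtain s where s: "\<And>n. N n \<le> s n" "\<And>n. s n < s (Suc n)" by blast
  have near: "near (X (s n)) (X (s (Suc n))) (r n) (r n)" for n
  proof -
    have "enn2real (box_dist (X (s n)) (X (s (Suc n)))) < r n"
      using N[of n "s n" "s (Suc n)"] s(1)[of n] s(2)[of n] by (simp add: \<sigma>X box_dist_classes_class X)
    then have "box_dist (X (s n)) (X (s (Suc n))) < ennreal (r n)"
      using box_dist_finite[OF X X] ennreal_lessI[OF r] by metis
    from near_if_box_less[OF X X this] show ?thesis
      by (rule near_mono[OF X X]) (use r[of n] in auto)
  qed
  obtain L :: "'a gds" where L: "geometric_data_set L" "\<And>n. near (X (s n)) L (4 * r n) (4 * r n)"
    unfolding r_def by (rule ex_limit[where X="\<lambda>n. X (s n)", OF assms X near[unfolded r_def]]) blast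
  \<comment> \<open>The feature error \<open>4 * r n\<close> corresponds to the distance
    \<open>8 * r n\<close>, because a distance \<open>c\<close> goes with the error
    \<open>c / 2\<close>.\<close>
  have le: "box_dist_classes (\<sigma> (s n)) (gds_class L) \<le> 8 * r n" for n
  proof -
    have "near (X (s n)) L (8 * r n) (8 * r n / 2)"
      by (rule near_mono[OF X L(1) L(2)]) (use r[of n] in auto)
    then have "box_dist (X (s n)) L \<le> ennreal (8 * r n)"
      by (rule box_le_if_near[OF X L(1)]) (use r[of n] in auto)
    then have "enn2real (box_dist (X (s n)) L) \<le> enn2real (ennreal (8 * r n))"
      by (rule enn2real_mono) simp
    then show ?thesis using r[of n] by (simp add: \<sigma>X box_dist_classes_class X L)
  qed
  have "limitin classes.mtopology (\<sigma> \<circ> s) (gds_class L) sequentially"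
    unfolding classes.limitin_metric_dist_null
  proof (intro conjI)
    have "r \<longlonglongrightarrow> 0" unfolding r_def by (intro LIMSEQ_power_zero) simp
    from tendsto_mult_right_zero[OF this, of 8]
    show "(\<lambda>n. box_dist_classes ((\<sigma> \<circ> s) n) (gds_class L)) \<longlonglongrightarrow> 0"
      by (rule Lim_null_comparison[rotated]) (use le in \<open>simp add: classes.nonneg\<close>)
  qed (simp_all add: \<sigma>X gds_class_in X L)
  then have "limitin classes.mtopology \<sigma> (gds_class L) sequentially"
    by (rule classes.MCauchy_convergent_subsequence[OF \<sigma>, rotated]) (use s(2) in \<open>simp add: strict_mono_Suc_iff\<close>)
  then show "\<exists>x. limitin classes.mtopology \<sigma> x sequentially" by blast
qed

section \<open>Non-separability\<close>

text \<open>One-point spaces are told apart by their feature sets alone. The feature sets made of integer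
  constants are at Hausdorff distance at least 1 from each other.\<close>

definition point_gds :: "'a \<Rightarrow> nat set \<Rightarrow> 'a gds" where
  "point_gds a K = \<lparr>pts = {a}, feats = (\<lambda>k. \<lambda>x\<in>{a}. real k) ` K, law = return (count_space {a}) a\<rparr>"

lemma geometric_data_set_point:
  assumes "K \<noteq> {}"
  shows "geometric_data_set (point_gds a K)"
proof -
  let ?X = "point_gds a K"
  have sel: "pts ?X = {a}" "feats ?X = (\<lambda>k. \<lambda>x\<in>{a}. real k) ` K" "law ?X = return (count_space {a}) a"
    by (simp_all add: point_gds_def)
  define d0 :: "'a \<Rightarrow> 'a \<Rightarrow> real" where "d0 = (\<lambda>x y. 0)"
  have d: "gds_dist ?X = d0"
    using assms by (intro ext) (simp add: gds_dist_def sel image_comp d0_def)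
  interpret Metric_space "{a}" d0 by unfold_locales (auto simp: d0_def)
  have top: "gds_top ?X = mtopology" unfolding gds_top_def sel(1) d ..
  have "mcomplete"
    unfolding mcomplete_def
  proof (intro allI impI)
    fix \<sigma> assume "MCauchy \<sigma>"
    then have "\<sigma> n = a" for n unfolding MCauchy_def by auto
    then have "limitin mtopology \<sigma> a sequentially" unfolding limitin_metric by (simp add: d0_def)
    then show "\<exists>x. limitin mtopology \<sigma> x sequentially" by blast
  qed
  moreover have "separable_space mtopology"
    unfolding separable_space_def by (rule exI[of _ "{a}"]) (use closure_of_topspace[of mtopology] in simp)
  moreover have "sets (borel_of mtopology) = Pow {a}"
  proof
    show "sets (borel_of mtopology) \<subseteq> Pow {a}"
      using sets.sets_into_space[of _ "borel_of mtopology"] by auto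
    show "Pow {a} \<subseteq> sets (borel_of mtopology)"
      using sets.top[of "borel_of mtopology"] by (auto simp: subset_singleton_iff)
  qed
  moreover have "prob_space (return (count_space {a}) a)"
    by (rule prob_space_return) simp
  moreover have "supp_of mtopology (return (count_space {a}) a) = {a}"
    unfolding supp_of_def using openin_subset[of mtopology] by (auto simp: indicator_def)
  ultimately show ?thesis
    unfolding geometric_data_set_def top d using assms Metric_space_axioms
    by (auto simp: sel intro!: bdd_aboveI2[where M=0])
qed

text \<open>A distance below 1 leaves positive mass on \<open>agree\<close>, which therefore
  contains the only pair of points. Related features are then natural numbers closer than 1, hence
  equal, and fullness gives \<open>A = B\<close>.\<close>

lemma box_dist_point_ge_1:
  assumes A: "A \<noteq> {}" and B: "B \<noteq> {}" and "A \<noteq> B"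
  shows "1 \<le> box_dist (point_gds a A) (point_gds a B)"
proof (rule ccontr)
  note gA = geometric_data_set_point[OF A, of a] and gB = geometric_data_set_point[OF B, of a]
  let ?X = "point_gds a A" and ?Y = "point_gds a B"
  assume "\<not> ?thesis"
  then obtain q where q: "box_dist ?X ?Y < q" "q < 1" using dense by (meson not_le)
  then obtain c where c: "q = ennreal c" "0 \<le> c" by (cases q) auto
  then have c1: "c < 1" using q(2) by simp
  obtain \<pi> R where \<pi>: "\<pi> \<in> couplings ?X ?Y" and R: "full_rel ?X ?Y R"
    and m: "1 - c \<le> measure \<pi> (agree ?X ?Y R (c / 2))"
    using near_if_box_less[OF gA gB] q(1) c unfolding near_def by blast
  then have "agree ?X ?Y R (c / 2) \<noteq> {}" using c1 by auto
  then have aa: "(a, a) \<in> agree ?X ?Y R (c / 2)"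
    by (auto simp: agree_def point_gds_def)
  have close: "f a = g a" if fg: "(f, g) \<in> R" for f g
  proof -
    obtain k l where kl: "f a = real k" "g a = real l"
      using full_relD(1,2)[OF R fg] by (auto simp: point_gds_def)
    have "\<bar>f a - g a\<bar> \<le> c / 2" using aa fg by (auto simp: agree_iff)
    then have "\<bar>real k - real l\<bar> < 1" using c1 kl by simp
    then have "k = l" by linarith
    then show ?thesis using kl by simp
  qed
  have "k \<in> B" if "k \<in> A" for k
  proof -
    obtain g where g: "((\<lambda>x\<in>{a}. real k), g) \<in> R"
      using full_relD(3)[OF R, of "\<lambda>x\<in>{a}. real k"] \<open>k \<in> A\<close> by (auto simp: point_gds_def)
    show ?thesis using close[OF g] full_relD(2)[OF R g] by (auto simp: point_gds_def)
  qed
  moreover have "k \<in> A" if "k \<in> B" for k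
  proof -
    obtain f where f: "(f, (\<lambda>x\<in>{a}. real k)) \<in> R"
      using full_relD(4)[OF R, of "\<lambda>x\<in>{a}. real k"] \<open>k \<in> B\<close> by (auto simp: point_gds_def)
    show ?thesis using close[OF f] full_relD(1)[OF R f] by (auto simp: point_gds_def)
  qed
  ultimately show False using \<open>A \<noteq> B\<close> by blast
qed

text \<open>The non-empty sets of naturals give uncountably many classes at mutual distance at least
  1. A dense set has a member within \<open>1 / 2\<close> of each, and these members are
  distinct.\<close>

lemma not_separable_gds_classes:
  "\<not> separable_space (Metric_space.mtopology (gds_classes :: 'a gds set set) box_dist_classes)"
proof
  assume "separable_space (classes.mtopology :: 'a gds set topology)"
  then obtain D where D: "countable D" "D \<subseteq> gds_classes" "classes.mtopology closure_of D = (gds_classes :: 'a gds set set)"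
    unfolding separable_space_def by auto
  define pt where "pt K = gds_class (point_gds (undefined :: 'a) K)" for K
  have pt: "pt K \<in> gds_classes" if "K \<noteq> {}" for K
    unfolding pt_def by (rule gds_class_in[OF geometric_data_set_point[OF that]])
  have far: "1 \<le> box_dist_classes (pt A) (pt B)" if "A \<noteq> {}" "B \<noteq> {}" "A \<noteq> B" for A B
  proof -
    note g = geometric_data_set_point[OF that(1), of "undefined :: 'a"] geometric_data_set_point[OF that(2), of "undefined :: 'a"]
    have "ennreal 1 \<le> ennreal (enn2real (box_dist (point_gds (undefined :: 'a) A) (point_gds (undefined :: 'a) B)))"
      unfolding box_dist_finite[OF g] using box_dist_point_ge_1[OF that, of "undefined :: 'a"] by simp
    then show ?thesis
      unfolding pt_def box_dist_classes_class[OF g] by (subst (asm) ennreal_le_iff) simp_all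
  qed
  have "\<exists>y\<in>D. box_dist_classes (pt K) y < 1 / 2" if "K \<noteq> {}" for K
  proof -
    have "pt K \<in> classes.mtopology closure_of D" using pt[OF that] D(3) by simp
    then obtain y where "y \<in> D" "y \<in> classes.mball (pt K) (1 / 2)"
      unfolding classes.metric_closure_of by (auto dest!: spec[of _ "1 / 2"])
    then show ?thesis by auto
  qed
  then obtain y where y: "\<And>K. K \<noteq> {} \<Longrightarrow> y K \<in> D \<and> box_dist_classes (pt K) (y K) < 1 / 2" by metis
  have "inj_on y (- {{}})"
  proof (rule inj_onI, rule ccontr)
    fix A B :: "nat set" assume AB: "A \<in> - {{}}" "B \<in> - {{}}" "y A = y B" "A \<noteq> B"
    then have ne: "A \<noteq> {}" "B \<noteq> {}" by auto
    have "box_dist_classes (pt A) (pt B) \<le> box_dist_classes (pt A) (y A) + box_dist_classes (y A) (pt B)"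
      using y[OF ne(1)] D(2) by (intro classes.triangle pt ne) auto
    also have "\<dots> < 1"
      using y[OF ne(1)] y[OF ne(2)] AB(3) classes.commute[of "pt B" "y A"] by simp
    finally show False using far[OF ne AB(4)] by simp
  qed
  moreover have "countable (y ` (- {{}}))"
    by (rule countable_subset[OF _ D(1)]) (use y in auto)
  ultimately have "countable (- {{}} :: nat set set)" by (rule countable_image_inj_on[rotated])
  then have "countable (insert {} (- {{}}) :: nat set set)" by (rule countable_insert)
  moreover have "insert {} (- {{}}) = (UNIV :: nat set set)" by auto
  ultimately have "countable (UNIV :: nat set set)" by simp
  moreover obtain g :: "nat set \<Rightarrow> real" where "bij_betw g UNIV UNIV"
    using nat_sets_eqpoll_reals unfolding eqpoll_def by blast
  ultimately have "countable (UNIV :: real set)"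
    by (metis bij_betw_imp_surj_on countable_image)
  then show False using uncountable_UNIV_real by blast
qed

theorem theorem1p4:
  assumes "\<exists>e :: real \<Rightarrow> 'a. inj e"
  shows "Metric_space (gds_classes :: 'a gds set set) box_dist_classes \<and>
    Metric_space.mcomplete (gds_classes :: 'a gds set set) box_dist_classes \<and>
    \<not> separable_space
        (Metric_space.mtopology (gds_classes :: 'a gds set set) box_dist_classes)"
  using assms Metric_space_gds_classes mcomplete_gds_classes not_separable_gds_classes by blast

end
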